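(* Let $H$ be a connected locally semicomplete digraph. If $H$ is acyclic or $H$ is a directed cycle $\overrightarrow{C_k}$ with $k\ge 2$, then MinHOM($H$) is polynomial-time solvable.
   Context: All digraphs are finite, loopless and without parallel arcs; connected means the underlying undirected graph is connected. A homomorphism of $G$ to $H$ is a map $f:V(G)\to V(H)$ with $f(u)f(v)\in A(H)$ whenever $uv\in A(G)$. MinHOM($H$): given a digraph $G$ and (rational) costs $c_i(u)$, $u\in V(G)$, $i\in V(H)$, decide whether a homomorphism of $G$ to $H$ exists and, if so, find one minimizing $\sum_{u}c_{f(u)}(u)$. A digraph is semicomplete if every pair of distinct vertices is joined by at least one arc; it is locally semicomplete if for every vertex $x$ the in-neighbors of $x$ induce a semicomplete digraph and the out-neighbors of $x$ induce a semicomplete digraph. $\overrightarrow{C_k}$ is the directed cycle on $k$ vertices. *)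

theory Defs
  imports
    "Graph_Theory.Graph_Theory"
    "HOL-Computational_Algebra.Polynomial"
begin

section \<open>Digraphs\<close>

definition semicomplete :: "('a, 'b) pre_digraph \<Rightarrow> bool" where
  "semicomplete D \<longleftrightarrow>
     (\<forall>u\<in>verts D. \<forall>v\<in>verts D. u \<noteq> v \<longrightarrow> u \<rightarrow>\<^bsub>D\<^esub> v \<or> v \<rightarrow>\<^bsub>D\<^esub> u)"

definition locally_semicomplete :: "('a, 'b) pre_digraph \<Rightarrow> bool" where
  "locally_semicomplete D \<longleftrightarrow>
     (\<forall>x\<in>verts D. semicomplete (D \<restriction> {y. y \<rightarrow>\<^bsub>D\<^esub> x}) \<and> semicomplete (D \<restriction> {y. x \<rightarrow>\<^bsub>D\<^esub> y}))"

text \<open>Cycles of \<^const>\<open>pre_digraph.cycle\<close> are directed, and a pair of opposite arcs is a cycle.\<close>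

definition acyclic_digraph :: "('a, 'b) pre_digraph \<Rightarrow> bool" where
  "acyclic_digraph D \<longleftrightarrow> \<not> (\<exists>p. pre_digraph.cycle D p)"

definition directed_cycle :: "nat \<Rightarrow> nat pair_pre_digraph" where
  "directed_cycle k = \<lparr> pverts = {0..<k}, parcs = {(i, Suc i mod k) | i. i < k} \<rparr>"

definition digraph_hom ::
  "('a, 'b) pre_digraph \<Rightarrow> ('c, 'd) pre_digraph \<Rightarrow> ('a \<Rightarrow> 'c) \<Rightarrow> bool" where
  "digraph_hom G H f \<longleftrightarrow>
     (\<forall>u\<in>verts G. f u \<in> verts H) \<and> (\<forall>u v. u \<rightarrow>\<^bsub>G\<^esub> v \<longrightarrow> f u \<rightarrow>\<^bsub>H\<^esub> f v)"

definition hom_cost :: "('a, 'b) pre_digraph \<Rightarrow> ('a \<Rightarrow> 'c \<Rightarrow> rat) \<Rightarrow> ('a \<Rightarrow> 'c) \<Rightarrow> rat" where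
  "hom_cost G c f = (\<Sum>u\<in>verts G. c u (f u))"

definition min_cost_hom ::
  "('a, 'b) pre_digraph \<Rightarrow> ('c, 'd) pre_digraph \<Rightarrow> ('a \<Rightarrow> 'c \<Rightarrow> rat) \<Rightarrow> ('a \<Rightarrow> 'c) \<Rightarrow> bool" where
  "min_cost_hom G H c f \<longleftrightarrow>
     digraph_hom G H f \<and> (\<forall>g. digraph_hom G H g \<longrightarrow> hom_cost G c f \<le> hom_cost G c g)"


section \<open>Polynomial time\<close>

text \<open>
  The machine model is the WHILE language over binary trees of N. D. Jones (\<^emph>\<open>Computability and
  Complexity from a Programming Perspective\<close>), whose polynomial-time problems are those of
  Turing machines. Programs inspect data only through head, tail and the test for \<open>Leaf\<close>.
  Jones charges one unit per elementary operation, relying on pointers and sharing. Here every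
  evaluated subexpression is charged the full size of its value, so that no program
  can build, use or return large data within small time.
\<close>

datatype btree = Leaf | Fork btree btree

datatype expr = Var nat | Nil_E | Cons_E expr expr | Hd expr | Tl expr

datatype com =
    Skip
  | Assign nat expr
  | Seq com com
  | If nat com com
  | While nat com

type_synonym store = "nat \<Rightarrow> btree"

fun btree_hd :: "btree \<Rightarrow> btree" where
  "btree_hd Leaf = Leaf"
| "btree_hd (Fork a b) = a"

fun btree_tl :: "btree \<Rightarrow> btree" where
  "btree_tl Leaf = Leaf"
| "btree_tl (Fork a b) = b"

fun expr_val :: "expr \<Rightarrow> store \<Rightarrow> btree" where
  "expr_val (Var x) s = s x"
| "expr_val Nil_E s = Leaf"
| "expr_val (Cons_E e1 e2) s = Fork (expr_val e1 s) (expr_val e2 s)"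
| "expr_val (Hd e) s = btree_hd (expr_val e s)"
| "expr_val (Tl e) s = btree_tl (expr_val e s)"

text \<open>The function \<^const>\<open>size\<close> on \<^typ>\<open>btree\<close> counts the \<open>Fork\<close> nodes.\<close>

fun expr_cost :: "expr \<Rightarrow> store \<Rightarrow> nat" where
  "expr_cost (Var x) s = Suc (size (s x))"
| "expr_cost Nil_E s = 1"
| "expr_cost (Cons_E e1 e2) s =
     expr_cost e1 s + expr_cost e2 s + Suc (size (expr_val (Cons_E e1 e2) s))"
| "expr_cost (Hd e) s = expr_cost e s + Suc (size (expr_val (Hd e) s))"
| "expr_cost (Tl e) s = expr_cost e s + Suc (size (expr_val (Tl e) s))"

text \<open>\<open>exec p s t s'\<close>: started in store \<open>s\<close>, program \<open>p\<close> halts in store \<open>s'\<close> after time \<open>t\<close>.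
  The value \<open>Leaf\<close> counts as false.\<close>

inductive exec :: "com \<Rightarrow> store \<Rightarrow> nat \<Rightarrow> store \<Rightarrow> bool" where
  Skip: "exec Skip s 1 s"
| Assign: "exec (Assign x e) s (Suc (expr_cost e s)) (s(x := expr_val e s))"
| Seq: "exec c1 s t1 s1 \<Longrightarrow> exec c2 s1 t2 s2 \<Longrightarrow> exec (Seq c1 c2) s (Suc (t1 + t2)) s2"
| If_true: "s x \<noteq> Leaf \<Longrightarrow> exec c1 s t s' \<Longrightarrow> exec (If x c1 c2) s (Suc t) s'"
| If_false: "s x = Leaf \<Longrightarrow> exec c2 s t s' \<Longrightarrow> exec (If x c1 c2) s (Suc t) s'"
| While_false: "s x = Leaf \<Longrightarrow> exec (While x c) s 1 s"
| While_true: "s x \<noteq> Leaf \<Longrightarrow> exec c s t1 s1 \<Longrightarrow> exec (While x c) s1 t2 s2 \<Longrightarrow>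
    exec (While x c) s (Suc (t1 + t2)) s2"

inductive_cases exec_SkipE: "exec Skip s t s'"
inductive_cases exec_AssignE: "exec (Assign x e) s t s'"
inductive_cases exec_SeqE: "exec (Seq c1 c2) s t s'"
inductive_cases exec_IfE: "exec (If x c1 c2) s t s'"
inductive_cases exec_WhileE: "exec (While x c) s t s'"

lemma exec_deterministic:
  "exec p s t s' \<Longrightarrow> exec p s u s'' \<Longrightarrow> u = t \<and> s'' = s'"
proof (induction arbitrary: u s'' rule: exec.induct)
  case Skip
  then show ?case by (rule exec_SkipE) simp
next
  case Assign
  then show ?case by (rule exec_AssignE) simp
next
  case (Seq c1 s t1 s1 c2 t2 s2)
  from Seq.prems obtain v1 r v2
    where "u = Suc (v1 + v2)" and 1: "exec c1 s v1 r" and 2: "exec c2 r v2 s''"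
    by (rule exec_SeqE)
  with Seq.IH(1)[OF 1] Seq.IH(2)[of v2 s''] show ?case by simp
next
  case (If_true s x c1 t s' c2)
  from If_true.prems show ?case
    by (rule exec_IfE) (use If_true.hyps(1) in \<open>simp_all add: If_true.IH\<close>)
next
  case (If_false s x c2 t s' c1)
  from If_false.prems show ?case
    by (rule exec_IfE) (use If_false.hyps(1) in \<open>simp_all add: If_false.IH\<close>)
next
  case (While_false s x c)
  from While_false.prems show ?case
    by (rule exec_WhileE) (use While_false.hyps in simp_all)
next
  case (While_true s x c t1 s1 t2 s2)
  from While_true.prems obtain v1 r v2
    where "u = Suc (v1 + v2)" and 1: "exec c s v1 r" and 2: "exec (While x c) r v2 s''"
    by (rule exec_WhileE) (use While_true.hyps(1) in blast)+
  with While_true.IH(1)[OF 1] While_true.IH(2)[of v2 s''] show ?case by simp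
qed

text \<open>
  A search problem is given by its instances, their encoding and the correct answers.
  Variable 0 holds the input and the output; all other variables start as \<open>Leaf\<close>.
\<close>

definition poly_time_solvable ::
  "'i set \<Rightarrow> ('i \<Rightarrow> btree) \<Rightarrow> ('i \<Rightarrow> btree \<Rightarrow> bool) \<Rightarrow> bool" where
  "poly_time_solvable I enc ans \<longleftrightarrow>
     (\<exists>(p :: com) (q :: nat poly). \<forall>x\<in>I. \<exists>t s.
        exec p ((\<lambda>_. Leaf)(0 := enc x)) t s \<and> t \<le> poly q (size (enc x)) \<and> ans x (s 0))"


section \<open>Encodings\<close>

fun enc_bool :: "bool \<Rightarrow> btree" where
  "enc_bool False = Leaf"
| "enc_bool True = Fork Leaf Leaf"

fun enc_list :: "('a \<Rightarrow> btree) \<Rightarrow> 'a list \<Rightarrow> btree" where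
  "enc_list e [] = Leaf"
| "enc_list e (x # xs) = Fork (e x) (enc_list e xs)"

text \<open>Binary, least significant bit first.\<close>

fun enc_nat :: "nat \<Rightarrow> btree" where
  "enc_nat n = (if n = 0 then Leaf else Fork (enc_bool (odd n)) (enc_nat (n div 2)))"

declare enc_nat.simps [simp del]

definition enc_int :: "int \<Rightarrow> btree" where
  "enc_int k = Fork (enc_bool (k < 0)) (enc_nat (nat \<bar>k\<bar>))"

definition enc_rat :: "rat \<Rightarrow> btree" where
  "enc_rat r = Fork (enc_int (fst (quotient_of r))) (enc_int (snd (quotient_of r)))"


section \<open>The problem MinHOM(H)\<close>

text \<open>
  An instance is a digraph on the vertex set \<open>{0..<n}\<close> together with costs. It is presented as
  its adjacency matrix and its cost matrix, whose columns follow an enumeration \<open>hs\<close> of the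
  vertices of the fixed digraph \<open>H\<close>.
\<close>

type_synonym 'a minhom_instance = "nat pair_pre_digraph \<times> (nat \<Rightarrow> 'a \<Rightarrow> rat)"

definition minhom_instances :: "'a minhom_instance set" where
  "minhom_instances = {(G, c). pair_digraph G \<and> (\<exists>n. pverts G = {0..<n})}"

definition enc_minhom :: "'a list \<Rightarrow> 'a minhom_instance \<Rightarrow> btree" where
  "enc_minhom hs = (\<lambda>(G, c). let vs = [0..<card (pverts G)] in
     Fork (enc_list (\<lambda>u. enc_list (\<lambda>v. enc_bool ((u, v) \<in> parcs G)) vs) vs)
          (enc_list (\<lambda>u. enc_list (\<lambda>i. enc_rat (c u i)) hs) vs))"

text \<open>
  The answer is \<open>Leaf\<close> if there is no homomorphism, and otherwise \<open>Fork Leaf\<close> of the list of the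
  images of \<open>0, 1, \<dots>, n - 1\<close> under an optimal one, given by their positions in \<open>hs\<close>.
\<close>

definition minhom_answer ::
  "('a, 'b) pre_digraph \<Rightarrow> 'a list \<Rightarrow> 'a minhom_instance \<Rightarrow> btree \<Rightarrow> bool" where
  "minhom_answer H hs = (\<lambda>(G, c) out.
     if \<exists>f. digraph_hom (with_proj G) H f
     then \<exists>f is. min_cost_hom (with_proj G) H c f
            \<and> set is \<subseteq> {0..<length hs}
            \<and> map f [0..<card (pverts G)] = map (\<lambda>i. hs ! i) is
            \<and> out = Fork Leaf (enc_list enc_nat is)
     else out = Leaf)"

definition MinHOM_poly_time :: "('a, 'b) pre_digraph \<Rightarrow> bool" where
  "MinHOM_poly_time H \<longleftrightarrow>
     (\<forall>hs. distinct hs \<and> set hs = verts H \<longrightarrow>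
        poly_time_solvable minhom_instances (enc_minhom hs) (minhom_answer H hs))"

end

theory Submission
  imports Defs
begin

text \<open>
  If \<open>H\<close> is acyclic, local semicompleteness makes reachability a total order on the vertices, and an
  arc between two vertices of this order forces all forward arcs between vertices in between. So the
  condition on a homomorphism at an arc \<open>uv\<close> is a set of implications between threshold
  statements on the positions of \<open>f u\<close> and \<open>f v\<close>. If \<open>H\<close> is a directed cycle, a
  spanning forest yields a homomorphism whenever there is one, all others arise by rotating the labels
  of each component, and the constraint becomes equality of the rotations, again a set of
  threshold implications. Minimizing a sum of unary costs under such implications is a
  minimum cut problem.

  Capacities are processed bit by bit. After a cut of residual value 0, doubling and adding the next bits leaves
  a cut of value at most the number of arcs, so that many augmentations by one unit
  suffice. No flow is needed in the argument: pushing one unit along a path changes every cut between source and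
  sink by the same amount.

  Programs are avoided by showing that the functions computable in polynomial time contain
  the basic operations and are closed under composition, case distinction and folds whose accumulators
  stay polynomially bounded.
\<close>

section \<open>Encodable types\<close>

text \<open>Repeating a polynomial-time step can produce exponentially large values, and the machine
  charges for size. So nearly all algorithms below are folds with a number of rounds fixed by a list
  length, and each fold comes with a bound on its accumulator. Measures that grow by a fixed amount
  per round are preferred to exact sizes.

  Both kinds of \<open>H\<close> are served by one interface: each input vertex gets its own
  ordering of the labels, and only indices in these orderings occur in the implications. The
  implications then depend on \<open>H\<close> alone and can be built into the program as constants;
  only the orderings are computed from the input.

  For a directed cycle the orderings are meaningful only if a homomorphism exists, and the cut
  respects the implications only if they can be satisfied at all. Existence is not decided
  beforehand: the labelling read off the cut is checked at the end. If the check fails there is no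
  homomorphism, since otherwise the orderings would be correct and the cut would yield one.\<close>

class encodable =
  fixes enc :: "'a \<Rightarrow> btree"
  assumes enc_inject: "enc x = enc y \<Longrightarrow> x = y"

lemma enc_eq_iff [simp]: "enc x = enc y \<longleftrightarrow> x = y"
  using enc_inject by blast

instantiation btree :: encodable
begin
definition enc_btree :: "btree \<Rightarrow> btree" where [simp]: "enc_btree x = x"
instance by standard simp
end

instantiation bool :: encodable
begin
definition encode_bool: "enc = enc_bool"
instance
proof
  fix x y :: bool show "enc x = enc y \<Longrightarrow> x = y"
    by (cases x; cases y) (simp_all add: encode_bool)
qed
end

instantiation prod :: (encodable, encodable) encodable
begin
definition enc_prod :: "'a \<times> 'b \<Rightarrow> btree" where "enc_prod = (\<lambda>(a, b). Fork (enc a) (enc b))"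
instance by standard (auto simp: enc_prod_def)
end

lemma enc_Pair [simp]: "enc (a, b) = Fork (enc a) (enc b)"
  by (simp add: enc_prod_def)

instantiation list :: (encodable) encodable
begin
definition encode_list: "enc = enc_list enc"
instance
proof
  fix xs ys :: "'a list" show "enc xs = enc ys \<Longrightarrow> xs = ys"
    unfolding encode_list
  proof (induction xs arbitrary: ys)
    case Nil then show ?case by (cases ys) auto
  next
    case (Cons x xs) then show ?case by (cases ys) auto
  qed
qed
end

lemma enc_Nil [simp]: "enc [] = Leaf"
  and enc_Cons [simp]: "enc (x # xs) = Fork (enc x) (enc xs)"
  by (simp_all add: encode_list)

lemma enc_True [simp]: "enc True = Fork Leaf Leaf"
  and enc_False [simp]: "enc False = Leaf"
  by (simp_all add: encode_bool)

instantiation nat :: encodable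
begin
definition encode_nat: "enc = enc_nat"
instance
proof
  fix m n :: nat show "enc m = enc n \<Longrightarrow> m = n"
    unfolding encode_nat
  proof (induction m arbitrary: n rule: less_induct)
    case (less m)
    show ?case
    proof (cases "m = 0 \<or> n = 0")
      case True
      then show ?thesis using less.prems
        by (subst (asm) (1 2) enc_nat.simps) (auto split: if_splits)
    next
      case False
      then have *: "enc_bool (odd m) = enc_bool (odd n)" "enc_nat (m div 2) = enc_nat (n div 2)"
        using less.prems by (subst (asm) (1 2) enc_nat.simps; simp)+
      from *(1) have "odd m = odd n" by (cases "odd m"; cases "odd n") auto
      moreover have "m div 2 = n div 2" using less.IH[of "m div 2"] * False by simp
      ultimately show ?thesis by presburger
    qed
  qed
qed
end

instantiation int :: encodable
begin
definition encode_int: "enc = enc_int"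
instance
proof
  fix x y :: int assume "enc x = enc y"
  then have "enc (x < 0, nat \<bar>x\<bar>) = enc (y < 0, nat \<bar>y\<bar>)"
    by (simp add: encode_int enc_int_def encode_nat encode_bool)
  then show "x = y" unfolding enc_eq_iff by (auto split: if_splits)
qed
end

text \<open>Sign and absolute value thereby become head and tail of the encoding, so a single
  program step extracts them.\<close>

lemma enc_int_conv: "enc (k :: int) = enc (k < 0, nat \<bar>k\<bar>)"
  by (simp add: encode_int enc_int_def encode_nat encode_bool)

instantiation rat :: encodable
begin
definition encode_rat: "enc = enc_rat"
instance
proof
  fix x y :: rat assume "enc x = enc y"
  then have "enc (quotient_of x) = enc (quotient_of y)"
    by (simp add: encode_rat enc_rat_def encode_int enc_prod_def case_prod_beta)
  then show "x = y" by (simp add: quotient_of_inject_eq)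
qed
end

lemma enc_rat_conv: "enc (r :: rat) = enc (quotient_of r)"
  by (simp add: encode_rat enc_rat_def encode_int enc_prod_def split: prod.split)

instantiation option :: (encodable) encodable
begin
definition enc_option :: "'a option \<Rightarrow> btree" where
  "enc_option z = (case z of None \<Rightarrow> Leaf | Some x \<Rightarrow> Fork Leaf (enc x))"
instance by standard (auto simp: enc_option_def split: option.splits)
end

lemma enc_None [simp]: "enc None = Leaf"
  and enc_Some [simp]: "enc (Some x) = Fork Leaf (enc x)"
  by (simp_all add: enc_option_def)

lemma length_le_size_enc: "length xs \<le> size (enc xs)"
  by (induction xs) auto

lemma size_enc_elem: "x \<in> set xs \<Longrightarrow> size (enc x) < size (enc xs)"
  by (induction xs) auto

lemma size_enc_append [simp]: "size (enc (xs @ ys)) = size (enc xs) + size (enc ys)"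
  by (induction xs) auto


section \<open>Polynomial bounds\<close>

text \<open>Coefficients are natural numbers, so no term can decrease. Bounds can therefore be
  composed and evaluated at overestimates of the size.\<close>

lemma poly_nat_mono: "x \<le> y \<Longrightarrow> poly q x \<le> poly q (y :: nat)"
  by (induction q) (auto intro!: add_mono mult_mono)

definition pb :: "('a :: encodable \<Rightarrow> nat) \<Rightarrow> bool" where
  "pb F \<longleftrightarrow> (\<exists>q :: nat poly. \<forall>x. F x \<le> poly q (size (enc x)))"

named_theorems pb_intros

lemma pb_const [pb_intros]: "pb (\<lambda>x. c)"
  unfolding pb_def by (intro exI[of _ "[:c:]"]) simp

lemma pb_size [pb_intros]: "pb (\<lambda>x. size (enc x))"
  unfolding pb_def by (intro exI[of _ "[:0, 1:]"]) simp

lemma pb_add [pb_intros]: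
  assumes "pb F" "pb G" shows "pb (\<lambda>x. F x + G x)"
proof -
  from assms obtain p q where "\<forall>x. F x \<le> poly p (size (enc x))" "\<forall>x. G x \<le> poly q (size (enc x))"
    unfolding pb_def by blast
  then show ?thesis unfolding pb_def by (intro exI[of _ "p + q"]) (auto intro: add_mono)
qed

lemma pb_mult [pb_intros]:
  assumes "pb F" "pb G" shows "pb (\<lambda>x. F x * G x)"
proof -
  from assms obtain p q where "\<forall>x. F x \<le> poly p (size (enc x))" "\<forall>x. G x \<le> poly q (size (enc x))"
    unfolding pb_def by blast
  then show ?thesis unfolding pb_def by (intro exI[of _ "p * q"]) (auto intro: mult_mono)
qed

lemma pb_Suc [pb_intros]: "pb F \<Longrightarrow> pb (\<lambda>x. Suc (F x))"
  using pb_add[OF _ pb_const[of 1]] by simp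

lemma pb_mono: "pb G \<Longrightarrow> (\<And>x. F x \<le> G x) \<Longrightarrow> pb F"
  unfolding pb_def using order.trans by metis

lemma pb_poly:
  assumes "pb F" shows "pb (\<lambda>x. poly q (F x))"
proof -
  from assms obtain p where "\<forall>x. F x \<le> poly p (size (enc x))"
    unfolding pb_def by blast
  then show ?thesis unfolding pb_def
    by (intro exI[of _ "pcompose q p"]) (auto simp: poly_pcompose intro: poly_nat_mono)
qed

lemma pb_compose:
  assumes "pb F" "pb (\<lambda>x. size (enc (g x)))" shows "pb (\<lambda>x. F (g x))"
proof -
  from assms(1) obtain p where "\<forall>x. F x \<le> poly p (size (enc x))"
    unfolding pb_def by blast
  then show ?thesis by (intro pb_mono[OF pb_poly[OF assms(2), of p]]) simp
qed


section \<open>Programs\<close>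

text \<open>An assignment is charged at least the size of the value stored, so no variable grows by
  more than the elapsed time.\<close>

lemma exec_size: "exec p s t s' \<Longrightarrow> size (s' v) \<le> size (s v) + t"
proof (induction rule: exec.induct)
  case (Assign x e s)
  have "size (expr_val e s) \<le> expr_cost e s" by (cases e) auto
  then show ?case by simp
qed auto

text \<open>From this index on no variable is written (\<open>exec_frame\<close>), so such variables
  can hold values across the run of a subprogram.\<close>

fun var_bound :: "com \<Rightarrow> nat" where
  "var_bound Skip = 0"
| "var_bound (Assign x e) = Suc x"
| "var_bound (Seq p q) = max (var_bound p) (var_bound q)"
| "var_bound (If x p q) = max (var_bound p) (var_bound q)"
| "var_bound (While x p) = var_bound p"

lemma exec_frame: "exec p s t s' \<Longrightarrow> var_bound p \<le> v \<Longrightarrow> s' v = s v"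
  by (induction rule: exec.induct) auto

section \<open>Correctness within a time bound\<close>

definition runs :: "com \<Rightarrow> store \<Rightarrow> nat \<Rightarrow> (store \<Rightarrow> bool) \<Rightarrow> bool" where
  "runs p s B Q \<longleftrightarrow> (\<exists>t s'. exec p s t s' \<and> t \<le> B \<and> Q s')"

lemma runs_weaken: "runs p s B Q \<Longrightarrow> B \<le> B' \<Longrightarrow> runs p s B' Q"
  unfolding runs_def by (meson order.trans)

lemma runs_Assign:
  assumes "expr_cost e s \<le> B" "Q (s(x := expr_val e s))"
  shows "runs (Assign x e) s (Suc B) Q"
  using assms exec.Assign[of x e s] unfolding runs_def by auto

lemma runs_Seq:
  "runs p s B R \<Longrightarrow> (\<And>s'. R s' \<Longrightarrow> runs q s' C Q) \<Longrightarrow> runs (Seq p q) s (Suc (B + C)) Q"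
  unfolding runs_def using exec.Seq by (metis Suc_le_mono add_mono)

lemma runs_Assign_Seq:
  "expr_cost e s \<le> B \<Longrightarrow> runs q (s(x := expr_val e s)) C Q \<Longrightarrow> runs (Seq (Assign x e) q) s (Suc (Suc B + C)) Q"
  by (rule runs_Seq[OF runs_Assign[where Q = "\<lambda>s'. s' = s(x := expr_val e s)"]]) auto

lemma runs_If:
  assumes "s x \<noteq> Leaf \<Longrightarrow> runs p s B Q" "s x = Leaf \<Longrightarrow> runs q s B Q"
  shows "runs (If x p q) s (Suc B) Q"
proof (cases "s x = Leaf")
  case True
  then show ?thesis using assms(2) unfolding runs_def by (meson Suc_le_mono exec.If_false)
next
  case False
  then show ?thesis using assms(1) unfolding runs_def by (meson Suc_le_mono exec.If_true)
qed

text \<open>The rest of the loop stands in the postcondition of the body, so the rule unrolls one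
  iteration and fits an induction on their number.\<close>

lemma runs_While:
  assumes "s x \<noteq> Leaf \<Longrightarrow> runs p s B (\<lambda>s'. runs (While x p) s' C Q)" "s x = Leaf \<Longrightarrow> Q s"
  shows "runs (While x p) s (Suc (B + C)) Q"
proof (cases "s x = Leaf")
  case True
  then have "exec (While x p) s 1 s" by (rule exec.While_false)
  with True assms(2) show ?thesis unfolding runs_def by fastforce
next
  case False
  then obtain t1 s1 t2 s2 where "exec p s t1 s1" "t1 \<le> B" "exec (While x p) s1 t2 s2" "t2 \<le> C" "Q s2"
    using assms(1) unfolding runs_def by blast
  with False show ?thesis unfolding runs_def
    by (intro exI[of _ "Suc (t1 + t2)"] exI[of _ s2]) (auto intro: exec.While_true)
qed

text \<open>The variables other than 0 are arbitrary, not \<open>Leaf\<close>. Programs can thus be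
  chained and repeated in loops without clearing their work variables.\<close>

definition computes :: "com \<Rightarrow> ('a :: encodable \<Rightarrow> nat) \<Rightarrow> ('a \<Rightarrow> 'b :: encodable) \<Rightarrow> bool" where
  "computes p T f \<longleftrightarrow> (\<forall>x s. s 0 = enc x \<longrightarrow> runs p s (T x) (\<lambda>s'. s' 0 = enc (f x)))"

definition pt :: "('a :: encodable \<Rightarrow> 'b :: encodable) \<Rightarrow> bool" where
  "pt f \<longleftrightarrow> (\<exists>p T. pb T \<and> computes p T f)"

lemma ptI: "pb T \<Longrightarrow> (\<And>x s. s 0 = enc x \<Longrightarrow> runs p s (T x) (\<lambda>s'. s' 0 = enc (f x))) \<Longrightarrow> pt f"
  unfolding pt_def computes_def by blast

lemma runs_computes_Seq:
  assumes "computes p T f" "s 0 = enc x"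
    "\<And>s'. s' 0 = enc (f x) \<Longrightarrow> (\<And>v. var_bound p \<le> v \<Longrightarrow> s' v = s v) \<Longrightarrow> runs q s' C Q"
  shows "runs (Seq p q) s (Suc (T x + C)) Q"
proof (rule runs_Seq[where R = "\<lambda>s'. s' 0 = enc (f x) \<and> (\<forall>v \<ge> var_bound p. s' v = s v)"])
  show "runs p s (T x) (\<lambda>s'. s' 0 = enc (f x) \<and> (\<forall>v \<ge> var_bound p. s' v = s v))"
    using assms(1,2) exec_frame unfolding computes_def runs_def by metis
qed (use assms(3) in blast)

lemma runs_computes: "computes p T f \<Longrightarrow> s 0 = enc x \<Longrightarrow> runs p s (T x) (\<lambda>s'. s' 0 = enc (f x))"
  unfolding computes_def by blast

text \<open>By \<open>exec_size\<close> the output exceeds the input by at most the running time.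
  This is where charging for sizes pays off: time bounds yield size bounds.\<close>

lemma pb_pt [pb_intros]:
  assumes "pt f" shows "pb (\<lambda>x. size (enc (f x)))"
proof -
  from assms obtain p T where "pb T" and c: "computes p T f" unfolding pt_def by blast
  have "pb (\<lambda>x. size (enc x) + T x)" by (intro pb_intros \<open>pb T\<close>)
  moreover have "size (enc (f x)) \<le> size (enc x) + T x" for x
  proof -
    have "runs p ((\<lambda>_. Leaf)(0 := enc x)) (T x) (\<lambda>s'. s' 0 = enc (f x))"
      using c unfolding computes_def by simp
    then obtain t s' where "exec p ((\<lambda>_. Leaf)(0 := enc x)) t s'" "t \<le> T x" "s' 0 = enc (f x)"
      unfolding runs_def by blast
    with exec_size[OF this(1), of 0] show ?thesis by simp
  qed
  ultimately show ?thesis by (rule pb_mono)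
qed

lemma pb_comp: "pb F \<Longrightarrow> pt g \<Longrightarrow> pb (\<lambda>x. F (g x))"
  by (rule pb_compose) (auto intro: pb_pt)

lemma pb_length [pb_intros]: "pt l \<Longrightarrow> pb (\<lambda>x. length (l x))"
  by (rule pb_mono[where G = "\<lambda>x. size (enc (l x))"]) (auto intro: pb_pt length_le_size_enc)

lemma pt_comp:
  fixes g :: "'a :: encodable \<Rightarrow> 'b :: encodable" and f :: "'b \<Rightarrow> 'c :: encodable"
  assumes "pt f" "pt g" shows "pt (\<lambda>x. f (g x))"
proof -
  from assms obtain p T q U where T: "pb T" "computes p T f" and U: "pb U" "computes q U g"
    unfolding pt_def by blast
  show ?thesis
  proof (rule ptI[where p = "Seq q p" and T = "\<lambda>x. Suc (U x + T (g x))"])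
    show "pb (\<lambda>x. Suc (U x + T (g x)))" by (intro pb_intros T(1) U(1) pb_comp[OF T(1) assms(2)])
    fix x :: 'a and s :: store assume "s 0 = enc x"
    show "runs (Seq q p) s (Suc (U x + T (g x))) (\<lambda>s'. s' 0 = enc (f (g x)))"
      by (rule runs_computes_Seq[OF U(2), where x = x], fact, rule runs_computes[OF T(2)])
  qed
qed

text \<open>Programs see encodings only, so passing between types with equal encodings is
  free.\<close>

lemma pt_retype: "pt f \<Longrightarrow> (\<And>x. enc (g x) = enc (f x)) \<Longrightarrow> pt g"
  unfolding pt_def computes_def by simp

section \<open>Basic operations and closure properties\<close>

named_theorems pt_intros

lemma pt_ident [pt_intros]: "pt (\<lambda>x. x)"
proof (rule ptI[where p = Skip and T = "\<lambda>_. 1"])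
  fix x :: 'a and s :: store assume "s 0 = enc x"
  then show "runs Skip s 1 (\<lambda>s'. s' 0 = enc x)"
    unfolding runs_def using exec.Skip by blast
qed (intro pb_intros)

fun const_expr :: "btree \<Rightarrow> expr" where
  "const_expr Leaf = Nil_E"
| "const_expr (Fork a b) = Cons_E (const_expr a) (const_expr b)"

lemma const_expr_val [simp]: "expr_val (const_expr a) s = a"
  by (induction a) auto

lemma const_expr_cost: "expr_cost (const_expr a) s = expr_cost (const_expr a) s'"
  by (induction a) auto

lemma pt_const [pt_intros]: "pt (\<lambda>x. c)"
proof (rule ptI[where p = "Assign 0 (const_expr (enc c))"
      and T = "\<lambda>_. Suc (expr_cost (const_expr (enc c)) (\<lambda>_. Leaf))"])
  fix x :: 'a and s :: store
  show "runs (Assign 0 (const_expr (enc c))) s (Suc (expr_cost (const_expr (enc c)) (\<lambda>_. Leaf)))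
    (\<lambda>s'. s' 0 = enc c)"
    by (rule runs_Assign) (auto simp: const_expr_cost[of _ s "\<lambda>_. Leaf"])
qed (intro pb_intros)

lemma pt_btree_hd: "pt btree_hd"
proof (rule ptI[where p = "Assign 0 (Hd (Var 0))" and T = "\<lambda>x. 3 + 2 * size (enc x)"])
  fix x :: btree and s :: store assume "s 0 = enc x"
  then show "runs (Assign 0 (Hd (Var 0))) s (3 + 2 * size (enc x)) (\<lambda>s'. s' 0 = enc (btree_hd x))"
    by (intro runs_weaken[OF runs_Assign[where B = "2 + 2 * size (enc x)"]]; cases x) auto
qed (intro pb_intros)

lemma pt_btree_tl: "pt btree_tl"
proof (rule ptI[where p = "Assign 0 (Tl (Var 0))" and T = "\<lambda>x. 3 + 2 * size (enc x)"])
  fix x :: btree and s :: store assume "s 0 = enc x"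
  then show "runs (Assign 0 (Tl (Var 0))) s (3 + 2 * size (enc x)) (\<lambda>s'. s' 0 = enc (btree_tl x))"
    by (intro runs_weaken[OF runs_Assign[where B = "2 + 2 * size (enc x)"]]; cases x) auto
qed (intro pb_intros)

lemma pt_enc [pt_intros]: "pt f \<Longrightarrow> pt (\<lambda>x. enc (f x))"
  by (erule pt_retype) simp

lemma pt_hd_enc: "pt f \<Longrightarrow> (\<And>x. enc (g x) = btree_hd (enc (f x))) \<Longrightarrow> pt g"
  by (rule pt_retype[OF pt_comp[OF pt_btree_hd pt_enc]]) auto

lemma pt_tl_enc: "pt f \<Longrightarrow> (\<And>x. enc (g x) = btree_tl (enc (f x))) \<Longrightarrow> pt g"
  by (rule pt_retype[OF pt_comp[OF pt_btree_tl pt_enc]]) auto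

lemma pt_fst [pt_intros]: "pt f \<Longrightarrow> pt (\<lambda>x. fst (f x))"
  by (erule pt_hd_enc) (metis btree_hd.simps(2) enc_Pair prod.collapse)

lemma pt_snd [pt_intros]: "pt f \<Longrightarrow> pt (\<lambda>x. snd (f x))"
  by (erule pt_tl_enc) (metis btree_tl.simps(2) enc_Pair prod.collapse)

lemma pt_Pair [pt_intros]:
  fixes f :: "'a :: encodable \<Rightarrow> 'b :: encodable" and g :: "'a \<Rightarrow> 'c :: encodable"
  assumes "pt f" "pt g" shows "pt (\<lambda>x. (f x, g x))"
proof -
  from assms obtain p T q U where T: "pb T" "computes p T f" and U: "pb U" "computes q U g"
    unfolding pt_def by blast
  \<comment> \<open>Registers \<open>K\<close> (the input) and \<open>Suc K\<close> (the first
    result) survive both programs; the outer \<open>Suc\<close> keeps them apart from variable 0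
    even if both bounds are 0.\<close>
  define K where "K = Suc (max (var_bound p) (var_bound q))"
  have K: "var_bound p \<le> K" "var_bound q \<le> K" "0 < K" by (auto simp: K_def)
  define B where "B x = 100 + 10 * (size (enc x) + T x + U x + size (enc (f x)) + size (enc (g x)))" for x
  show ?thesis
  proof (rule ptI)
    show "pb B" unfolding B_def by (intro pb_intros T(1) U(1) assms)
    fix x :: 'a and s :: store assume s: "s 0 = enc x"
    show "runs (Seq (Assign K (Var 0)) (Seq p (Seq (Assign (Suc K) (Var 0)) (Seq (Assign 0 (Var K))
      (Seq q (Assign 0 (Cons_E (Var (Suc K)) (Var 0)))))))) s (B x) (\<lambda>s'. s' 0 = enc (f x, g x))"
      apply (rule runs_weaken)
        apply (rule runs_Assign_Seq[where B = "1 + size (enc x)"])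
         apply (use s in simp)
        apply (rule runs_computes_Seq[OF T(2), where x = x])
         apply (use s K in simp)
        apply (rule runs_Assign_Seq[where B = "1 + size (enc (f x))"])
         apply simp
        apply (rule runs_Assign_Seq[where B = "1 + size (enc x)"])
         apply (use s K in simp)
        apply (rule runs_computes_Seq[OF U(2), where x = x])
         apply (use s K in simp)
        apply (rule runs_Assign[where B = "10 + 2 * size (enc (f x)) + 2 * size (enc (g x))"])
         apply (use K in simp)
        apply (use K in simp)
       apply (simp add: B_def)
      done
  qed
qed

lemma pt_case_prod [pt_intros]:
  "pt (\<lambda>x. f x (fst (g x)) (snd (g x))) \<Longrightarrow> pt (\<lambda>x. case g x of (a, b) \<Rightarrow> f x a b)"
  by (simp add: case_prod_beta)

lemma pt_Cons [pt_intros]: "pt f \<Longrightarrow> pt g \<Longrightarrow> pt (\<lambda>x. f x # g x)"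
  by (rule pt_retype[where f = "\<lambda>x. (f x, g x)"]) (auto intro: pt_Pair)

lemma pt_Some [pt_intros]: "pt f \<Longrightarrow> pt (\<lambda>x. Some (f x))"
  by (rule pt_retype[where f = "\<lambda>x. (Leaf, f x)"]) (auto intro: pt_Pair pt_const)

lemma pt_Fork [pt_intros]: "pt f \<Longrightarrow> pt g \<Longrightarrow> pt (\<lambda>x. Fork (f x) (g x))"
  by (rule pt_retype[where f = "\<lambda>x. (f x, g x)"]) (auto intro: pt_Pair)

text \<open>The second branch may view the value of the guard at another type with the same encoding,
  such as a nonempty list as a pair.\<close>

lemma pt_cases:
  fixes l :: "'a :: encodable \<Rightarrow> 'd :: encodable" and f :: "'a \<Rightarrow> 'b :: encodable" and g :: "'a \<times> 'c :: encodable \<Rightarrow> 'b"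
  assumes "pt l" "pt f" "pt g"
    "\<And>x. enc (l x) = Leaf \<Longrightarrow> h x = f x"
    "\<And>x. enc (l x) \<noteq> Leaf \<Longrightarrow> \<exists>c. enc c = enc (l x) \<and> h x = g (x, c)"
  shows "pt h"
proof -
  obtain p T where T: "pb T" "computes p T l" using assms(1) unfolding pt_def by blast
  obtain q U where U: "pb U" "computes q U f" using assms(2) unfolding pt_def by blast
  obtain r V where "pb V" and V: "computes r V g" using assms(3) unfolding pt_def by blast
  obtain v where v: "\<And>z. V z \<le> poly v (size (enc z))" using \<open>pb V\<close> unfolding pb_def by blast
  define K where "K = Suc (max (var_bound p) (max (var_bound q) (var_bound r)))"
  have K: "var_bound p \<le> K" "var_bound q \<le> K" "var_bound r \<le> K" "0 < K" by (auto simp: K_def)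
  \<comment> \<open>The running time of \<open>r\<close> refers to the pair \<open>(x, c)\<close>,
    whose encoding has this size whichever \<open>c\<close> represents the guard.\<close>
  define W where "W x = poly v (Suc (size (enc x) + size (enc (l x))))" for x
  define B where "B x = 100 + 10 * (size (enc x) + size (enc (l x)) + T x + U x + W x)" for x
  show ?thesis
  proof (rule ptI)
    have "pb W" unfolding W_def by (intro pb_poly pb_intros assms)
    then show "pb B" unfolding B_def by (intro pb_intros assms T(1) U(1))
    fix x :: 'a and s :: store assume s: "s 0 = enc x"
    have *: "runs r s' (W x) (\<lambda>s'. s' 0 = enc (h x))"
      if st: "s' 0 = Fork (enc x) (enc (l x))" and ne: "enc (l x) \<noteq> Leaf" for s'
    proof -
      obtain c where c: "enc c = enc (l x)" "h x = g (x, c)" using assms(5)[OF ne] by blast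
      have "runs r s' (V (x, c)) (\<lambda>s'. s' 0 = enc (h x))"
        using V c st unfolding computes_def by simp
      then show ?thesis
        by (rule runs_weaken) (use v[of "(x, c)"] c in \<open>auto simp: W_def\<close>)
    qed
    have **: "runs q s' (U x) (\<lambda>s'. s' 0 = enc (h x))" if "s' 0 = enc x" "enc (l x) = Leaf" for s'
      unfolding assms(4)[OF that(2)] by (rule runs_computes[OF U(2)]) (rule that(1))
    show "runs (Seq (Assign K (Var 0)) (Seq p (If 0
      (Seq (Assign 0 (Cons_E (Var K) (Var 0))) r) (Seq (Assign 0 (Var K)) q)))) s (B x) (\<lambda>s'. s' 0 = enc (h x))"
      apply (rule runs_weaken)
        apply (rule runs_Assign_Seq[where B = "1 + size (enc x)"])
         apply (use s in simp)
        apply (rule runs_computes_Seq[OF T(2), where x = x])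
         apply (use s K in simp)
        apply (rule runs_If[where B = "15 + 2 * size (enc x) + 2 * size (enc (l x)) + U x + W x"])
         apply (rule runs_weaken)
           apply (rule runs_Assign_Seq[where B = "10 + 2 * size (enc x) + 2 * size (enc (l x))"])
            apply (use K s in simp)
           apply (rule *)
            apply (use K s in simp)
           apply (use K s in simp)
          apply simp
        apply (rule runs_weaken)
          apply (rule runs_Assign_Seq[where B = "1 + size (enc x)"])
           apply (use s K in simp)
          apply (rule **)
           apply (use s K in simp)
          apply (use s K in simp)
         apply simp
       apply (simp add: B_def)
      done
  qed
qed

lemma pt_if [pt_intros]:
  fixes f g :: "'a :: encodable \<Rightarrow> 'b :: encodable"
  assumes "pt P" "pt f" "pt g" shows "pt (\<lambda>x. if P x then f x else g x)"
proof (rule pt_cases[OF assms(1,3)])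
  show "pt (\<lambda>z. f (fst z) :: 'b)" for z :: "'a \<times> btree"
    by (rule pt_comp[OF assms(2)]) (intro pt_intros)
  fix x
  show "(if P x then f x else g x) = g x" if "enc (P x) = Leaf" using that by (cases "P x") auto
  show "\<exists>c :: btree. enc c = enc (P x) \<and> (if P x then f x else g x) = f (fst (x, c))"
    if "enc (P x) \<noteq> Leaf" using that by (cases "P x") auto
qed

lemma pt_case_list [pt_intros]:
  assumes "pt l" "pt f" "pt (\<lambda>z. g (fst z) (fst (snd z)) (snd (snd z)))"
  shows "pt (\<lambda>x. case l x of [] \<Rightarrow> f x | y # ys \<Rightarrow> g x y ys)"
  by (rule pt_cases[OF assms]) (auto split: list.splits)

text \<open>A polynomial-time step alone is not enough, since it might square the size each time.
  The bound \<open>C\<close> on all intermediate accumulators gives every round the same polynomial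
  cost.\<close>

lemma pt_foldl:
  fixes l :: "'a :: encodable \<Rightarrow> 'c :: encodable list" and a :: "'a \<Rightarrow> 'b :: encodable"
  assumes "pt l" "pt a" "pt (\<lambda>z. g (fst z) (fst (snd z)) (snd (snd z)))" "pb C"
    "\<And>x ys zs. l x = ys @ zs \<Longrightarrow> size (enc (foldl (g x) (a x) ys)) \<le> C x"
  shows "pt (\<lambda>x. foldl (g x) (a x) (l x))"
proof -
  let ?g = "\<lambda>z. g (fst z) (fst (snd z)) (snd (snd z))"
  obtain p T where T: "pb T" "computes p T l" using assms(1) unfolding pt_def by blast
  obtain q U where U: "pb U" "computes q U a" using assms(2) unfolding pt_def by blast
  obtain r V where "pb V" and V: "computes r V ?g" using assms(3) unfolding pt_def by blast
  obtain v where v: "\<And>z. V z \<le> poly v (size (enc z))" using \<open>pb V\<close> unfolding pb_def by blast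
  define K where "K = Suc (max (var_bound p) (max (var_bound q) (var_bound r)))"
  have K: "var_bound p \<le> K" "var_bound q \<le> K" "var_bound r \<le> K" "0 < K" by (auto simp: K_def)
  define D where "D x = size (enc x) + C x + size (enc (l x))" for x
  define W where "W x = poly v (2 + D x)" for x
  define E where "E x = 100 + 20 * D x + W x" for x
  define B where "B x = 100 + 10 * D x + T x + U x + E x * Suc (length (l x))" for x
  \<comment> \<open>Register \<open>K\<close> holds the input, \<open>K + 1\<close> the rest of the
    list, which also guards the loop, and \<open>K + 2\<close> the accumulator.\<close>
  define body where "body = Seq (Assign 0 (Cons_E (Var K) (Cons_E (Var (K + 2)) (Hd (Var (K + 1))))))
    (Seq r (Seq (Assign (K + 2) (Var 0)) (Assign (K + 1) (Tl (Var (K + 1))))))"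
  have loop: "runs (While (K + 1) body) s (E x * Suc (length zs)) (\<lambda>s'. s' (K + 2) = enc (foldl (g x) (a x) (l x)))"
    if "l x = ys @ zs" "s K = enc x" "s (K + 1) = enc zs" "s (K + 2) = enc (foldl (g x) (a x) ys)"
    for x ys zs s
    using that
  proof (induction zs arbitrary: ys s)
    case Nil
    have "exec (While (K + 1) body) s 1 s" by (rule exec.While_false) (use Nil in simp)
    then show ?case using Nil unfolding runs_def by (intro exI[of _ 1] exI[of _ s]) (auto simp: E_def)
  next
    case (Cons y zs)
    let ?b = "foldl (g x) (a x) ys"
    have sz: "size (enc ?b) \<le> C x" "size (enc (g x ?b y)) \<le> C x"
      using assms(5)[of x ys "y # zs"] assms(5)[of x "ys @ [y]" zs] Cons.prems(1) by auto
    have sl: "size (enc zs) + size (enc y) < size (enc (l x))" using Cons.prems(1) by simp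
    have Vb: "V (x, ?b, y) \<le> W x"
      by (rule order.trans[OF v]) (use sz sl in \<open>auto simp: W_def D_def intro!: poly_nat_mono\<close>)
    have "runs (While (K + 1) body) s (Suc (99 + 20 * D x + W x + E x * Suc (length zs)))
      (\<lambda>s'. s' (K + 2) = enc (foldl (g x) (a x) (l x)))"
    proof (rule runs_While)
      show "runs body s (99 + 20 * D x + W x) (\<lambda>s'. runs (While (K + 1) body) s' (E x * Suc (length zs))
        (\<lambda>s'. s' (K + 2) = enc (foldl (g x) (a x) (l x))))"
        apply (subst (1) body_def)
        apply (rule runs_weaken)
          apply (rule runs_Assign_Seq[where B = "20 + 5 * D x"])
           apply (use Cons.prems K sz sl in \<open>simp add: D_def\<close>)
          apply (rule runs_computes_Seq[OF V, where x = "(x, ?b, y)"])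
           apply (use Cons.prems in simp)
          apply (rule runs_Assign_Seq[where B = "1 + C x"])
           apply (use sz in simp)
          apply (rule runs_Assign[where B = "10 + 2 * size (enc (l x))"])
           apply (use Cons.prems K sl in simp)
          apply (rule Cons.IH[of "ys @ [y]"])
             apply (use Cons.prems(1) in simp)
            apply (use Cons.prems K in simp)
           apply (use Cons.prems K in simp)
          apply simp
         apply (use Vb in \<open>simp add: D_def\<close>)
        done
    qed (use Cons.prems in simp)
    then show ?case
      unfolding length_Cons mult_Suc_right[of _ "Suc (length zs)"]
      by (rule runs_weaken) (use E_def[of x] in linarith)
  qed
  show ?thesis
  proof (rule ptI)
    have D: "pb D" unfolding D_def by (intro pb_add pb_size pb_pt assms(1,4))
    have W: "pb W" unfolding W_def by (rule pb_poly) (intro pb_intros D)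
    have E: "pb E" unfolding E_def by (intro pb_intros D W)
    show "pb B" unfolding B_def by (intro pb_intros D E assms(1) T(1) U(1))
    fix x :: 'a and s :: store assume s: "s 0 = enc x"
    have sz: "size (enc (a x)) \<le> C x" using assms(5)[of x "[]" "l x"] by simp
    show "runs (Seq (Assign K (Var 0)) (Seq p (Seq (Assign (K + 1) (Var 0)) (Seq (Assign 0 (Var K))
      (Seq q (Seq (Assign (K + 2) (Var 0)) (Seq (While (K + 1) body) (Assign 0 (Var (K + 2)))))))))) s (B x)
      (\<lambda>s'. s' 0 = enc (foldl (g x) (a x) (l x)))"
      apply (rule runs_weaken)
        apply (rule runs_Assign_Seq[where B = "1 + size (enc x)"])
         apply (use s in simp)
        apply (rule runs_computes_Seq[OF T(2), where x = x])
         apply (use s K in simp)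
        apply (rule runs_Assign_Seq[where B = "1 + size (enc (l x))"])
         apply simp
        apply (rule runs_Assign_Seq[where B = "1 + size (enc x)"])
         apply (use s K in simp)
        apply (rule runs_computes_Seq[OF U(2), where x = x])
         apply (use s K in simp)
        apply (rule runs_Assign_Seq[where B = "1 + size (enc (a x))"])
         apply simp
        apply (rule runs_Seq)
         apply (rule loop[where ys = "[]" and zs = "l x" and x = x])
            apply simp
           apply (use s K in simp)
          apply (use s K in simp)
         apply simp
        apply (rule runs_Assign[where B = "1 + C x"])
         apply (use assms(5)[of x "l x" "[]"] in simp)
        apply simp
       apply (use sz in \<open>simp add: B_def D_def\<close>)
      done
  qed
qed


lemma foldl_measure:
  fixes m :: "'b \<Rightarrow> nat"
  assumes "\<And>a y. I a \<Longrightarrow> y \<in> set l \<Longrightarrow> I (g a y) \<and> m (g a y) \<le> m a + c" "I a"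
  shows "I (foldl g a l) \<and> m (foldl g a l) \<le> m a + length l * c"
  using assms
proof (induction l arbitrary: a)
  case (Cons y l)
  have "I (g a y)" "m (g a y) \<le> m a + c" using Cons.prems by auto
  with Cons.IH[of "g a y"] Cons.prems(1) show ?case by fastforce
qed simp

text \<open>An increase per round that depends on the input only adds up to a polynomial total, as
  the number of rounds is a list length. The measure just has to dominate the size; the invariant
  serves to bound the increase.\<close>

lemma pt_foldl_measure:
  fixes l :: "'a :: encodable \<Rightarrow> 'c :: encodable list" and a :: "'a \<Rightarrow> 'b :: encodable"
    and m :: "'a \<Rightarrow> 'b \<Rightarrow> nat"
  assumes "pt l" "pt a" "pt (\<lambda>z. g (fst z) (fst (snd z)) (snd (snd z)))" "pb C" "pb A"
    "\<And>x. I x (a x)" "\<And>x. m x (a x) \<le> A x"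
    "\<And>x b y. I x b \<Longrightarrow> y \<in> set (l x) \<Longrightarrow> I x (g x b y) \<and> m x (g x b y) \<le> m x b + C x"
    "\<And>x b. I x b \<Longrightarrow> size (enc b) \<le> m x b"
  shows "pt (\<lambda>x. foldl (g x) (a x) (l x))"
proof (rule pt_foldl[OF assms(1-3)])
  show "pb (\<lambda>x. A x + length (l x) * C x)"
    by (intro pb_intros assms)
  fix x ys zs assume l: "l x = ys @ zs"
  then have *: "I x (foldl (g x) (a x) ys) \<and> m x (foldl (g x) (a x) ys) \<le> m x (a x) + length ys * C x"
    using assms(6,8) by (intro foldl_measure) auto
  moreover have "m x (a x) + length ys * C x \<le> A x + length (l x) * C x"
    using assms(7)[of x] l by (intro add_le_mono mult_le_mono1) auto
  ultimately show "size (enc (foldl (g x) (a x) ys)) \<le> A x + length (l x) * C x"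
    using assms(9)[of x "foldl (g x) (a x) ys"] by linarith
qed

lemma pt_foldl_inv:
  fixes l :: "'a :: encodable \<Rightarrow> 'c :: encodable list" and a :: "'a \<Rightarrow> 'b :: encodable"
  assumes "pt l" "pt a" "pt (\<lambda>z. g (fst z) (fst (snd z)) (snd (snd z)))" "pb C" "\<And>x. I x (a x)"
    "\<And>x b y. I x b \<Longrightarrow> y \<in> set (l x) \<Longrightarrow> I x (g x b y) \<and> size (enc (g x b y)) \<le> size (enc b) + C x"
  shows "pt (\<lambda>x. foldl (g x) (a x) (l x))"
  by (rule pt_foldl_measure[where m = "\<lambda>_ b. size (enc b)" and A = "\<lambda>x. size (enc (a x))" and C = C and I = I])
    (use assms pb_pt in simp_all)

lemmas pt_foldl_add = pt_foldl_inv[where I = "\<lambda>_ _. True", simplified]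

text \<open>An element has a smaller encoding than its list, so a bound for single elements becomes
  one bound for all of them in terms of the input.\<close>

lemma pb_elem:
  fixes l :: "'a :: encodable \<Rightarrow> 'c :: encodable list"
  assumes "pb G" "pt l"
  obtains C where "pb C" "\<And>x y. y \<in> set (l x) \<Longrightarrow> G (x, y) \<le> C x"
proof -
  obtain q where q: "\<And>z. G z \<le> poly q (size (enc z))" using assms(1) unfolding pb_def by blast
  show ?thesis
  proof
    show "pb (\<lambda>x. poly q (size (enc x) + size (enc (l x))))"
      by (rule pb_poly) (intro pb_add pb_size pb_pt assms(2))
    fix x and y assume "y \<in> set (l x)"
    then show "G (x, y) \<le> poly q (size (enc x) + size (enc (l x)))"
      by (intro order.trans[OF q poly_nat_mono]) (use size_enc_elem[of y "l x"] in simp)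
  qed
qed

text \<open>For loops that do not run along a list, such as the comparison of two trees. The variant
  \<open>\<mu>\<close> bounds the number of rounds and \<open>F\<close> gives the final state,
  invariant under the step.\<close>

lemma pt_while:
  fixes g :: "'b :: encodable \<times> 'c :: encodable \<Rightarrow> 'b \<times> 'c"
  assumes "pt g" "pb \<mu>" "\<And>s. enc (fst s) \<noteq> Leaf \<Longrightarrow> \<mu> (g s) < \<mu> s \<and> size (enc (g s)) \<le> size (enc s) + c"
    "\<And>s. enc (fst s) \<noteq> Leaf \<Longrightarrow> F (g s) = F s" "\<And>s. enc (fst s) = Leaf \<Longrightarrow> F s = s"
  shows "pt F"
proof -
  obtain p T where "pb T" and T: "computes p T g" using assms(1) unfolding pt_def by blast
  obtain v where v: "\<And>z. T z \<le> poly v (size (enc z))" using \<open>pb T\<close> unfolding pb_def by blast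
  define K where "K = Suc (var_bound p)"
  have K: "var_bound p \<le> K" "0 < K" by (auto simp: K_def)
  \<comment> \<open>A potential that never increases: a round adds at most \<open>c\<close> to the
    size and lowers \<open>\<mu>\<close> by at least 1. It bounds the size of all later
    states.\<close>
  define D where "D s = size (enc s) + c * \<mu> s" for s
  define E where "E s = 100 + 20 * (D s + c) + poly v (D s)" for s
  define B where "B s = 100 + 20 * D s + E s * Suc (\<mu> s)" for s
  define body where "body = Seq (Assign 0 (Var K)) (Seq p (Seq (Assign K (Var 0)) (Assign (K + 1) (Hd (Var K)))))"
  have loop: "runs (While (K + 1) body) st (E s * Suc m) (\<lambda>st'. st' K = enc (F r))"
    if "\<mu> r \<le> m" "D r \<le> D s" "st K = enc r" "st (K + 1) = enc (fst r)" "F r = F s" for st r m s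
    using that
  proof (induction m arbitrary: r st)
    case 0
    then have "st (K + 1) = Leaf" using assms(3)[of r] by auto
    then have "exec (While (K + 1) body) st 1 st" by (rule exec.While_false)
    moreover have "F r = r" using \<open>st (K + 1) = Leaf\<close> 0 assms(5)[of r] by simp
    ultimately show ?case using 0 unfolding runs_def
      by (intro exI[of _ 1] exI[of _ st]) (auto simp: E_def)
  next
    case (Suc m)
    have "runs (While (K + 1) body) st (Suc (99 + 20 * (D s + c) + poly v (D s) + E s * Suc m)) (\<lambda>st'. st' K = enc (F r))"
    proof (rule runs_While)
      assume ne: "st (K + 1) \<noteq> Leaf"
      have r: "\<mu> (g r) < \<mu> r" "size (enc (g r)) \<le> size (enc r) + c" "F (g r) = F r"
        using assms(3,4)[of r] ne Suc.prems(4) by auto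
      have "size (enc (g r)) + c * \<mu> (g r) \<le> size (enc r) + (c + c * \<mu> (g r))" using r by simp
      also have "c + c * \<mu> (g r) = c * Suc (\<mu> (g r))" by simp
      also have "\<dots> \<le> c * \<mu> r" using r by (intro mult_le_mono) auto
      finally have Dg: "D (g r) \<le> D s" using Suc.prems(2) by (simp add: D_def)
      have sz: "size (enc (g r)) \<le> D s" "size (enc (fst (g r))) \<le> D s" "size (enc r) \<le> D s"
        using Dg Suc.prems(2) by (auto simp: D_def enc_prod_def case_prod_beta)
      have Tr: "T r \<le> poly v (D s)"
        by (rule order.trans[OF v poly_nat_mono]) (rule sz)
      have hd: "btree_hd (enc (g r)) = enc (fst (g r))" by (simp add: enc_prod_def case_prod_beta)
      show "runs body st (99 + 20 * (D s + c) + poly v (D s)) (\<lambda>st. runs (While (K + 1) body) st (E s * Suc m) (\<lambda>st'. st' K = enc (F r)))"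
        apply (subst (1) body_def)
        apply (rule runs_weaken)
         apply (rule runs_Assign_Seq[where B = "1 + D s"])
          apply (use sz Suc.prems in simp)
         apply (rule runs_computes_Seq[OF T, where x = r])
          apply (use Suc.prems in simp)
         apply (rule runs_Assign_Seq[where B = "1 + D s"])
          apply (use sz in simp)
         apply (rule runs_Assign[where B = "10 + 2 * D s"])
          apply (use sz hd in simp)
         apply (subst r(3)[symmetric])
         apply (rule Suc.IH)
             apply (use r Suc.prems(1) in simp)
            apply (rule Dg)
           apply (use K in simp)
          apply (use hd in simp)
         apply (use r Suc.prems(5) in simp)
        apply (use Tr in simp)
        done
    next
      assume "st (K + 1) = Leaf"
      then show "st K = enc (F r)" using Suc.prems assms(5)[of r] by simp
    qed
    then show ?case
      unfolding mult_Suc_right[of _ "Suc m"]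
      by (rule runs_weaken) (use E_def[of s] in linarith)
  qed
  show ?thesis
  proof (rule ptI)
    have D: "pb D" unfolding D_def by (intro pb_add pb_mult pb_const pb_size assms(2))
    have W: "pb (\<lambda>s. poly v (D s))" by (rule pb_poly[OF D])
    have E: "pb E" unfolding E_def by (intro pb_add pb_mult pb_const D W)
    show "pb B" unfolding B_def by (intro pb_add pb_mult pb_Suc pb_const D E assms(2))
    fix s :: "'b \<times> 'c" and st :: store assume st: "st 0 = enc s"
    have hd: "btree_hd (enc s) = enc (fst s)" by (simp add: enc_prod_def case_prod_beta)
    have sz: "size (enc s) \<le> D s" "size (enc (fst s)) \<le> D s" "size (enc (F s)) \<le> D s"
    proof -
      show 1: "size (enc s) \<le> D s" "size (enc (fst s)) \<le> D s" by (auto simp: D_def enc_prod_def case_prod_beta)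
      have "size (enc (F s)) \<le> D s"
      proof (induction "\<mu> s" arbitrary: s rule: less_induct)
        case less
        show ?case
        proof (cases "enc (fst s) = Leaf")
          case True
          then show ?thesis using assms(5) by (simp add: D_def)
        next
          case False
          note r = assms(3,4)[OF False]
          have "size (enc (g s)) + c * \<mu> (g s) \<le> size (enc s) + (c + c * \<mu> (g s))" using r by simp
          also have "c + c * \<mu> (g s) = c * Suc (\<mu> (g s))" by simp
          also have "\<dots> \<le> c * \<mu> s" using r by (intro mult_le_mono) auto
          finally have "D (g s) \<le> D s" by (simp add: D_def)
          then show ?thesis using less[of "g s"] r by simp
        qed
      qed
      then show "size (enc (F s)) \<le> D s" .
    qed
    show "runs (Seq (Assign K (Var 0)) (Seq (Assign (K + 1) (Hd (Var 0))) (Seq (While (K + 1) body) (Assign 0 (Var K)))))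
      st (B s) (\<lambda>st'. st' 0 = enc (F s))"
      apply (rule runs_weaken)
       apply (rule runs_Assign_Seq[where B = "1 + D s"])
        apply (use st sz in simp)
       apply (rule runs_Assign_Seq[where B = "10 + 2 * D s"])
        apply (use st sz K hd in simp)
       apply (rule runs_Seq)
        apply (rule loop[where r = s and s = s and m = "\<mu> s"])
            apply simp
           apply simp
          apply (use st in simp)
         apply (use st K hd in simp)
        apply simp
       apply (rule runs_Assign[where B = "1 + D s"])
        apply (use sz in simp)
       apply simp
      apply (simp add: B_def)
      done
  qed
qed


section \<open>Booleans, equality and lists\<close>

lemma pt_not [pt_intros]: "pt P \<Longrightarrow> pt (\<lambda>x. \<not> P x)"
  by (erule pt_retype[OF pt_if[OF _ pt_const[of False] pt_const[of True]]]) simp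

lemma pt_conj [pt_intros]: "pt P \<Longrightarrow> pt Q \<Longrightarrow> pt (\<lambda>x. P x \<and> Q x)"
  by (erule (1) pt_retype[OF pt_if[OF _ _ pt_const[of False]]]) simp

lemma pt_disj [pt_intros]: "pt P \<Longrightarrow> pt Q \<Longrightarrow> pt (\<lambda>x. P x \<or> Q x)"
  by (erule (1) pt_retype[OF pt_if[OF _ pt_const[of True]]]) simp

lemma pt_is_Nil [pt_intros]: "pt l \<Longrightarrow> pt (\<lambda>x. l x = [])"
  by (erule pt_retype[OF pt_case_list[OF _ pt_const[of True] pt_const[of False]]]) (simp split: list.split)

lemma pt_is_Leaf: "pt f \<Longrightarrow> pt (\<lambda>x. f x = Leaf)"
  by (rule pt_cases[of f "\<lambda>_. True" "\<lambda>_ :: _ \<times> btree. False"]) (auto intro: pt_const)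

text \<open>A stack of pairs still to be compared replaces the recursion; a mismatch clears the
  stack and thereby ends the loop.\<close>

definition tree_eq_step :: "(btree \<times> btree) list \<times> bool \<Rightarrow> (btree \<times> btree) list \<times> bool" where
  "tree_eq_step s = (case fst s of [] \<Rightarrow> s | ab # st \<Rightarrow>
     (if fst ab = Leaf \<and> snd ab = Leaf then (st, snd s)
      else if fst ab = Leaf \<or> snd ab = Leaf then ([], False)
      else ((btree_hd (fst ab), btree_hd (snd ab)) # (btree_tl (fst ab), btree_tl (snd ab)) # st, snd s)))"

lemma pt_tree_eq_step: "pt tree_eq_step"
  unfolding tree_eq_step_def
  by (intro pt_intros pt_is_Leaf pt_comp[OF pt_btree_hd] pt_comp[OF pt_btree_tl])

lemma pt_tree_eq: "pt (\<lambda>s :: (btree \<times> btree) list \<times> bool. ([] :: (btree \<times> btree) list, snd s \<and> (\<forall>(a, b) \<in> set (fst s). a = b)))"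
  (is "pt ?F")
proof -
  \<comment> \<open>\<open>2 * size + 1\<close> counts all nodes of the first tree, leaves included.
    Splitting a pair discards the root, so the sum drops by 1.\<close>
  define \<mu> where "\<mu> s = (\<Sum>ab \<leftarrow> fst s. 2 * size (fst ab) + 1)" for s :: "(btree \<times> btree) list \<times> bool"
  have "(\<Sum>ab \<leftarrow> st. 2 * size (fst ab) + 1) \<le> 2 * size (enc st)" for st :: "(btree \<times> btree) list"
    by (induction st) (auto simp: enc_prod_def)
  then have "\<mu> s \<le> 2 * size (enc (fst s))" for s
    unfolding \<mu>_def .
  then have "\<mu> s \<le> 2 * size (enc s)" for s
    by (rule order.trans) (simp add: enc_prod_def case_prod_beta)
  then have \<mu>: "pb \<mu>" by (rule pb_mono[rotated]) (intro pb_mult pb_const pb_size)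
  show ?thesis
  proof (rule pt_while[OF pt_tree_eq_step \<mu>, where c = 2])
  show "\<mu> (tree_eq_step s) < \<mu> s \<and> size (enc (tree_eq_step s)) \<le> size (enc s) + 2"
    if "enc (fst s) \<noteq> Leaf" for s
  proof (cases s)
    case (Pair st b)
    with that obtain x y st' where "st = (x, y) # st'" by (cases st) auto
    with Pair show ?thesis
      by (cases x; cases y) (auto simp: tree_eq_step_def \<mu>_def enc_prod_def)
  qed
  show "?F (tree_eq_step s) = ?F s" if "enc (fst s) \<noteq> Leaf" for s
  proof (cases s)
    case (Pair st b)
    with that obtain x y st' where "st = (x, y) # st'" by (cases st) auto
    with Pair show ?thesis by (cases x; cases y) (auto simp: tree_eq_step_def)
  qed
  show "?F s = s" if "enc (fst s) = Leaf" for s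
    using that by (cases s; cases "fst s") auto
  qed
qed

text \<open>Encodings are injective, so comparing trees decides equality at every encodable
  type.\<close>

lemma pt_eq [pt_intros]:
  assumes "pt f" "pt g" shows "pt (\<lambda>x. f x = g x)"
proof -
  have "pt (\<lambda>x. snd (([] :: (btree \<times> btree) list), True \<and> (\<forall>(a, b) \<in> set [(enc (f x), enc (g x))]. a = b)))"
    using pt_comp[OF pt_tree_eq, of "\<lambda>x. ([(enc (f x), enc (g x))], True)"] assms
    by (intro pt_snd) (simp add: pt_intros)
  then show ?thesis by simp
qed

lemma foldl_Cons_rev: "foldl (\<lambda>a y. f y # a) b l = rev (map f l) @ b"
  by (induction l arbitrary: b) auto

lemma pt_rev [pt_intros]:
  fixes l :: "'a :: encodable \<Rightarrow> 'b :: encodable list"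
  assumes "pt l" shows "pt (\<lambda>x. rev (l x))"
proof -
  have "pt (\<lambda>x. foldl (\<lambda>a y. y # a) [] (l x))"
    by (rule pt_foldl_add[where C = "\<lambda>x. Suc (size (enc (l x)))"])
      (intro pt_intros pb_Suc pb_pt assms | use size_enc_elem in force)+
  then show ?thesis by (simp add: foldl_Cons_rev[where f = "\<lambda>y. y"])
qed

lemma pt_append [pt_intros]:
  fixes l m :: "'a :: encodable \<Rightarrow> 'b :: encodable list"
  assumes "pt l" "pt m" shows "pt (\<lambda>x. l x @ m x)"
proof -
  have "pt (\<lambda>x. foldl (\<lambda>a y. y # a) (m x) (rev (l x)))"
    by (rule pt_foldl_add[where C = "\<lambda>x. Suc (size (enc (l x)))"])
      (intro pt_intros pb_Suc pb_pt assms | use size_enc_elem in force)+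
  then show ?thesis by (simp add: foldl_Cons_rev[where f = "\<lambda>y. y"])
qed

lemma pt_map [pt_intros]:
  fixes l :: "'a :: encodable \<Rightarrow> 'c :: encodable list" and f :: "'a \<Rightarrow> 'c \<Rightarrow> 'b :: encodable"
  assumes "pt (\<lambda>z. f (fst z) (snd z))" "pt l" shows "pt (\<lambda>x. map (f x) (l x))"
proof -
  obtain C where C: "pb C" "\<And>x y. y \<in> set (l x) \<Longrightarrow> size (enc (f (fst (x, y)) (snd (x, y)))) \<le> C x"
    using pb_elem[OF pb_pt[OF assms(1)] assms(2)] by blast
  have "pt (\<lambda>z :: 'a \<times> 'b list \<times> 'c. f (fst z) (snd (snd z)))"
    using pt_comp[OF assms(1), of "\<lambda>z. (fst z, snd (snd z))"] by (simp add: pt_intros)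
  then have "pt (\<lambda>x. foldl (\<lambda>a y. f x y # a) [] (l x))"
    by (intro pt_foldl_add[where C = "\<lambda>x. Suc (C x)"] pt_intros pb_Suc C(1) assms(2))
      (use C(2) in auto)
  then have "pt (\<lambda>x. rev (foldl (\<lambda>a y. f x y # a) [] (l x)))" by (rule pt_rev)
  then show ?thesis by (simp add: foldl_Cons_rev)
qed

lemma pt_concat [pt_intros]:
  fixes l :: "'a :: encodable \<Rightarrow> 'b :: encodable list list"
  assumes "pt l" shows "pt (\<lambda>x. concat (l x))"
proof -
  have *: "foldl (@) b l = b @ concat l" for b :: "'b list" and l by (induction l arbitrary: b) auto
  have "pt (\<lambda>x. foldl (@) [] (l x))"
  proof (rule pt_foldl_add[where C = "\<lambda>x. size (enc (l x))"])
    fix x b y assume "y \<in> set (l x)"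
    then show "size (enc (b @ y)) \<le> size (enc b) + size (enc (l x))" using size_enc_elem[of y "l x"] by simp
  qed (intro pt_intros pb_pt assms)+
  then show ?thesis by (simp add: *)
qed

lemma pt_filter [pt_intros]:
  fixes l :: "'a :: encodable \<Rightarrow> 'c :: encodable list"
  assumes "pt (\<lambda>z. P (fst z) (snd z))" "pt l" shows "pt (\<lambda>x. filter (P x) (l x))"
proof -
  have *: "filter Q xs = concat (map (\<lambda>y. if Q y then [y] else []) xs)" for Q and xs :: "'c list"
    by (induction xs) auto
  show ?thesis unfolding * by (intro pt_intros assms)
qed

lemma pt_ball [pt_intros]:
  fixes l :: "'a :: encodable \<Rightarrow> 'c :: encodable list"
  assumes "pt (\<lambda>z. P (fst z) (snd z))" "pt l" shows "pt (\<lambda>x. \<forall>y \<in> set (l x). P x y)"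
proof -
  have *: "(\<forall>y \<in> set xs. Q y) = (filter (\<lambda>y. \<not> Q y) xs = [])" for Q and xs :: "'c list"
    by (auto simp: filter_empty_conv)
  show ?thesis unfolding * by (intro pt_intros assms)
qed

lemma pt_member [pt_intros]:
  fixes l :: "'a :: encodable \<Rightarrow> 'c :: encodable list"
  assumes "pt f" "pt l" shows "pt (\<lambda>x. f x \<in> set (l x))"
proof -
  have *: "(y \<in> set xs) = (\<not> (filter (\<lambda>z. y = z) xs = []))" for y and xs :: "'c list"
    by (auto simp: filter_empty_conv)
  have "pt (\<lambda>z :: 'a \<times> 'c. f (fst z))" by (rule pt_comp[OF assms(1)]) (intro pt_intros)
  then show ?thesis unfolding * by (intro pt_intros assms)
qed

definition lookup :: "'b \<Rightarrow> ('a \<times> 'b) list \<Rightarrow> 'a \<Rightarrow> 'b" where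
  "lookup d l k = (case map_of l k of None \<Rightarrow> d | Some v \<Rightarrow> v)"

lemma pt_lookup [pt_intros]:
  fixes l :: "'a :: encodable \<Rightarrow> ('k :: encodable \<times> 'v :: encodable) list"
  assumes "pt d" "pt l" "pt k" shows "pt (\<lambda>x. lookup (d x) (l x) (k x))"
proof -
  have *: "lookup e m j = (case filter (\<lambda>p. fst p = j) m of [] \<Rightarrow> e | p # _ \<Rightarrow> snd p)"
    for e :: 'v and m and j :: 'k
    by (induction m) (auto simp: lookup_def)
  have "pt (\<lambda>z :: 'a \<times> 'k \<times> 'v. k (fst z))" by (rule pt_comp[OF assms(3)]) (intro pt_intros)
  then show ?thesis unfolding * by (intro pt_intros assms)
qed

lemma pt_zip [pt_intros]:
  fixes l :: "'a :: encodable \<Rightarrow> 'b :: encodable list" and m :: "'a \<Rightarrow> 'c :: encodable list"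
  assumes "pt l" "pt m" shows "pt (\<lambda>x. zip (l x) (m x))"
proof -
  let ?g = "\<lambda>a y. case fst a of [] \<Rightarrow> a | r # rs \<Rightarrow> (rs, (y, r) # snd a)"
  have *: "snd (foldl ?g (ys, a) xs) = rev (zip xs ys) @ a" for xs :: "'b list" and ys :: "'c list" and a
    by (induction xs arbitrary: ys a) (auto split: list.splits)
  have "pt (\<lambda>x. foldl ?g (m x, []) (l x))"
  proof (rule pt_foldl_add[where C = "\<lambda>x. 2 + size (enc (l x))"])
    fix x b y assume "y \<in> set (l x)"
    then show "size (enc (?g b y)) \<le> size (enc b) + (2 + size (enc (l x)))"
      using size_enc_elem[of y "l x"] by (cases b) (auto split: list.splits)
  qed (intro pt_intros pb_intros assms)+
  then have "pt (\<lambda>x. rev (snd (foldl ?g (m x, []) (l x))))" by (intro pt_rev pt_snd)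
  then show ?thesis by (simp add: *)
qed


section \<open>Binary arithmetic\<close>

fun bits :: "nat \<Rightarrow> bool list" where
  "bits n = (if n = 0 then [] else odd n # bits (n div 2))"

declare bits.simps [simp del]

lemma bits_0 [simp]: "bits 0 = []"
  and bits_pos: "n > 0 \<Longrightarrow> bits n = odd n # bits (n div 2)"
  by (subst bits.simps; simp)+

lemma enc_0 [simp]: "enc (0 :: nat) = Leaf"
  unfolding encode_nat by (subst enc_nat.simps) simp

lemma enc_nat_pos: "n > 0 \<Longrightarrow> enc (n :: nat) = Fork (enc (odd n)) (enc (n div 2))"
  unfolding encode_nat encode_bool by (subst enc_nat.simps) simp

lemma enc_bits: "enc (bits n) = enc n"
proof (induction n rule: bits.induct)
  case (1 n)
  then show ?case by (cases "n = 0") (simp_all add: bits_pos enc_nat_pos)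
qed

lemma pt_bits [pt_intros]: "pt f \<Longrightarrow> pt (\<lambda>x. bits (f x))"
  by (erule pt_retype) (rule enc_bits)

lemma enc_odd: "enc (odd (n :: nat)) = btree_hd (enc n)"
  by (cases "n = 0") (simp_all add: enc_nat_pos)

lemma enc_half: "enc (n div 2 :: nat) = btree_tl (enc n)"
  by (cases "n = 0") (simp_all add: enc_nat_pos)

lemma pt_odd [pt_intros]: "pt f \<Longrightarrow> pt (\<lambda>x. odd (f x :: nat))"
  by (erule pt_hd_enc) (rule enc_odd)

lemma pt_half [pt_intros]: "pt f \<Longrightarrow> pt (\<lambda>x. f x div (2 :: nat))"
  by (erule pt_tl_enc) (rule enc_half)

definition dbl :: "bool \<Rightarrow> nat \<Rightarrow> nat" where "dbl b n = of_bool b + 2 * n"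

text \<open>The exception is needed because encodings have no leading zeros: 0 is
  \<open>Leaf\<close>, not \<open>Fork Leaf Leaf\<close>.\<close>

lemma enc_dbl: "enc (dbl b n) = (if \<not> b \<and> n = 0 then Leaf else Fork (enc b) (enc n))"
proof (cases "\<not> b \<and> n = 0")
  case False
  then have "dbl b n > 0" "odd (dbl b n) = b" "dbl b n div 2 = n" by (auto simp: dbl_def)
  with False show ?thesis by (simp only: enc_nat_pos if_False)
qed (simp add: dbl_def)

lemma pt_dbl [pt_intros]:
  assumes "pt b" "pt n" shows "pt (\<lambda>x. dbl (b x) (n x))"
proof (rule pt_retype)
  show "pt (\<lambda>x. if \<not> b x \<and> n x = 0 then Leaf else Fork (enc (b x)) (enc (n x)))"
    by (intro pt_intros assms)
qed (simp only: enc_dbl enc_btree_def)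

text \<open>The size of the encoding is not monotone in the number, since a bit 1 takes two
  \<open>Fork\<close> nodes and a bit 0 only one. The bit length is monotone and agrees with the
  size up to a factor of 2.\<close>

definition blen :: "nat \<Rightarrow> nat" where "blen n = length (bits n)"

lemma blen_0 [simp]: "blen 0 = 0" by (simp add: blen_def)

lemma blen_pos: "n > 0 \<Longrightarrow> blen n = Suc (blen (n div 2))"
  by (simp add: blen_def bits_pos)

lemma blen_le_iff: "blen n \<le> k \<longleftrightarrow> n < 2 ^ k"
proof (induction k arbitrary: n)
  case 0 then show ?case by (cases "n = 0") (simp_all add: blen_def bits.simps[of n])
next
  case (Suc k)
  show ?case
  proof (cases "n = 0")
    case False
    then have "blen n = Suc (blen (n div 2))" by (simp add: blen_pos)
    then show ?thesis by (simp add: Suc.IH[of "n div 2"]) linarith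
  qed simp
qed

lemma less_2_blen: "n < 2 ^ blen n"
  using blen_le_iff by blast

lemma size_enc_bool: "size (enc (b :: bool)) \<le> 1"
  by (cases b) auto

lemma size_enc_nat_le: "size (enc n) \<le> 2 * blen n"
proof -
  have "size (enc l) \<le> 2 * length l" for l :: "bool list"
  proof (induction l)
    case (Cons b l)
    then show ?case using size_enc_bool[of b] by simp
  qed simp
  then show ?thesis unfolding blen_def enc_bits[symmetric] .
qed

lemma blen_le_size_enc: "blen n \<le> size (enc n)"
  unfolding blen_def enc_bits[symmetric] by (rule length_le_size_enc)

lemma size_enc_nat_le_of_less: "(n :: nat) < 2 ^ k \<Longrightarrow> size (enc n) \<le> 2 * k"
  using size_enc_nat_le[of n] blen_le_iff[of n k] by simp

lemma blen_mono: "m \<le> n \<Longrightarrow> blen m \<le> blen n"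
  using blen_le_iff less_2_blen le_less_trans by blast

lemma blen_mult_le: "blen (m * n) \<le> blen m + blen n"
  unfolding blen_le_iff power_add by (intro mult_strict_mono less_2_blen) auto

text \<open>Crude, but additive: summed over a list it bounds the result of a whole fold of
  additions.\<close>

lemma blen_add_le: "blen (m + n) \<le> blen m + blen n"
proof -
  have "m + n < Suc m * Suc n" by simp
  also have "\<dots> \<le> 2 ^ blen m * 2 ^ blen n" using less_2_blen by (intro mult_le_mono) (auto simp: Suc_le_eq)
  finally show ?thesis unfolding blen_le_iff power_add .
qed

lemma blen_Suc_le: "blen (Suc n) \<le> Suc (blen n)"
  using blen_add_le[of 1 n] by (simp add: blen_pos)

lemma blen_le_self: "blen n \<le> n"
  unfolding blen_le_iff by simp

text \<open>Numbers are built by \<open>dbl\<close> from the top bit down, so arithmetic folds over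
  \<open>rev (bits n)\<close>; this is the value of a prefix of that list.\<close>

definition msb :: "bool list \<Rightarrow> nat" where "msb l = foldl (\<lambda>m b. dbl b m) 0 l"

lemma msb_Nil [simp]: "msb [] = 0" and msb_snoc [simp]: "msb (l @ [b]) = dbl b (msb l)"
  by (simp_all add: msb_def)

lemma msb_less: "msb l < 2 ^ length l"
  by (induction l rule: rev_induct) (auto simp: dbl_def)

lemma msb_rev_bits [simp]: "msb (rev (bits n)) = n"
proof (induction n rule: bits.induct)
  case (1 n)
  then show ?case by (cases "n = 0"; cases "odd n") (auto simp: bits_pos dbl_def)
qed

text \<open>Carries travel upwards while the result is built downwards. The fold therefore keeps the
  prefix value together with its successor, and the next bit selects which of them to
  extend.\<close>

lemma pt_Suc [pt_intros]:
  assumes "pt f" shows "pt (\<lambda>x. Suc (f x))"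
proof -
  let ?g = "\<lambda>a b. if b then (dbl True (fst a), dbl False (snd a)) else (dbl False (fst a), dbl True (fst a))"
  have *: "foldl ?g (0, Suc 0) l = (msb l, Suc (msb l))" for l
    by (induction l rule: rev_induct) (auto simp: dbl_def)
  have "pt (\<lambda>x. foldl ?g (0, Suc 0) (rev (bits (f x))))"
  proof (rule pt_foldl)
    show "pb (\<lambda>x. 3 + 4 * length (rev (bits (f x))))" by (intro pb_intros pt_intros assms)
    fix x ys zs assume "rev (bits (f x)) = ys @ zs"
    then have "length ys \<le> length (rev (bits (f x)))" by simp
    moreover have "size (enc (msb ys)) \<le> 2 * length ys" "size (enc (Suc (msb ys))) \<le> 2 * Suc (length ys)"
      using msb_less[of ys] by (intro size_enc_nat_le_of_less; simp)+
    ultimately show "size (enc (foldl ?g (0, Suc 0) ys)) \<le> 3 + 4 * length (rev (bits (f x)))"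
      unfolding * by simp
  qed (intro pt_intros assms)+
  from pt_snd[OF this] show ?thesis unfolding * by simp
qed

lemma pt_pred [pt_intros]:
  assumes "pt f" shows "pt (\<lambda>x. f x - (1 :: nat))"
proof -
  \<comment> \<open>Value and predecessor of the prefix; a zero prefix followed by a zero bit keeps
    the truncated predecessor 0.\<close>
  let ?g = "\<lambda>a b. if b then (dbl True (fst a), dbl False (fst a))
    else (dbl False (fst a), if fst a = 0 then 0 else dbl True (snd a))"
  have *: "foldl ?g (0, 0) l = (msb l, msb l - 1)" for l
    by (induction l rule: rev_induct) (auto simp: dbl_def)
  have "pt (\<lambda>x. foldl ?g (0, 0) (rev (bits (f x))))"
  proof (rule pt_foldl)
    show "pb (\<lambda>x. 3 + 4 * length (rev (bits (f x))))" by (intro pb_intros pt_intros assms)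
    fix x ys zs assume "rev (bits (f x)) = ys @ zs"
    then have "length ys \<le> length (rev (bits (f x)))" by simp
    moreover have "size (enc (msb ys)) \<le> 2 * length ys" "size (enc (msb ys - 1)) \<le> 2 * length ys"
      using msb_less[of ys] by (auto intro!: size_enc_nat_le_of_less)
    ultimately show "size (enc (foldl ?g (0, 0) ys)) \<le> 3 + 4 * length (rev (bits (f x)))"
      unfolding * by simp
  qed (intro pt_intros assms)+
  from pt_snd[OF this] show ?thesis unfolding * by simp
qed

text \<open>The first fold \<open>?h\<close> splits both numbers into pairs of bits, the most
  significant pair ending up in front. The second fold \<open>?g\<close> keeps the sum of the
  prefixes and its successor, so a carry only selects between the two.\<close>

lemma pt_add [pt_intros]:
  fixes f g :: "'a :: encodable \<Rightarrow> nat"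
  assumes "pt f" "pt g" shows "pt (\<lambda>x. f x + g x)"
proof -
  let ?h = "\<lambda>s (b :: bool). (fst s div 2, fst (snd s) div (2 :: nat), (odd (fst s), odd (fst (snd s))) # snd (snd s))"
  let ?g = "\<lambda>a b. if fst b \<and> snd b then (dbl False (snd a), dbl True (snd a))
    else if fst b \<or> snd b then (dbl True (fst a), dbl False (snd a)) else (dbl False (fst a), dbl True (fst a))"
  let ?v = "\<lambda>l :: (bool \<times> bool) list. foldl (\<lambda>s b. 2 * s + of_bool (fst b) + of_bool (snd b)) (0 :: nat) l"
  have g: "foldl ?g (s, Suc s) l = (let t = foldl (\<lambda>s b. 2 * s + of_bool (fst b) + of_bool (snd b)) s l in (t, Suc t))" for s l
    by (induction l arbitrary: s) (auto simp: dbl_def Let_def)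
  have g0: "foldl ?g (0, Suc 0) l = (?v l, Suc (?v l))" for l
    using g[of 0 l] by (simp add: Let_def)
  have v: "?v l < 2 ^ Suc (length l) - 1" for l
  proof (induction l rule: rev_induct)
    case (snoc b l)
    have "2 ^ Suc (length l) \<ge> (2 :: nat)" by simp
    with snoc show ?case by (auto split: if_splits)
  qed simp
  have w: "fst (foldl ?g (m + n, Suc (m + n)) zs) = fst (foldl ?g (0, Suc 0) (snd (snd (foldl ?h (m, n, zs) l))))"
    if "m < 2 ^ length l" "n < 2 ^ length l" for m n l zs
    using that
  proof (induction l arbitrary: m n zs)
    case (Cons b l)
    have "foldl ?g (m + n, Suc (m + n)) zs = foldl ?g (m div 2 + n div 2, Suc (m div 2 + n div 2)) ((odd m, odd n) # zs)"
      by (auto simp: dbl_def intro!: arg_cong[where f = "\<lambda>s. foldl _ s zs"]) presburger+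
    then show ?case using Cons.IH[of "m div 2" "n div 2" "(odd m, odd n) # zs"] Cons.prems by simp
  qed simp
  \<comment> \<open>Only the length of this list matters: it is at least the bit length of either
    summand.\<close>
  let ?l = "\<lambda>x. bits (f x) @ bits (g x)"
  let ?zs = "\<lambda>x. snd (snd (foldl ?h (f x, g x, []) (?l x)))"
  have half: "size (enc (n div 2)) \<le> size (enc n)" for n :: nat
    by (cases "n = 0") (simp_all add: enc_nat_pos)
  have "pt (\<lambda>x. foldl ?h (f x, g x, []) (?l x))"
  proof (rule pt_foldl_add[where C = "\<lambda>_. 5"])
    fix s :: "nat \<times> nat \<times> (bool \<times> bool) list" and b
    obtain m n zs where "s = (m, n, zs)" by (cases s)
    then show "size (enc (?h s b)) \<le> size (enc s) + 5"
      using half[of m] half[of n] size_enc_bool[of "odd m"] size_enc_bool[of "odd n"] by simp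
  qed (intro pt_intros pb_intros assms)+
  then have zs: "pt ?zs" by (intro pt_snd)
  have "pt (\<lambda>x. foldl ?g (0, Suc 0) (?zs x))"
  proof (rule pt_foldl[OF zs])
    show "pb (\<lambda>x. 5 + 4 * length (?zs x))" by (intro pb_intros zs)
    fix x ys us assume "?zs x = ys @ us"
    then have "length ys \<le> length (?zs x)" by simp
    moreover have "size (enc (?v ys)) \<le> 2 * Suc (length ys)" "size (enc (Suc (?v ys))) \<le> 2 * Suc (length ys)"
      using v[of ys] by (intro size_enc_nat_le_of_less; linarith)+
    ultimately show "size (enc (foldl ?g (0, Suc 0) ys)) \<le> 5 + 4 * length (?zs x)"
      unfolding g0 by simp
  qed (intro pt_intros)+
  then have "pt (\<lambda>x. fst (foldl ?g (0, Suc 0) (?zs x)))" by (rule pt_fst)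
  moreover have "fst (foldl ?g (0, Suc 0) (?zs x)) = f x + g x" for x
  proof -
    have "f x < 2 ^ length (?l x)" "g x < 2 ^ length (?l x)"
      using blen_le_iff[of "f x" "length (?l x)"] blen_le_iff[of "g x" "length (?l x)"] by (auto simp: blen_def)
    from w[OF this, of "[]"] show ?thesis by simp
  qed
  ultimately show ?thesis by simp
qed

lemma pt_mult [pt_intros]:
  fixes f g :: "'a :: encodable \<Rightarrow> nat"
  assumes "pt f" "pt g" shows "pt (\<lambda>x. f x * g x)"
proof -
  let ?g = "\<lambda>m a b. if b then dbl False a + m else dbl False a"
  have *: "foldl (?g m) 0 l = msb l * m" for m l
    by (induction l rule: rev_induct) (auto simp: dbl_def algebra_simps)
  have g: "pt (\<lambda>z :: 'a \<times> nat \<times> bool. g (fst z))" by (rule pt_comp[OF assms(2)]) (intro pt_intros)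
  have "pt (\<lambda>x. foldl (?g (g x)) 0 (rev (bits (f x))))"
  proof (rule pt_foldl)
    show "pb (\<lambda>x. 2 * (length (rev (bits (f x))) + size (enc (g x))))" by (intro pb_intros pt_intros assms)
    fix x ys zs assume "rev (bits (f x)) = ys @ zs"
    then have "length ys \<le> length (rev (bits (f x)))" by simp
    moreover have "blen (msb ys) \<le> length ys" using msb_less[of ys] by (simp add: blen_le_iff)
    moreover have "size (enc (msb ys * g x)) \<le> 2 * (blen (msb ys) + blen (g x))"
      using size_enc_nat_le[of "msb ys * g x"] blen_mult_le[of "msb ys" "g x"] by simp
    ultimately show "size (enc (foldl (?g (g x)) 0 ys)) \<le> 2 * (length (rev (bits (f x))) + size (enc (g x)))"
      unfolding * using blen_le_size_enc[of "g x"] by (meson add_mono mult_le_mono2 order.trans)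
  qed (intro pt_intros assms g)+
  then show ?thesis unfolding * by simp
qed

lemma pt_sum_list [pt_intros]:
  fixes l :: "'a :: encodable \<Rightarrow> nat list"
  assumes "pt l" shows "pt (\<lambda>x. sum_list (l x))"
proof -
  have b: "blen (foldl (+) 0 ys) \<le> size (enc ys)" for ys
  proof (induction ys rule: rev_induct)
    case (snoc y ys)
    then show ?case using blen_add_le[of "foldl (+) 0 ys" y] blen_le_size_enc[of y] by simp
  qed simp
  have "pt (\<lambda>x. foldl (+) 0 (l x))"
  proof (rule pt_foldl[OF assms])
    show "pb (\<lambda>x. 2 * size (enc (l x)))" by (intro pb_mult pb_const pb_pt assms)
    fix x ys zs assume "l x = ys @ zs"
    then show "size (enc (foldl (+) 0 ys)) \<le> 2 * size (enc (l x))"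
      using b[of ys] size_enc_nat_le[of "foldl (+) 0 ys"] by simp
  qed (intro pt_intros)+
  moreover have "foldl (+) s ys = s + sum_list ys" for s :: nat and ys by (induction ys arbitrary: s) auto
  ultimately show ?thesis by simp
qed

lemma pt_prod_list [pt_intros]:
  fixes l :: "'a :: encodable \<Rightarrow> nat list"
  assumes "pt l" shows "pt (\<lambda>x. prod_list (l x))"
proof -
  have b: "blen (foldl (*) 1 ys) \<le> Suc (size (enc ys))" for ys :: "nat list"
  proof (induction ys rule: rev_induct)
    case Nil show ?case by (simp add: blen_pos)
  next
    case (snoc y ys)
    then show ?case using blen_mult_le[of "foldl (*) 1 ys" y] blen_le_size_enc[of y] by simp
  qed
  have "pt (\<lambda>x. foldl (*) 1 (l x))"
  proof (rule pt_foldl[OF assms])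
    show "pb (\<lambda>x. 2 * Suc (size (enc (l x))))" by (intro pb_mult pb_Suc pb_const pb_pt assms)
    fix x ys zs assume "l x = ys @ zs"
    then show "size (enc (foldl (*) 1 ys)) \<le> 2 * Suc (size (enc (l x)))"
      using b[of ys] size_enc_nat_le[of "foldl (*) 1 ys"] by simp
  qed (intro pt_intros)+
  moreover have "foldl (*) s ys = s * prod_list ys" for s :: nat and ys by (induction ys arbitrary: s) auto
  ultimately show ?thesis by simp
qed

text \<open>The bound is the length of a list, hence in effect unary; a range up to a number given
  in binary could be exponentially long.\<close>

lemma pt_upt [pt_intros]:
  fixes l :: "'a :: encodable \<Rightarrow> 'b :: encodable list"
  assumes "pt l" shows "pt (\<lambda>x. [0..<length (l x)])"
proof -
  let ?g = "\<lambda>a (y :: 'b). case a of [] \<Rightarrow> [0] | n # _ \<Rightarrow> Suc n # a"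
  have *: "foldl ?g [] ys = rev [0..<length ys]" for ys
  proof (induction ys rule: rev_induct)
    case (snoc y ys)
    then show ?case by (cases "length ys") simp_all
  qed simp
  have s: "size (enc (rev [0..<k])) \<le> k * (1 + 2 * k)" for k
  proof -
    have "size (enc l) \<le> length l * (1 + 2 * k)" if "\<forall>n \<in> set l. n \<le> k" for l
      using that
    proof (induction l)
      case (Cons n l)
      moreover have "size (enc n) \<le> 2 * k"
        using size_enc_nat_le[of n] blen_le_self[of n] Cons.prems by simp
      ultimately show ?case by simp
    qed simp
    from this[of "rev [0..<k]"] show ?thesis by simp
  qed
  have "pt (\<lambda>x. foldl ?g [] (l x))"
  proof (rule pt_foldl[OF assms])
    show "pb (\<lambda>x. length (l x) * (1 + 2 * length (l x)))" by (intro pb_intros assms)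
    fix x ys zs assume "l x = ys @ zs"
    then have "length ys \<le> length (l x)" by simp
    then have "length ys * (1 + 2 * length ys) \<le> length (l x) * (1 + 2 * length (l x))"
      by (intro mult_le_mono) auto
    then show "size (enc (foldl ?g [] ys)) \<le> length (l x) * (1 + 2 * length (l x))"
      unfolding * using s[of "length ys"] by linarith
  qed (intro pt_intros)+
  from pt_rev[OF this] show ?thesis unfolding * by simp
qed

lemma pt_enumerate [pt_intros]: "pt l \<Longrightarrow> pt (\<lambda>x. List.enumerate 0 (l x))"
  unfolding enumerate_eq_zip by (simp add: pt_intros)


section \<open>Search trees\<close>

text \<open>A search tree is a list of arcs \<open>((a, b), x)\<close>, newest first, each of which attaches the new
  vertex \<open>b\<close> to an older vertex \<open>a\<close>; a loop stands for a root.\<close>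

type_synonym ('a, 'x) arc_list = "(('a \<times> 'a) \<times> 'x) list"

definition reach :: "('a, 'x) arc_list \<Rightarrow> 'a list" where
  "reach T = map (\<lambda>e. snd (fst e)) T"

definition grow :: "('a, 'x) arc_list \<Rightarrow> ('a, 'x) arc_list \<Rightarrow> ('a, 'x) arc_list" where
  "grow A T = foldl (\<lambda>T e. if fst (fst e) \<in> set (reach T) \<and> snd (fst e) \<notin> set (reach T) then e # T else T) T A"

text \<open>A pass that starts before closure attaches the head of at least one more arc, so
  \<open>length A\<close> passes suffice.\<close>

definition close :: "('a, 'x) arc_list \<Rightarrow> ('a, 'x) arc_list \<Rightarrow> ('a, 'x) arc_list" where
  "close A T = foldl (\<lambda>T _. grow A T) T A"

definition closed_under :: "('a, 'x) arc_list \<Rightarrow> 'a set \<Rightarrow> bool" where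
  "closed_under A X \<longleftrightarrow> (\<forall>e \<in> set A. fst (fst e) \<in> X \<longrightarrow> snd (fst e) \<in> X)"

text \<open>A root from \<open>X\<close> may be added only when the older vertices are closed under
  the arcs. Later trees of a forest can then be relabelled without affecting earlier ones. Searches
  use \<open>{s}\<close> for \<open>X\<close>, forests \<open>UNIV\<close>.\<close>

fun arbor :: "('a, 'x) arc_list \<Rightarrow> 'a set \<Rightarrow> ('a, 'x) arc_list \<Rightarrow> bool" where
  "arbor A X [] \<longleftrightarrow> True"
| "arbor A X (e # T) \<longleftrightarrow> snd (fst e) \<notin> set (reach T) \<and> arbor A X T \<and>
     (e \<in> set A \<and> fst (fst e) \<in> set (reach T) \<or>
      fst (fst e) = snd (fst e) \<and> snd (fst e) \<in> X \<and> closed_under A (set (reach T)))"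

lemma reach_simps [simp]: "reach [] = []" "reach (e # T) = snd (fst e) # reach T"
  by (simp_all add: reach_def)

lemma foldl_const_funpow: "foldl (\<lambda>s _. f s) s l = (f ^^ length l) s"
  by (induction l arbitrary: s) (simp_all add: funpow_swap1)

text \<open>Replaces a loop by a fixed number of rounds: the goal states are fixed points, so
  surplus rounds do no harm.\<close>

lemma funpow_reaches:
  fixes \<mu> :: "'s \<Rightarrow> nat"
  assumes "\<And>s. I s \<Longrightarrow> P s \<Longrightarrow> f s = s" "\<And>s. I s \<Longrightarrow> \<not> P s \<Longrightarrow> I (f s) \<and> \<mu> (f s) < \<mu> s"
  shows "I s \<Longrightarrow> \<mu> s \<le> n \<Longrightarrow> I ((f ^^ n) s) \<and> P ((f ^^ n) s)"
proof (induction n arbitrary: s)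
  case 0
  then show ?case using assms(2)[of s] by auto
next
  case (Suc n)
  show ?case
  proof (cases "P s")
    case True
    then have "f s = s" using assms(1) Suc.prems by blast
    then have "(f ^^ k) s = s" for k by (induction k) simp_all
    then show ?thesis using True Suc.prems by metis
  next
    case False
    with assms(2) Suc.prems have "I (f s)" "\<mu> (f s) < \<mu> s" by auto
    with Suc.IH[of "f s"] Suc.prems show ?thesis by (simp add: funpow_swap1)
  qed
qed

lemma grow_invariant:
  assumes "I T" "\<And>T e. I T \<Longrightarrow> e \<in> set A \<Longrightarrow> fst (fst e) \<in> set (reach T) \<Longrightarrow> snd (fst e) \<notin> set (reach T) \<Longrightarrow> I (e # T)"
  shows "I (grow A T)"
proof -
  have "I (foldl (\<lambda>T e. if fst (fst e) \<in> set (reach T) \<and> snd (fst e) \<notin> set (reach T) then e # T else T) T B)"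
    if "I T" "set B \<subseteq> set A" for B T
    using that by (induction B arbitrary: T) (auto intro: assms(2))
  then show ?thesis using assms(1) unfolding grow_def by blast
qed

lemma grow_mono: "set (reach T) \<subseteq> set (reach (grow A T))"
  by (rule grow_invariant) auto

lemma arbor_grow: "arbor A X T \<Longrightarrow> arbor A X (grow A T)"
  by (rule grow_invariant) auto

lemma grow_closed: "closed_under A (set (reach T)) \<Longrightarrow> grow A T = T"
proof -
  assume c: "closed_under A (set (reach T))"
  have "foldl (\<lambda>T e. if fst (fst e) \<in> set (reach T) \<and> snd (fst e) \<notin> set (reach T) then e # T else T) T B = T"
    if "set B \<subseteq> set A" for B
    using that by (induction B) (use c in \<open>auto simp: closed_under_def\<close>)
  then show ?thesis by (simp add: grow_def)
qed

lemma grow_progress: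
  assumes "e \<in> set A" "fst (fst e) \<in> set (reach T)"
  shows "snd (fst e) \<in> set (reach (grow A T))"
proof -
  obtain B C where A: "A = B @ e # C" using assms(1) by (metis split_list)
  let ?T = "grow B T"
  have "fst (fst e) \<in> set (reach ?T)" using assms(2) grow_mono[of T B] by blast
  then have "snd (fst e) \<in> set (reach (grow [e] ?T))" by (auto simp: grow_def)
  moreover have "grow A T = grow C (grow [e] ?T)" by (simp add: grow_def A)
  ultimately show ?thesis using grow_mono by fastforce
qed

lemma close_properties:
  fixes A T :: "('a, 'x) arc_list"
  assumes "arbor A X T"
  shows "arbor A X (close A T)" "set (reach T) \<subseteq> set (reach (close A T))"
    "closed_under A (set (reach (close A T)))"
proof -
  \<comment> \<open>The arcs whose head is still missing. There are at most \<open>length A\<close>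
    of them, the number of passes made by \<open>close\<close>.\<close>
  define \<mu> where "\<mu> T = card {e \<in> set A. snd (fst e) \<notin> set (reach T)}" for T :: "('a, 'x) arc_list"
  have "\<mu> T \<le> length A"
    unfolding \<mu>_def by (rule order.trans[OF card_mono[of "set A"] card_length]) auto
  moreover have "\<mu> (grow A T) < \<mu> T" if nc: "\<not> closed_under A (set (reach T))" for T
  proof -
    obtain e where e: "e \<in> set A" "fst (fst e) \<in> set (reach T)" "snd (fst e) \<notin> set (reach T)"
      using nc unfolding closed_under_def by blast
    have "{e \<in> set A. snd (fst e) \<notin> set (reach (grow A T))} \<subset> {e \<in> set A. snd (fst e) \<notin> set (reach T)}"
      using grow_mono[of T A] grow_progress[OF e(1,2)] e by blast
    then show ?thesis unfolding \<mu>_def by (intro psubset_card_mono) auto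
  qed
  ultimately have "(arbor A X (close A T) \<and> set (reach T) \<subseteq> set (reach (close A T)))
      \<and> closed_under A (set (reach (close A T)))"
    unfolding close_def foldl_const_funpow
    using assms grow_mono[of _ A] arbor_grow[of A X]
    by (intro funpow_reaches[where \<mu> = \<mu> and I = "\<lambda>S. arbor A X S \<and> set (reach T) \<subseteq> set (reach S)"])
      (blast intro: grow_closed)+
  then show "arbor A X (close A T)" "set (reach T) \<subseteq> set (reach (close A T))"
    "closed_under A (set (reach (close A T)))" by auto
qed


section \<open>Minimum cuts\<close>

definition cut_cap :: "('a \<times> 'a) list \<Rightarrow> ('a \<times> 'a \<Rightarrow> nat) \<Rightarrow> 'a set \<Rightarrow> nat" where
  "cut_cap K r S = (\<Sum>k \<leftarrow> K. if fst k \<in> S \<and> snd k \<notin> S then r k else 0)"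

text \<open>Functions on the fixed list \<open>K\<close> of arcs are stored as association lists.\<close>

definition tab :: "'k list \<Rightarrow> ('k \<Rightarrow> 'v) \<Rightarrow> ('k \<times> 'v) list" where
  "tab K r = map (\<lambda>k. (k, r k)) K"

text \<open>The residual capacities after one unit has been sent from \<open>a\<close> to
  \<open>b\<close>.\<close>

definition push :: "'a \<Rightarrow> 'a \<Rightarrow> ('a \<times> 'a \<Rightarrow> nat) \<Rightarrow> 'a \<times> 'a \<Rightarrow> nat" where
  "push a b r k = (if k = (a, b) then r k - 1 else if k = (b, a) then Suc (r k) else r k)"

definition push_list :: "'a \<Rightarrow> 'a \<Rightarrow> ('a, nat) arc_list \<Rightarrow> ('a, nat) arc_list" where
  "push_list a b R = map (\<lambda>e. (fst e, if fst e = (a, b) then snd e - 1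
     else if fst e = (b, a) then Suc (snd e) else snd e)) R"

text \<open>The tree lists the arc into a vertex before the arcs into its ancestors, so one pass
  from the front follows the path from \<open>t\<close> back to the root, where the loop stops
  it.\<close>

definition augment :: "('a, 'x) arc_list \<Rightarrow> 'a \<Rightarrow> ('a, nat) arc_list \<Rightarrow> 'a \<times> ('a, nat) arc_list" where
  "augment T t R = foldl (\<lambda>s e. if snd (fst e) = fst s \<and> fst (fst e) \<noteq> fst s
     then (fst (fst e), push_list (fst (fst e)) (snd (fst e)) (snd s)) else s) (t, R) T"

definition search :: "'a \<Rightarrow> ('a, nat) arc_list \<Rightarrow> ('a, nat) arc_list" where
  "search s R = close (filter (\<lambda>e. snd e > 0) R) [((s, s), 0)]"

definition augstep :: "'a \<Rightarrow> 'a \<Rightarrow> ('a, nat) arc_list \<Rightarrow> ('a, nat) arc_list" where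
  "augstep s t R = (if t \<in> set (reach (search s R)) then snd (augment (search s R) t R) else R)"

definition refine :: "('a, nat) arc_list \<Rightarrow> ('a, nat) arc_list \<Rightarrow> ('a, nat) arc_list" where
  "refine R C = map (\<lambda>p. (fst (fst p), dbl (odd (snd (snd p))) (snd (fst p)))) (zip R C)"

definition phase :: "'a \<Rightarrow> 'a \<Rightarrow> ('a, nat) arc_list \<Rightarrow> ('a, nat) arc_list \<Rightarrow> ('a, nat) arc_list" where
  "phase s t R C = foldl (\<lambda>R _. augstep s t R) (refine R C) R"

text \<open>The capacities shifted right by every amount, the largest shift first. The bit length of
  their total covers the bit length of each of them.\<close>

definition halvings :: "('a, nat) arc_list \<Rightarrow> ('a, nat) arc_list list" where
  "halvings C = snd (foldl (\<lambda>p _. (map (\<lambda>e. (fst e, snd e div 2)) (fst p), fst p # snd p)) (C, [])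
     (bits (\<Sum>e \<leftarrow> C. snd e)))"

definition min_cut :: "'a \<Rightarrow> 'a \<Rightarrow> ('a, nat) arc_list \<Rightarrow> 'a list" where
  "min_cut s t C = reach (search s (foldl (phase s t) (map (\<lambda>e. (fst e, 0)) C) (halvings C)))"

section \<open>Correctness of the minimum cut algorithm\<close>

lemma push_list_tab: "push_list a b (tab K r) = tab K (push a b r)"
  by (auto simp: push_list_def tab_def push_def)

text \<open>Only the arcs \<open>(a, b)\<close> and \<open>(b, a)\<close> change, and at most one of
  them crosses. The difference of two indicators telescopes along a path.\<close>

lemma cut_push:
  assumes "distinct K" "(a, b) \<in> set K" "(b, a) \<in> set K" "a \<noteq> b" "r (a, b) > 0"
  shows "int (cut_cap K (push a b r) S) = int (cut_cap K r S) + of_bool (b \<in> S) - of_bool (a \<in> S)"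
proof -
  have *: "cut_cap K r S = (if a \<in> S \<and> b \<notin> S then r (a, b) else 0) + (if b \<in> S \<and> a \<notin> S then r (b, a) else 0)
    + (\<Sum>k \<in> set K - {(a, b)} - {(b, a)}. if fst k \<in> S \<and> snd k \<notin> S then r k else 0)" for r :: "'a \<times> 'a \<Rightarrow> nat"
    unfolding cut_cap_def using assms
    by (simp add: sum_list_distinct_conv_sum_set sum.remove[of "set K" "(a, b)"] sum.remove[of "set K - {(a, b)}" "(b, a)"])
  have "(\<Sum>k \<in> set K - {(a, b)} - {(b, a)}. if fst k \<in> S \<and> snd k \<notin> S then push a b r k else 0)
      = (\<Sum>k \<in> set K - {(a, b)} - {(b, a)}. if fst k \<in> S \<and> snd k \<notin> S then r k else 0)"
    by (intro sum.cong) (auto simp: push_def)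
  then show ?thesis unfolding *[of r] *[of "push a b r"]
    using assms(4,5) by (auto simp: push_def of_bool_def)
qed

lemma augment_Nil [simp]: "augment [] t R = (t, R)"
  by (simp add: augment_def)

lemma augment_Cons [simp]: "augment (e # T) t R = (if snd (fst e) = t \<and> fst (fst e) \<noteq> t
     then augment T (fst (fst e)) (push_list (fst (fst e)) (snd (fst e)) R) else augment T t R)"
  by (simp add: augment_def)

lemma augment_not_reached: "t \<notin> set (reach T) \<Longrightarrow> augment T t R = (t, R)"
  by (induction T) auto

text \<open>The changes from \<open>cut_push\<close> telescope along the tree path, leaving only its
  two ends \<open>s\<close> and \<open>u\<close>.\<close>

lemma augment_correct:
  assumes "distinct K" "arbor A {s} T" "u \<in> set (reach T)"
    "\<And>e. e \<in> set T \<Longrightarrow> fst (fst e) \<noteq> snd (fst e) \<Longrightarrow>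
       r (fst e) > 0 \<and> fst e \<in> set K \<and> prod.swap (fst e) \<in> set K"
  shows "\<exists>r'. snd (augment T u (tab K r)) = tab K r' \<and>
     (\<forall>S. int (cut_cap K r' S) = int (cut_cap K r S) + of_bool (u \<in> S) - of_bool (s \<in> S))"
  using assms
proof (induction T arbitrary: u r)
  case (Cons e T)
  obtain a b x where e: "e = ((a, b), x)" by (metis prod.collapse)
  consider "b \<noteq> u" | "b = u" "a = u" | "b = u" "a \<noteq> u" by blast
  then show ?case
  proof cases
    case 1
    then show ?thesis using Cons.IH[of u r] Cons.prems by (simp add: e)
  next
    case 2
    then have "u \<notin> set (reach T)" "u = s" using Cons.prems by (auto simp: e)
    then show ?thesis using 2 by (auto simp: e augment_not_reached)
  next
    case 3
    have ab: "r (a, b) > 0" "(a, b) \<in> set K" "(b, a) \<in> set K" using Cons.prems(4)[of e] 3 by (auto simp: e)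
    have T: "arbor A {s} T" "a \<in> set (reach T)" "b \<notin> set (reach T)" using Cons.prems 3 by (auto simp: e)
    have cp: "int (cut_cap K (push a b r) S) = int (cut_cap K r S) + of_bool (b \<in> S) - of_bool (a \<in> S)" for S
      by (rule cut_push) (use ab 3 \<open>distinct K\<close> in auto)
    have "\<exists>r'. snd (augment T a (tab K (push a b r))) = tab K r' \<and>
        (\<forall>S. int (cut_cap K r' S) = int (cut_cap K (push a b r) S) + of_bool (a \<in> S) - of_bool (s \<in> S))"
    proof (rule Cons.IH[OF \<open>distinct K\<close> T(1,2)])
      fix f assume f: "f \<in> set T" "fst (fst f) \<noteq> snd (fst f)"
      then have "snd (fst f) \<in> set (reach T)" by (auto simp: reach_def)
      \<comment> \<open>No older tree arc enters \<open>b\<close>, so the push takes no capacity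
        from the rest of the path; a reverse arc can only gain.\<close>
      with T have "fst f \<noteq> (a, b)" by auto
      then show "push a b r (fst f) > 0 \<and> fst f \<in> set K \<and> prod.swap (fst f) \<in> set K"
        using Cons.prems(4)[of f] f by (auto simp: push_def)
    qed
    then obtain r' where "snd (augment T a (tab K (push a b r))) = tab K r'"
      "\<And>S. int (cut_cap K r' S) = int (cut_cap K (push a b r) S) + of_bool (a \<in> S) - of_bool (s \<in> S)"
      by blast
    then show ?thesis using 3 cp by (intro exI[of _ r']) (simp add: e push_list_tab)
  qed
qed simp

text \<open>\<open>F\<close> plays the role of the value of the flow sent so far, while the flow
  itself is never represented. Equivalent residual capacities have the same minimum cuts.\<close>

definition equivalent :: "('a \<times> 'a) list \<Rightarrow> 'a \<Rightarrow> 'a \<Rightarrow> ('a \<times> 'a \<Rightarrow> nat) \<Rightarrow> ('a, nat) arc_list \<Rightarrow> bool" where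
  "equivalent K s t c R \<longleftrightarrow>
     (\<exists>r F. R = tab K r \<and> (\<forall>S. s \<in> S \<longrightarrow> t \<notin> S \<longrightarrow> cut_cap K r S + F = cut_cap K c S))"

definition list_cut :: "('a, nat) arc_list \<Rightarrow> 'a set \<Rightarrow> nat" where
  "list_cut R S = (\<Sum>e \<leftarrow> R. if fst (fst e) \<in> S \<and> snd (fst e) \<notin> S then snd e else 0)"

lemma list_cut_tab [simp]: "list_cut (tab K r) S = cut_cap K r S"
  by (simp add: list_cut_def tab_def cut_cap_def o_def cong: if_cong)

lemma search_properties:
  shows "arbor (filter (\<lambda>e. snd e > 0) R) {s} (search s R)" "s \<in> set (reach (search s R))"
    "list_cut R (set (reach (search s R))) = 0"
proof -
  let ?A = "filter (\<lambda>e. snd e > 0) R"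
  have "arbor ?A {s} [((s, s), 0)]" by (simp add: closed_under_def)
  note * = close_properties[OF this, folded search_def]
  show "arbor ?A {s} (search s R)" by (rule *)
  show "s \<in> set (reach (search s R))" using *(2) by simp
  show "list_cut R (set (reach (search s R))) = 0"
  proof -
    have "snd e = 0" if "e \<in> set R" "fst (fst e) \<in> set (reach (search s R))" "snd (fst e) \<notin> set (reach (search s R))" for e
    proof (rule ccontr)
      assume "snd e \<noteq> 0"
      then have "e \<in> set (filter (\<lambda>e. snd e > 0) R)" using that(1) by simp
      then show False using *(3) that(2,3) unfolding closed_under_def by blast
    qed
    then show ?thesis unfolding list_cut_def sum_list_eq_0_iff by auto
  qed
qed

lemma arbor_elem:
  assumes "arbor A X T" "e \<in> set T" "fst (fst e) \<noteq> snd (fst e)"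
  shows "e \<in> set A"
  using assms by (induction T) auto

text \<open>Every cut separating \<open>s\<close> from \<open>t\<close> loses exactly 1, so the
  value of any one such cut bounds the number of further augmentations.\<close>

lemma augstep_correct:
  assumes "distinct K" "set K = V \<times> V" "equivalent K s t c R" "t \<in> set (reach (search s R))"
  shows "equivalent K s t c (augstep s t R)"
    "\<And>S. s \<in> S \<Longrightarrow> t \<notin> S \<Longrightarrow> Suc (list_cut (augstep s t R) S) = list_cut R S"
proof -
  obtain r F where R: "R = tab K r" and F: "\<And>S. s \<in> S \<Longrightarrow> t \<notin> S \<Longrightarrow> cut_cap K r S + F = cut_cap K c S"
    using assms(3) unfolding equivalent_def by blast
  have "r (fst e) > 0 \<and> fst e \<in> set K \<and> prod.swap (fst e) \<in> set K"
    if "e \<in> set (search s R)" "fst (fst e) \<noteq> snd (fst e)" for e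
  proof -
    have "e \<in> set (filter (\<lambda>e. snd e > 0) R)"
      using search_properties(1) that by (rule arbor_elem)
    then show ?thesis using assms(2) by (auto simp: R tab_def)
  qed
  from augment_correct[OF assms(1) search_properties(1) assms(4) this, simplified R] obtain r' where
    r': "augstep s t R = tab K r'" and
    c: "\<And>S. int (cut_cap K r' S) = int (cut_cap K r S) + of_bool (t \<in> S) - of_bool (s \<in> S)"
    using assms(4) by (auto simp: augstep_def R)
  have c': "Suc (cut_cap K r' S) = cut_cap K r S" if "s \<in> S" "t \<notin> S" for S
    using c[of S] that by simp
  show "equivalent K s t c (augstep s t R)"
    unfolding equivalent_def r'
  proof (intro exI[of _ r'] exI[of _ "Suc F"] conjI allI impI)
    fix S assume "s \<in> S" "t \<notin> S"
    then show "cut_cap K r' S + Suc F = cut_cap K c S" using F[of S] c'[of S] by simp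
  qed simp
  show "\<And>S. s \<in> S \<Longrightarrow> t \<notin> S \<Longrightarrow> Suc (list_cut (augstep s t R) S) = list_cut R S"
    unfolding r' by (simp add: R c')
qed

lemma cut_dbl: "cut_cap K (\<lambda>k. dbl (odd (c k)) (r k)) S = cut_cap K (\<lambda>k. of_bool (odd (c k))) S + 2 * cut_cap K r S"
  unfolding cut_cap_def by (induction K) (auto simp: dbl_def)

lemma phase_correct:
  assumes "distinct K" "set K = V \<times> V" "equivalent K s t (\<lambda>k. c k div 2) R" "t \<notin> set (reach (search s R))"
  shows "equivalent K s t c (phase s t R (tab K c)) \<and> t \<notin> set (reach (search s (phase s t R (tab K c))))"
proof -
  obtain r F where R: "R = tab K r"
    and F: "\<And>S. s \<in> S \<Longrightarrow> t \<notin> S \<Longrightarrow> cut_cap K r S + F = cut_cap K (\<lambda>k. c k div 2) S"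
    using assms(3) unfolding equivalent_def by blast
  define r' where "r' k = dbl (odd (c k)) (r k)" for k
  have ref: "refine R (tab K c) = tab K r'"
    unfolding refine_def R tab_def r'_def by (simp add: zip_map_map o_def zip_same_conv_map)
  have c: "cut_cap K c S = cut_cap K (\<lambda>k. of_bool (odd (c k))) S + 2 * cut_cap K (\<lambda>k. c k div 2) S" for S
  proof -
    have "dbl (odd n) (n div 2) = n" for n by (cases "odd n") (simp_all add: dbl_def)
    then show ?thesis using cut_dbl[of K c "\<lambda>k. c k div 2" S] by simp
  qed
  have eq: "equivalent K s t c (refine R (tab K c))"
    unfolding equivalent_def ref
  proof (intro exI[of _ r'] exI[of _ "2 * F"] conjI allI impI)
    fix S assume "s \<in> S" "t \<notin> S"
    from F[OF this] show "cut_cap K r' S + 2 * F = cut_cap K c S"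
      unfolding r'_def cut_dbl c by simp
  qed simp
  \<comment> \<open>The cut left by the previous phase stays fixed during this one; its value is the
    variant that bounds the augmentations.\<close>
  define S where "S = set (reach (search s R))"
  have S: "s \<in> S" "t \<notin> S" using assms(4) search_properties(2) by (auto simp: S_def)
  have "cut_cap K r S = 0" using search_properties(3)[of R s] by (simp add: S_def R)
  then have "cut_cap K r' S = cut_cap K (\<lambda>k. of_bool (odd (c k))) S" unfolding r'_def cut_dbl by simp
  also have "\<dots> \<le> (\<Sum>k \<leftarrow> K. 1)" unfolding cut_cap_def by (rule sum_list_mono) auto
  finally have bound: "list_cut (refine R (tab K c)) S \<le> length R"
    by (simp add: ref sum_list_triv) (simp add: R tab_def)
  have dec: "Suc (list_cut (augstep s t R) S) = list_cut R S"
    if "equivalent K s t c R" "t \<in> set (reach (search s R))" for R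
    using augstep_correct(2)[OF assms(1,2) that S] .
  show ?thesis
    unfolding phase_def foldl_const_funpow
  proof (rule funpow_reaches[where I = "equivalent K s t c" and P = "\<lambda>R. t \<notin> set (reach (search s R))"
        and \<mu> = "\<lambda>R. list_cut R S", OF _ _ eq bound])
    show "augstep s t R = R" if "t \<notin> set (reach (search s R))" for R
      using that by (simp add: augstep_def)
    show "equivalent K s t c (augstep s t R) \<and> list_cut (augstep s t R) S < list_cut R S"
      if "equivalent K s t c R" "\<not> t \<notin> set (reach (search s R))" for R
      using augstep_correct(1)[OF assms(1,2) that(1)] dec[OF that(1)] that(2) by auto
  qed
qed

lemma halvings_tab:
  "halvings (tab K c) = rev (map (\<lambda>j. tab K (\<lambda>k. c k div 2 ^ j)) [0..<blen (\<Sum>k \<leftarrow> K. c k)])"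
proof -
  have *: "foldl (\<lambda>p _. (map (\<lambda>e. (fst e, snd e div 2)) (fst p), fst p # snd p)) (tab K c, []) l
     = (tab K (\<lambda>k. c k div 2 ^ length l), rev (map (\<lambda>j. tab K (\<lambda>k. c k div 2 ^ j)) [0..<length l]))" for l :: "bool list"
    by (induction l rule: rev_induct) (simp_all add: tab_def o_def power_Suc2 div_mult2_eq del: power_Suc)
  show ?thesis unfolding halvings_def * by (simp add: blen_def tab_def o_def)
qed

theorem min_cut_correct:
  fixes c :: "'a \<times> 'a \<Rightarrow> nat"
  assumes "distinct K" "set K = V \<times> V" "s \<noteq> t"
  defines "S \<equiv> set (min_cut s t (tab K c))"
  shows "s \<in> S" "t \<notin> S" "\<And>S'. s \<in> S' \<Longrightarrow> t \<notin> S' \<Longrightarrow> cut_cap K c S \<le> cut_cap K c S'"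
proof -
  define B where "B = blen (\<Sum>k \<leftarrow> K. c k)"
  have small: "c k div 2 ^ B = 0" if "k \<in> set K" for k
  proof -
    have "c k \<le> (\<Sum>k \<leftarrow> K. c k)" using that by (intro member_le_sum_list) auto
    also have "\<dots> < 2 ^ B" unfolding B_def by (rule less_2_blen)
    finally show ?thesis by simp
  qed
  \<comment> \<open>The state after the bits from position \<open>B - 1\<close> down to
    \<open>m\<close>. The induction descends from \<open>B\<close>, where all shifted capacities
    vanish and the search does not leave \<open>s\<close>.\<close>
  define R where "R m = foldl (phase s t) (tab K (\<lambda>_. 0)) (rev (map (\<lambda>j. tab K (\<lambda>k. c k div 2 ^ j)) [m..<B]))" for m
  have inv: "equivalent K s t (\<lambda>k. c k div 2 ^ m) (R m) \<and> t \<notin> set (reach (search s (R m)))"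
    if "m \<le> B" for m
    using that
  proof (induction rule: inc_induct)
    case base
    have "cut_cap K (\<lambda>_. 0) S = cut_cap K (\<lambda>k. c k div 2 ^ B) S" for S
      unfolding cut_cap_def by (intro arg_cong[where f = sum_list] map_cong) (auto simp: small)
    moreover have "filter (\<lambda>e. snd e > 0) (tab K (\<lambda>_. 0 :: nat)) = []" by (simp add: tab_def)
    then have "search s (tab K (\<lambda>_. 0)) = [((s, s), 0)]" by (simp add: search_def close_def)
    ultimately show ?case using assms(3) unfolding R_def equivalent_def
      by (intro conjI exI[of _ "\<lambda>_. 0"] exI[of _ 0]) auto
  next
    case (step m)
    have "R m = phase s t (R (Suc m)) (tab K (\<lambda>k. c k div 2 ^ m))"
      unfolding R_def using step.hyps by (subst upt_conv_Cons) auto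
    moreover have "(\<lambda>k. c k div 2 ^ m div 2) = (\<lambda>k. c k div 2 ^ Suc m)"
      by (simp add: div_mult2_eq[symmetric] mult.commute)
    ultimately show ?case using phase_correct[OF assms(1,2), of s t "\<lambda>k. c k div 2 ^ m" "R (Suc m)"] step.IH by simp
  qed
  have S: "S = set (reach (search s (R 0)))"
    unfolding S_def min_cut_def halvings_tab R_def B_def by (simp add: tab_def o_def)
  show "s \<in> S" "t \<notin> S" using inv[of 0] search_properties(2) by (auto simp: S)
  obtain r F where R: "R 0 = tab K r" and F: "\<And>S. s \<in> S \<Longrightarrow> t \<notin> S \<Longrightarrow> cut_cap K r S + F = cut_cap K c S"
    using inv[of 0] unfolding equivalent_def by auto
  \<comment> \<open>Hence \<open>F\<close> equals the original value of \<open>S\<close>, and it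
    bounds every other cut from below.\<close>
  have "cut_cap K r S = 0" using search_properties(3)[of "R 0" s] by (simp add: S R)
  then show "cut_cap K c S \<le> cut_cap K c S'" if "s \<in> S'" "t \<notin> S'" for S'
    using F[OF \<open>s \<in> S\<close> \<open>t \<notin> S\<close>] F[OF that] by simp
qed


section \<open>Minimum cuts in polynomial time\<close>

lemma pt_reach [pt_intros]:
  fixes T :: "'b :: encodable \<Rightarrow> ('a :: encodable, 'x :: encodable) arc_list"
  assumes "pt T" shows "pt (\<lambda>x. reach (T x))"
  unfolding reach_def by (intro pt_intros assms)

lemma size_grow:
  fixes A T :: "('a :: encodable, 'x :: encodable) arc_list"
  shows "size (enc (grow A T)) \<le> size (enc T) + length A * Suc (size (enc A))"
proof -
  have "size (enc (if P then e # T else T)) \<le> size (enc T) + Suc (size (enc A))"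
    if "e \<in> set A" for P e and T :: "('a, 'x) arc_list"
    using size_enc_elem[OF that] by auto
  then show ?thesis
    unfolding grow_def
    by (intro foldl_measure[where I = "\<lambda>_. True" and m = "\<lambda>T. size (enc T)", THEN conjunct2]) auto
qed

lemma pt_grow [pt_intros]:
  fixes A T :: "'b :: encodable \<Rightarrow> ('a :: encodable, 'x :: encodable) arc_list"
  assumes "pt A" "pt T" shows "pt (\<lambda>x. grow (A x) (T x))"
  unfolding grow_def
proof (rule pt_foldl_add[where C = "\<lambda>x. Suc (size (enc (A x)))"])
  fix x and U :: "('a, 'x) arc_list" and e assume "e \<in> set (A x)"
  then show "size (enc (if fst (fst e) \<in> set (reach U) \<and> snd (fst e) \<notin> set (reach U) then e # U else U))
      \<le> size (enc U) + Suc (size (enc (A x)))"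
    using size_enc_elem[of e "A x"] by auto
qed (intro pt_intros pb_Suc pb_pt assms)+

lemma pt_close [pt_intros]:
  fixes A T :: "'b :: encodable \<Rightarrow> ('a :: encodable, 'x :: encodable) arc_list"
  assumes "pt A" "pt T" shows "pt (\<lambda>x. close (A x) (T x))"
  unfolding close_def
proof (rule pt_foldl_add[where C = "\<lambda>x. length (A x) * Suc (size (enc (A x)))"])
  have "pt (\<lambda>z :: 'b \<times> ('a, 'x) arc_list \<times> ('a \<times> 'a) \<times> 'x. A (fst z))"
    by (rule pt_comp[OF assms(1)]) (intro pt_intros)
  then show "pt (\<lambda>z :: 'b \<times> ('a, 'x) arc_list \<times> ('a \<times> 'a) \<times> 'x. grow (A (fst z)) (fst (snd z)))"
    by (intro pt_intros)
qed (intro pb_intros pb_pt assms size_grow)+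

lemma length_grow: "length (grow A T) \<le> length T + length A"
  using foldl_measure[where I = "\<lambda>_. True" and m = length and l = A and c = 1 and a = T]
  unfolding grow_def by simp

lemma length_close: "length (close A T) \<le> length T + length A * length A"
  using foldl_measure[where I = "\<lambda>_. True" and m = length and l = A and c = "length A" and a = T and g = "\<lambda>T _. grow A T"]
    length_grow[of A]
  unfolding close_def by simp

lemma length_search: "length (search s R) \<le> 1 + length R * length R"
proof -
  let ?n = "length (filter (\<lambda>e. snd e > 0) R)"
  have "length (search s R) \<le> 1 + ?n * ?n"
    unfolding search_def using length_close[of _ "[((s, s), 0)]"] by simp
  also have "?n * ?n \<le> length R * length R" by (intro mult_le_mono length_filter_le)
  finally show ?thesis by simp
qed

lemma pt_pos [pt_intros]: "pt f \<Longrightarrow> pt (\<lambda>x. (f x :: nat) > 0)"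
  unfolding neq0_conv[symmetric] by (intro pt_intros)

lemma pt_search [pt_intros]:
  fixes R :: "'b :: encodable \<Rightarrow> ('a :: encodable, nat) arc_list"
  assumes "pt R" shows "pt (\<lambda>x. search s (R x))"
  unfolding search_def by (intro pt_intros assms)

text \<open>Unlike \<^const>\<open>size\<close>, this measure of the data does not grow when a capacity is decreased.\<close>

definition arcs_weight :: "('a :: encodable, nat) arc_list \<Rightarrow> nat" where
  "arcs_weight R = (\<Sum>e \<leftarrow> R. 2 + size (enc (fst e)) + 2 * blen (snd e))"

lemma size_le_arcs_weight: "size (enc R) \<le> arcs_weight R"
  unfolding arcs_weight_def
proof (induction R)
  case (Cons e R)
  then show ?case using size_enc_nat_le[of "snd e"] by (simp add: enc_prod_def case_prod_beta)
qed simp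

lemma arcs_weight_le_size: "arcs_weight R \<le> 2 * size (enc R)"
  unfolding arcs_weight_def
proof (induction R)
  case (Cons e R)
  then show ?case using blen_le_size_enc[of "snd e"] by (simp add: enc_prod_def case_prod_beta)
qed simp

lemma length_push_list [simp]: "length (push_list a b R) = length R"
  by (simp add: push_list_def)

lemma arcs_weight_map_le:
  assumes "\<And>e. e \<in> set R \<Longrightarrow> blen (f e) \<le> Suc (blen (snd e))"
  shows "arcs_weight (map (\<lambda>e. (fst e, f e)) R) \<le> arcs_weight R + 2 * length R"
  using assms unfolding arcs_weight_def by (induction R) force+

lemma arcs_weight_push: "arcs_weight (push_list a b R) \<le> arcs_weight R + 2 * length R"
proof -
  have "blen (n - 1) \<le> Suc (blen n)" for n
    by (rule le_SucI[OF blen_mono]) simp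
  then show ?thesis
    unfolding push_list_def by (intro arcs_weight_map_le) (simp add: blen_Suc_le)
qed

lemma pt_push_list [pt_intros]:
  fixes R :: "'b :: encodable \<Rightarrow> ('a :: encodable, nat) arc_list"
  assumes "pt a" "pt b" "pt R" shows "pt (\<lambda>x. push_list (a x) (b x) (R x))"
proof -
  have "pt (\<lambda>z :: 'b \<times> ('a \<times> 'a) \<times> nat. a (fst z))" "pt (\<lambda>z :: 'b \<times> ('a \<times> 'a) \<times> nat. b (fst z))"
    by (rule pt_comp[OF assms(1)] pt_comp[OF assms(2)]; intro pt_intros)+
  then show ?thesis unfolding push_list_def by (intro pt_intros assms)
qed

lemma augment_size:
  fixes T :: "('a :: encodable, 'x :: encodable) arc_list"
  shows "length (snd (augment T t R)) = length R \<and>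
    arcs_weight (snd (augment T t R)) \<le> arcs_weight R + length T * (2 * length R)"
proof (induction T arbitrary: t R)
  case (Cons e T)
  show ?case
    using Cons[of t R] Cons[of "fst (fst e)" "push_list (fst (fst e)) (snd (fst e)) R"]
      arcs_weight_push[of "fst (fst e)" "snd (fst e)" R] by auto
qed simp

lemma pt_augment [pt_intros]:
  fixes T :: "'b :: encodable \<Rightarrow> ('a :: encodable, 'x :: encodable) arc_list"
  assumes "pt T" "pt t" "pt R" shows "pt (\<lambda>x. augment (T x) (t x) (R x))"
  unfolding augment_def
\<comment> \<open>The current vertex is \<open>t\<close> or the tail of a tree arc and so has
  bounded size; only the capacities can grow.\<close>
proof (rule pt_foldl_measure[where C = "\<lambda>x. 2 * length (R x)"
      and m = "\<lambda>x s. 1 + size (enc (t x)) + size (enc (T x)) + arcs_weight (snd s)"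
      and A = "\<lambda>x. 1 + size (enc (t x)) + size (enc (T x)) + 2 * size (enc (R x))"
      and I = "\<lambda>x s. size (enc (fst s)) \<le> size (enc (t x)) + size (enc (T x)) \<and> length (snd s) = length (R x)"])
  fix x and s :: "'a \<times> ('a, nat) arc_list" and e
  assume I: "size (enc (fst s)) \<le> size (enc (t x)) + size (enc (T x)) \<and> length (snd s) = length (R x)"
  show "size (enc s) \<le> 1 + size (enc (t x)) + size (enc (T x)) + arcs_weight (snd s)"
    using I size_le_arcs_weight[of "snd s"] by (simp add: enc_prod_def case_prod_beta)
  assume "e \<in> set (T x)"
  from size_enc_elem[OF this] have "size (enc (fst (fst e))) \<le> size (enc (T x))"
    by (simp add: enc_prod_def case_prod_beta)
  then show "(size (enc (fst (if snd (fst e) = fst s \<and> fst (fst e) \<noteq> fst s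
     then (fst (fst e), push_list (fst (fst e)) (snd (fst e)) (snd s)) else s))) \<le> size (enc (t x)) + size (enc (T x)) \<and>
     length (snd (if snd (fst e) = fst s \<and> fst (fst e) \<noteq> fst s
     then (fst (fst e), push_list (fst (fst e)) (snd (fst e)) (snd s)) else s)) = length (R x)) \<and>
    1 + size (enc (t x)) + size (enc (T x)) + arcs_weight (snd (if snd (fst e) = fst s \<and> fst (fst e) \<noteq> fst s
     then (fst (fst e), push_list (fst (fst e)) (snd (fst e)) (snd s)) else s))
     \<le> 1 + size (enc (t x)) + size (enc (T x)) + arcs_weight (snd s) + 2 * length (R x)"
    using I arcs_weight_push[of "fst (fst e)" "snd (fst e)" "snd s"] by auto
qed (intro pt_intros pb_intros assms | use arcs_weight_le_size in auto)+

text \<open>The search tree has at most \<open>1 + length R * length R\<close> arcs, each causing at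
  most one push. A push lengthens each number by at most one bit, which \<open>arcs_weight\<close>
  counts twice.\<close>

lemma augstep_size:
  "length (augstep s t R) = length R \<and>
   arcs_weight (augstep s t R) \<le> arcs_weight R + (1 + length R * length R) * (2 * length R)"
proof -
  have "length (search s R) * (2 * length R) \<le> (1 + length R * length R) * (2 * length R)"
    by (rule mult_le_mono1[OF length_search])
  then show ?thesis using augment_size[of "search s R" t R] unfolding augstep_def by auto
qed

lemma pt_augstep [pt_intros]:
  fixes R :: "'b :: encodable \<Rightarrow> ('a :: encodable, nat) arc_list"
  assumes "pt R" shows "pt (\<lambda>x. augstep s t (R x))"
  unfolding augstep_def by (intro pt_intros assms)

lemma refine_size:
  "length (refine R C) \<le> length R" "arcs_weight (refine R C) \<le> arcs_weight R + 2 * length R"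
proof -
  show "length (refine R C) \<le> length R" by (simp add: refine_def)
  have "blen (dbl b n) \<le> Suc (blen n)" for b n
    using less_2_blen[of n] by (simp add: blen_le_iff dbl_def)
  then show "arcs_weight (refine R C) \<le> arcs_weight R + 2 * length R"
  proof (induction R arbitrary: C)
    case (Cons e R)
    show ?case
    proof (cases C)
      case (Cons c C')
      then show ?thesis using Cons.IH[OF Cons.prems, of C'] Cons.prems[of "odd (snd c)" "snd e"]
        unfolding refine_def arcs_weight_def by simp
    qed (simp add: refine_def arcs_weight_def)
  qed (simp add: refine_def arcs_weight_def)
qed

lemma pt_refine [pt_intros]:
  fixes R :: "'b :: encodable \<Rightarrow> ('a :: encodable, nat) arc_list"
  assumes "pt R" "pt C" shows "pt (\<lambda>x. refine (R x) (C x))"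
  unfolding refine_def by (intro pt_intros assms)

text \<open>The new bits contribute \<open>2 * n\<close>; each of the at most \<open>n\<close>
  augmentations contributes the bound of \<open>augstep_size\<close>.\<close>

definition phase_growth :: "nat \<Rightarrow> nat" where
  "phase_growth n = 2 * n + n * ((1 + n * n) * (2 * n))"

lemma phase_size:
  assumes "length R \<le> n"
  shows "length (phase s t R C) \<le> n \<and> arcs_weight (phase s t R C) \<le> arcs_weight R + phase_growth n"
proof -
  let ?c = "(1 + n * n) * (2 * n)"
  have "length (augstep s t R) \<le> n \<and> arcs_weight (augstep s t R) \<le> arcs_weight R + ?c"
    if "length R \<le> n" for R
  proof -
    have "(1 + length R * length R) * (2 * length R) \<le> ?c"
      using that by (intro mult_le_mono add_le_mono) auto
    with augstep_size[of s t R] that show ?thesis by linarith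
  qed
  then have "length (phase s t R C) \<le> n \<and> arcs_weight (phase s t R C) \<le> arcs_weight (refine R C) + length R * ?c"
    unfolding phase_def using refine_size(1)[of R C] assms
    by (intro foldl_measure[where I = "\<lambda>R. length R \<le> n" and m = arcs_weight]) auto
  moreover have "length R * ?c \<le> n * ?c" using assms by (rule mult_le_mono1)
  ultimately show ?thesis using refine_size(2)[of R C] assms unfolding phase_growth_def by linarith
qed

lemma pt_phase [pt_intros]:
  fixes R :: "'b :: encodable \<Rightarrow> ('a :: encodable, nat) arc_list"
  assumes "pt R" "pt C" shows "pt (\<lambda>x. phase s t (R x) (C x))"
  unfolding phase_def
proof (rule pt_foldl_measure[where C = "\<lambda>x. (1 + length (R x) * length (R x)) * (2 * length (R x))"
      and m = "\<lambda>_. arcs_weight" and A = "\<lambda>x. 2 * size (enc (refine (R x) (C x)))"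
      and I = "\<lambda>x U. length U \<le> length (R x)"])
  fix x and U :: "('a, nat) arc_list" assume U: "length U \<le> length (R x)"
  have "(1 + length U * length U) * (2 * length U) \<le> (1 + length (R x) * length (R x)) * (2 * length (R x))"
    using U by (intro mult_le_mono add_le_mono) auto
  with augstep_size[of s t U] U
  show "length (augstep s t U) \<le> length (R x) \<and>
      arcs_weight (augstep s t U) \<le> arcs_weight U + (1 + length (R x) * length (R x)) * (2 * length (R x))"
    by linarith
qed (intro pt_intros pb_intros assms refine_size size_le_arcs_weight arcs_weight_le_size)+

lemma pt_halvings [pt_intros]:
  fixes C :: "'b :: encodable \<Rightarrow> ('a :: encodable, nat) arc_list"
  assumes "pt C" shows "pt (\<lambda>x. halvings (C x))"
proof -
  let ?g = "\<lambda>p (_ :: bool). (map (\<lambda>e. (fst e, snd e div 2)) (fst p), fst p # snd p) :: ('a, nat) arc_list \<times> ('a, nat) arc_list list"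
  have half: "size (enc (map (\<lambda>e. (fst e, snd e div 2)) D)) \<le> size (enc D)" for D :: "('a, nat) arc_list"
  proof (induction D)
    case (Cons e D)
    have "size (enc (n div 2)) \<le> size (enc n)" for n :: nat
      by (cases "n = 0") (simp_all add: enc_nat_pos)
    from this[of "snd e"] Cons show ?case by (simp add: enc_prod_def case_prod_beta)
  qed simp
  have "pt (\<lambda>x. foldl ?g (C x, []) (bits (\<Sum>e \<leftarrow> C x. snd e)))"
  proof (rule pt_foldl_inv[where C = "\<lambda>x. Suc (size (enc (C x)))" and I = "\<lambda>x p. size (enc (fst p)) \<le> size (enc (C x))"])
    fix x and p :: "('a, nat) arc_list \<times> ('a, nat) arc_list list" and b
    assume "size (enc (fst p)) \<le> size (enc (C x))"
    with half[of "fst p"] show "size (enc (fst (?g p b))) \<le> size (enc (C x)) \<and>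
      size (enc (?g p b)) \<le> size (enc p) + Suc (size (enc (C x)))"
      by (cases p) simp
  qed (intro pt_intros pb_intros assms | simp)+
  from pt_snd[OF this] show ?thesis unfolding halvings_def .
qed

theorem pt_min_cut [pt_intros]:
  fixes C :: "'b :: encodable \<Rightarrow> ('a :: encodable, nat) arc_list"
  assumes "pt C" shows "pt (\<lambda>x. min_cut s t (C x))"
proof -
  let ?R = "\<lambda>x. map (\<lambda>e. (fst e, 0 :: nat)) (C x)"
  have "pt ?R" by (intro pt_intros assms)
  then have "pt (\<lambda>x. foldl (phase s t) (?R x) (halvings (C x)))"
  proof (rule pt_foldl_measure[where C = "\<lambda>x. phase_growth (length (C x))" and m = "\<lambda>_. arcs_weight"
      and A = "\<lambda>x. 2 * size (enc (?R x))" and I = "\<lambda>x U. length U \<le> length (C x)", rotated])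
    show "pb (\<lambda>x. phase_growth (length (C x)))"
      unfolding phase_growth_def by (intro pb_intros assms)
    show "pb (\<lambda>x. 2 * size (enc (?R x)))" by (intro pb_mult pb_const pb_pt \<open>pt ?R\<close>)
  qed (intro pt_intros assms phase_size size_le_arcs_weight arcs_weight_le_size | simp)+
  then show ?thesis unfolding min_cut_def by (intro pt_intros)
qed


section \<open>From labellings to cuts\<close>

text \<open>The source is \<open>(0, 0)\<close>, the sink is \<open>(0, 1)\<close>, and \<open>(Suc u, i)\<close> lies on the source side if the
  label of \<open>u\<close> has index at least \<open>i\<close> in the list \<open>L u\<close> of labels. An arc \<open>uv\<close> of the digraph
  imposes implications: for \<open>(i, j)\<close> in \<open>Fw\<close>, index at least \<open>i\<close> at \<open>u\<close> implies index at least \<open>j\<close> at \<open>v\<close>, and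
  for \<open>(i, j)\<close> in \<open>Bw\<close>, index at least \<open>j\<close> at \<open>v\<close> implies index at least \<open>i\<close> at \<open>u\<close>.\<close>

type_synonym node = "nat \<times> nat"

text \<open>The flag marks a cost that was negative; such an entry is charged to the other labels of
  its vertex.\<close>

definition weight :: "(node \<times> bool \<times> nat) list \<Rightarrow> nat \<Rightarrow> nat \<Rightarrow> nat" where
  "weight Z u i =
     (\<Sum>e \<leftarrow> Z. if fst (fst e) = u \<and> (snd (fst e) = i) \<noteq> fst (snd e) then snd (snd e) else 0)"

definition nodes :: "nat \<Rightarrow> (nat \<times> nat list) list \<Rightarrow> node list" where
  "nodes p Ls = (0, 0) # (0, 1) # concat (map (\<lambda>(u, l). map (\<lambda>i. (Suc u, i)) [0..<Suc p]) Ls)"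

text \<open>On a downward closed source side, the arc from level \<open>i\<close> to level
  \<open>Suc i\<close> crosses exactly if the index is \<open>i\<close>, so the cut pays for the
  chosen label.\<close>

definition cost_arcs :: "(node \<times> bool \<times> nat) list \<Rightarrow> (nat \<times> nat list) list \<Rightarrow> (node, nat) arc_list" where
  "cost_arcs Z Ls = concat (map (\<lambda>(u, l).
     map (\<lambda>(i, x). (((Suc u, i), (Suc u, Suc i)), weight Z u x)) (List.enumerate 0 l)) Ls)"

text \<open>If none of these arcs is cut, level 0 lies on the source side, level \<open>p\<close> on
  the sink side, and the source side is downward closed; the cut then determines an index below
  \<open>p\<close> at each vertex.\<close>

definition chain_arcs :: "nat \<Rightarrow> (nat \<times> nat list) list \<Rightarrow> (node \<times> node) list" where
  "chain_arcs p Ls = concat (map (\<lambda>(u, l). ((0, 0), (Suc u, 0)) # ((Suc u, p), (0, 1)) #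
     map (\<lambda>i. ((Suc u, Suc i), (Suc u, i))) [0..<p]) Ls)"

definition constraint_arcs :: "(nat \<times> nat) list \<Rightarrow> (nat \<times> nat) list \<Rightarrow> (nat \<times> nat) list \<Rightarrow> (node \<times> node) list" where
  "constraint_arcs Fw Bw A = concat (map (\<lambda>(u, v).
     map (\<lambda>(i, j). ((Suc u, i), (Suc v, j))) Fw @ map (\<lambda>(i, j). ((Suc v, j), (Suc u, i))) Bw) A)"

definition total_capacity :: "('a, nat) arc_list \<Rightarrow> nat" where
  "total_capacity C = (\<Sum>e \<leftarrow> C. snd e)"

text \<open>The forced arcs get a capacity that exceeds the cost of every labelling.\<close>

definition combine :: "(node \<times> node) list \<Rightarrow> (node, nat) arc_list \<Rightarrow> (node, nat) arc_list" where
  "combine F C = map (\<lambda>a. (a, Suc (total_capacity C))) F @ C"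

definition capacity :: "('a, nat) arc_list \<Rightarrow> 'a \<times> 'a \<Rightarrow> nat" where
  "capacity N k = (\<Sum>e \<leftarrow> N. if fst e = k then snd e else 0)"

text \<open>\<open>min_cut\<close> works on all ordered pairs, so that every arc has its reverse.
  Missing arcs get capacity 0, repeated ones add up.\<close>

definition capacities :: "'a list \<Rightarrow> ('a, nat) arc_list \<Rightarrow> ('a, nat) arc_list" where
  "capacities V N = tab (List.product V V) (capacity N)"

text \<open>The last label whose node is on the source side. The default 0 is a legitimate position
  as long as \<open>p > 0\<close>.\<close>

definition decode :: "node list \<Rightarrow> nat \<Rightarrow> nat list \<Rightarrow> nat" where
  "decode S u l = foldl (\<lambda>y (i, x). if (Suc u, i) \<in> set S then x else y) 0 (List.enumerate 0 l)"

definition decode_all :: "node list \<Rightarrow> (nat \<times> nat list) list \<Rightarrow> (nat \<times> nat) list" where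
  "decode_all S Ls = map (\<lambda>(u, l). (u, decode S u l)) Ls"

text \<open>Detects that there is no homomorphism, in which case the cut may have violated forced
  arcs or the label lists may be meaningless.\<close>

definition verify :: "(nat \<times> nat) list \<Rightarrow> (nat \<times> nat) list \<Rightarrow> (nat \<times> nat) list \<Rightarrow> nat list option" where
  "verify E A Fs = (if \<forall>a \<in> set A. (lookup 0 Fs (fst a), lookup 0 Fs (snd a)) \<in> set E
     then Some (map snd Fs) else None)"

definition cut_labelling where
  "cut_labelling p Fw Bw A Z Ls = min_cut (0, 0) (0, 1)
     (capacities (nodes p Ls) (combine (chain_arcs p Ls @ constraint_arcs Fw Bw A) (cost_arcs Z Ls)))"

definition solve where
  "solve p Fw Bw E A Z Ls = verify E A (decode_all (cut_labelling p Fw Bw A Z Ls) Ls)"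

section \<open>Correspondence between cuts and labellings\<close>

lemma list_cut_append [simp]: "list_cut (N @ N') S = list_cut N S + list_cut N' S"
  by (simp add: list_cut_def)

lemma list_cut_concat: "list_cut (concat (map f xs)) S = (\<Sum>x \<leftarrow> xs. list_cut (f x) S)"
  by (induction xs) (simp_all add: list_cut_def)

lemma list_cut_le_total: "list_cut C S \<le> total_capacity C"
  unfolding list_cut_def total_capacity_def by (rule sum_list_mono) auto

lemma enumerate_conv_map: "List.enumerate 0 l = map (\<lambda>i. (i, l ! i)) [0..<length l]"
  by (rule nth_equalityI) (auto simp: nth_enumerate_eq)

lemma sum_list_upt: "(\<Sum>i \<leftarrow> [0..<n]. f i) = (\<Sum>i<n. f i :: nat)"
  by (simp add: interv_sum_list_conv_sum_set_nat atLeast0LessThan)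

lemma cut_capacities:
  assumes "distinct V" "\<And>e. e \<in> set N \<Longrightarrow> fst e \<in> set V \<times> set V"
  shows "cut_cap (List.product V V) (capacity N) S = list_cut N S"
  using assms(2)
proof (induction N)
  case Nil
  then show ?case by (simp add: cut_cap_def capacity_def list_cut_def)
next
  case (Cons e N)
  let ?K = "List.product V V"
  have K: "distinct ?K" "fst e \<in> set ?K" using assms(1) Cons.prems[of e] by (auto simp: distinct_product)
  have "cut_cap ?K (capacity (e # N)) S = cut_cap ?K (\<lambda>k. if fst e = k then snd e else 0) S + cut_cap ?K (capacity N) S"
    unfolding cut_cap_def capacity_def by (simp add: sum_list_addf[symmetric] if_distrib cong: if_cong)
      (intro arg_cong[where f = sum_list] map_cong; simp)
  also have "cut_cap ?K (\<lambda>k. if fst e = k then snd e else 0) S =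
      (\<Sum>k \<in> set ?K. if fst e = k then (if fst k \<in> S \<and> snd k \<notin> S then snd e else 0) else 0)"
    unfolding cut_cap_def sum_list_distinct_conv_sum_set[OF K(1)] by (rule sum.cong) auto
  also have "\<dots> = (if fst (fst e) \<in> S \<and> snd (fst e) \<notin> S then snd e else 0)"
    by (subst sum.delta') (use K(2) in auto)
  finally show ?case using Cons by (simp add: list_cut_def)
qed

locale labelling_problem =
  fixes n p :: nat and A Fw Bw :: "(nat \<times> nat) list" and L :: "nat \<Rightarrow> nat list"
    and Z :: "(node \<times> bool \<times> nat) list"
  assumes arcs: "\<And>u v. (u, v) \<in> set A \<Longrightarrow> u < n \<and> v < n"
    and implications: "\<And>i j. (i, j) \<in> set Fw \<union> set Bw \<Longrightarrow> i \<le> p \<and> j \<le> p"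
    and length_L: "\<And>u. u < n \<Longrightarrow> length (L u) = p"
begin

definition Ls where "Ls = map (\<lambda>u. (u, L u)) [0..<n]"

definition compatible :: "(nat \<Rightarrow> nat) \<Rightarrow> bool" where
  "compatible d \<longleftrightarrow> (\<forall>u<n. d u < p) \<and> (\<forall>(u, v) \<in> set A.
     (\<forall>(i, j) \<in> set Fw. i \<le> d u \<longrightarrow> j \<le> d v) \<and> (\<forall>(i, j) \<in> set Bw. j \<le> d v \<longrightarrow> i \<le> d u))"

definition label_cost :: "(nat \<Rightarrow> nat) \<Rightarrow> nat" where
  "label_cost d = (\<Sum>u<n. weight Z u (L u ! d u))"

abbreviation "forced \<equiv> chain_arcs p Ls @ constraint_arcs Fw Bw A"
abbreviation "costs \<equiv> cost_arcs Z Ls"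

lemma set_nodes: "set (nodes p Ls) = {(0, 0), (0, 1)} \<union> {(Suc u, i) | u i. u < n \<and> i \<le> p}"
  unfolding nodes_def Ls_def by (auto simp: less_Suc_eq_le simp del: upt_Suc)

lemma distinct_nodes: "distinct (nodes p Ls)"
proof -
  have "distinct (concat (map (\<lambda>u. map (\<lambda>i. (Suc u, i)) [0..<Suc p]) [0..<m]))" for m
    by (induction m) (auto simp: distinct_map inj_on_def)
  then show ?thesis unfolding nodes_def Ls_def by (auto simp: o_def)
qed

lemma set_chain_arcs: "set (chain_arcs p Ls) =
    (\<Union>u<n. {((0, 0), (Suc u, 0)), ((Suc u, p), (0, 1))} \<union> (\<lambda>i. ((Suc u, Suc i), (Suc u, i))) ` {..<p})"
  unfolding chain_arcs_def Ls_def by (auto simp: atLeast0LessThan)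

lemma set_constraint_arcs: "set (constraint_arcs Fw Bw A) = (\<Union>a \<in> set A.
    (\<lambda>(i, j). ((Suc (fst a), i), (Suc (snd a), j))) ` set Fw \<union>
    (\<lambda>(i, j). ((Suc (snd a), j), (Suc (fst a), i))) ` set Bw)"
  unfolding constraint_arcs_def by (simp add: case_prod_beta)

lemma forced_cases:
  assumes "a \<in> set forced"
  obtains (source) u where "u < n" "a = ((0, 0), (Suc u, 0))"
  | (sink) u where "u < n" "a = ((Suc u, p), (0, 1))"
  | (chain) u i where "u < n" "i < p" "a = ((Suc u, Suc i), (Suc u, i))"
  | (forward) u v i j where "(u, v) \<in> set A" "(i, j) \<in> set Fw" "a = ((Suc u, i), (Suc v, j))"
  | (backward) u v i j where "(u, v) \<in> set A" "(i, j) \<in> set Bw" "a = ((Suc v, j), (Suc u, i))"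
proof -
  consider "a \<in> set (chain_arcs p Ls)" | "a \<in> set (constraint_arcs Fw Bw A)" using assms by auto
  then show ?thesis
  proof cases
    case 1
    then show ?thesis unfolding set_chain_arcs using source sink chain by blast
  next
    case 2
    then obtain u v i j where "(u, v) \<in> set A"
      "(i, j) \<in> set Fw \<and> a = ((Suc u, i), (Suc v, j)) \<or> (i, j) \<in> set Bw \<and> a = ((Suc v, j), (Suc u, i))"
      unfolding set_constraint_arcs by force
    then show ?thesis using forward backward by blast
  qed
qed

lemma forced_intros:
  "u < n \<Longrightarrow> ((0, 0), (Suc u, 0)) \<in> set forced"
  "u < n \<Longrightarrow> ((Suc u, p), (0, 1)) \<in> set forced"
  "u < n \<Longrightarrow> i < p \<Longrightarrow> ((Suc u, Suc i), (Suc u, i)) \<in> set forced"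
  "(u, v) \<in> set A \<Longrightarrow> (i, j) \<in> set Fw \<Longrightarrow> ((Suc u, i), (Suc v, j)) \<in> set forced"
  "(u, v) \<in> set A \<Longrightarrow> (i, j) \<in> set Bw \<Longrightarrow> ((Suc v, j), (Suc u, i)) \<in> set forced"
  unfolding set_append set_chain_arcs set_constraint_arcs
  by (blast, blast, blast, rule UnI2, rule UN_I, assumption, force, rule UnI2, rule UN_I, assumption, force)

lemma cost_arcs_eq: "costs = concat (map (\<lambda>u. map (\<lambda>i. (((Suc u, i), (Suc u, Suc i)), weight Z u (L u ! i))) [0..<p]) [0..<n])"
  unfolding cost_arcs_def Ls_def enumerate_conv_map map_map o_def split_conv
  by (intro arg_cong[where f = concat] map_cong) (auto simp: length_L)

lemma list_cut_costs: "list_cut costs S =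
    (\<Sum>u<n. \<Sum>i<p. if (Suc u, i) \<in> S \<and> (Suc u, Suc i) \<notin> S then weight Z u (L u ! i) else 0)"
  unfolding cost_arcs_eq list_cut_concat sum_list_upt
  by (simp add: list_cut_def o_def sum_list_upt cong: if_cong)

lemma cut_value: "cut_cap (List.product (nodes p Ls) (nodes p Ls)) (capacity (combine forced costs)) S
    = list_cut (combine forced costs) S"
proof (rule cut_capacities[OF distinct_nodes])
  have *: "a \<in> set (nodes p Ls) \<times> set (nodes p Ls)" if "a \<in> set forced" for a
    using that
  proof (cases rule: forced_cases)
    case (forward u v i j)
    then show ?thesis using arcs[of u v] implications[of i j] by (auto simp: set_nodes)
  next
    case (backward u v i j)
    then show ?thesis using arcs[of u v] implications[of i j] by (auto simp: set_nodes)
  qed (auto simp: set_nodes)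
  fix e assume "e \<in> set (combine forced costs)"
  then consider "fst e \<in> set forced" | "e \<in> set costs" unfolding combine_def by auto
  then show "fst e \<in> set (nodes p Ls) \<times> set (nodes p Ls)"
  proof cases
    case 1
    then show ?thesis by (rule *)
  next
    case 2
    then show ?thesis unfolding cost_arcs_eq set_nodes by auto
  qed
qed

lemma forced_cut:
  assumes "a \<in> set forced" "fst a \<in> S" "snd a \<notin> S"
  shows "total_capacity costs < list_cut (combine forced costs) S"
proof -
  have "Suc m \<le> list_cut (map (\<lambda>a. (a, Suc m)) F) S" if "a \<in> set F" for F m
    using that by (induction F) (use assms(2,3) in \<open>auto simp: list_cut_def\<close>)
  from this[OF assms(1), of "total_capacity costs"] show ?thesis
    unfolding combine_def list_cut_append by linarith
qed

text \<open>With the levels up to \<open>d u\<close> on the source side, exactly one cost arc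
  crosses at each vertex, and the implications keep all forced arcs from crossing.\<close>

lemma cut_of_compatible:
  assumes "compatible d"
  defines "S \<equiv> insert (0, 0) {(Suc u, i) | u i. u < n \<and> i \<le> d u}"
  shows "list_cut (combine forced costs) S = label_cost d" "label_cost d \<le> total_capacity costs"
proof -
  have d: "d u < p" if "u < n" for u using assms(1) that by (auto simp: compatible_def)
  have S: "(0, 0) \<in> S" "(0, 1) \<notin> S" "(Suc u, i) \<in> S \<longleftrightarrow> u < n \<and> i \<le> d u" for u i
    by (auto simp: S_def)
  have "snd a \<in> S" if "a \<in> set forced" "fst a \<in> S" for a
    using that(1)
  proof (cases rule: forced_cases)
    case (sink u)
    then show ?thesis using that(2) S(3) d[of u] by auto
  next
    case (forward u v i j)
    then show ?thesis using that(2) S(3) assms(1) arcs[of u v] by (fastforce simp: compatible_def)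
  next
    case (backward u v i j)
    then show ?thesis using that(2) S(3) assms(1) arcs[of u v] by (fastforce simp: compatible_def)
  qed (use that(2) S in auto)
  moreover have "list_cut (map (\<lambda>a. (a, m)) F) S = 0" if "\<And>a. a \<in> set F \<Longrightarrow> fst a \<in> S \<Longrightarrow> snd a \<in> S" for F m
    using that
  proof (induction F)
    case (Cons a F)
    from Cons.IH Cons.prems show ?case by (cases "fst a \<in> S") (auto simp: list_cut_def)
  qed (simp add: list_cut_def)
  ultimately have "list_cut (map (\<lambda>a. (a, Suc (total_capacity costs))) forced) S = 0" by blast
  moreover have "list_cut costs S = label_cost d"
    unfolding list_cut_costs label_cost_def
  proof (intro sum.cong refl)
    fix u assume "u \<in> {..<n}"
    then have "(\<Sum>i<p. if (Suc u, i) \<in> S \<and> (Suc u, Suc i) \<notin> S then weight Z u (L u ! i) else 0)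
        = (\<Sum>i<p. if d u = i then weight Z u (L u ! i) else 0)"
      by (intro sum.cong) (auto simp: S_def)
    also have "\<dots> = weight Z u (L u ! d u)" using d \<open>u \<in> {..<n}\<close> by simp
    finally show "(\<Sum>i<p. if (Suc u, i) \<in> S \<and> (Suc u, Suc i) \<notin> S then weight Z u (L u ! i) else 0)
        = weight Z u (L u ! d u)" .
  qed
  ultimately show "list_cut (combine forced costs) S = label_cost d" "label_cost d \<le> total_capacity costs"
    using list_cut_le_total[of costs S] unfolding combine_def by (simp_all only: list_cut_append)
qed

text \<open>The highest level on the source side is the index; closure under the forced arcs of the
  chains makes this single number describe the cut at the vertex.\<close>

lemma compatible_of_cut:
  assumes "(0, 0) \<in> S" "(0, 1) \<notin> S" "\<And>a. a \<in> set forced \<Longrightarrow> fst a \<in> S \<Longrightarrow> snd a \<in> S"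
  obtains d where "compatible d" "list_cut costs S = label_cost d"
    "\<And>u i. u < n \<Longrightarrow> i \<le> p \<Longrightarrow> (Suc u, i) \<in> S \<longleftrightarrow> i \<le> d u"
proof -
  have bot: "(Suc u, 0) \<in> S" and top: "(Suc u, p) \<notin> S" if "u < n" for u
    using assms(1,2) assms(3)[OF forced_intros(1)] assms(3)[OF forced_intros(2)] that by auto
  have down: "(Suc u, i) \<in> S" if "(Suc u, Suc i) \<in> S" "u < n" "i < p" for u i
    using assms(3)[OF forced_intros(3)] that by auto
  have down': "(Suc u, i) \<in> S" if "(Suc u, j) \<in> S" "i \<le> j" "u < n" "j \<le> p" for u i j
    using that(2,1,4) by (induction rule: inc_induct) (use down that(3) in auto)
  define d where "d u = Max {i. i \<le> p \<and> (Suc u, i) \<in> S}" for u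
  have mem: "(Suc u, i) \<in> S \<longleftrightarrow> i \<le> d u" if "u < n" "i \<le> p" for u i
  proof
    assume "(Suc u, i) \<in> S"
    then show "i \<le> d u" unfolding d_def using that by (intro Max_ge) auto
  next
    assume "i \<le> d u"
    have "d u \<in> {i. i \<le> p \<and> (Suc u, i) \<in> S}"
      unfolding d_def by (rule Max_in) (use bot[OF that(1)] in auto)
    then show "(Suc u, i) \<in> S" using down'[of u "d u" i] \<open>i \<le> d u\<close> that by auto
  qed
  have d: "d u < p" if "u < n" for u using mem[OF that, of p] top[OF that] by auto
  have "compatible d"
    unfolding compatible_def
  proof (intro conjI allI impI ballI, goal_cases)
    case (1 u)
    then show ?case by (rule d)
  next
    case (2 a)
    obtain u v where a: "a = (u, v)" by (cases a)
    have uv: "u < n" "v < n" using arcs 2 a by auto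
    have "j \<le> d v" if "(i, j) \<in> set Fw" "i \<le> d u" for i j
      using assms(3)[OF forced_intros(4), of u v i j] 2 a that implications[of i j] mem uv by auto
    moreover have "i \<le> d u" if "(i, j) \<in> set Bw" "j \<le> d v" for i j
      using assms(3)[OF forced_intros(5), of u v i j] 2 a that implications[of i j] mem uv by auto
    ultimately show ?case using a by auto
  qed
  moreover have "list_cut costs S = label_cost d"
    unfolding list_cut_costs label_cost_def
  proof (intro sum.cong refl)
    fix u assume u: "u \<in> {..<n}"
    then have "(\<Sum>i<p. if (Suc u, i) \<in> S \<and> (Suc u, Suc i) \<notin> S then weight Z u (L u ! i) else 0)
        = (\<Sum>i<p. if d u = i then weight Z u (L u ! i) else 0)"
      by (intro sum.cong) (auto simp: mem)
    also have "\<dots> = weight Z u (L u ! d u)" using d u by simp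
    finally show "(\<Sum>i<p. if (Suc u, i) \<in> S \<and> (Suc u, Suc i) \<notin> S then weight Z u (L u ! i) else 0)
        = weight Z u (L u ! d u)" .
  qed
  ultimately show ?thesis using that mem by blast
qed

lemma decode_eq:
  assumes "u < n" "k < p" "\<And>i. i < p \<Longrightarrow> (Suc u, i) \<in> set S \<longleftrightarrow> i \<le> k"
  shows "decode S u (L u) = L u ! k"
proof -
  \<comment> \<open>After the prefix up to \<open>m\<close> the current value is the label at
    \<open>min k m\<close>; the initial 0 is overwritten at index 0, which is always on the source
    side.\<close>
  have "foldl (\<lambda>y (i, x). if (Suc u, i) \<in> set S then x else y) 0 (map (\<lambda>i. (i, L u ! i)) [0..<Suc m]) = L u ! min k m"
    if "m < p" for m
    using that assms(3)
  proof (induction m)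
    case (Suc m)
    then show ?case by (cases "Suc m \<le> k") (simp_all add: min_def)
  qed simp
  from this[of "p - 1"] show ?thesis
    using assms(1,2) unfolding decode_def enumerate_conv_map length_L[OF assms(1)] by simp
qed

lemma cut_labelling_optimal:
  assumes "compatible d0"
  obtains d where "compatible d" "\<And>d'. compatible d' \<Longrightarrow> label_cost d \<le> label_cost d'"
    "decode_all (cut_labelling p Fw Bw A Z Ls) Ls = map (\<lambda>u. (u, L u ! d u)) [0..<n]"
proof -
  let ?V = "nodes p Ls" and ?N = "combine forced costs"
  let ?S = "set (cut_labelling p Fw Bw A Z Ls)"
  have K: "distinct (List.product ?V ?V)" "set (List.product ?V ?V) = set ?V \<times> set ?V"
    using distinct_nodes by (auto simp: distinct_product)
  have S_eq: "?S = set (min_cut (0, 0) (0, 1) (tab (List.product ?V ?V) (capacity ?N)))"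
    by (simp only: cut_labelling_def capacities_def)
  have ne: "(0 :: nat, 0 :: nat) \<noteq> (0, 1)" by simp
  have S: "(0, 0) \<in> ?S" "(0, 1) \<notin> ?S"
    unfolding S_eq using min_cut_correct(1,2)[OF K ne] by blast+
  have mc: "list_cut ?N ?S \<le> list_cut ?N S'" if s: "(0, 0) \<in> S'" "(0, 1) \<notin> S'" for S'
    unfolding S_eq cut_value[symmetric] by (rule min_cut_correct(3)[OF K ne s])
  have le: "list_cut ?N ?S \<le> label_cost d'" if c: "compatible d'" for d'
    unfolding cut_of_compatible(1)[OF c, symmetric] by (rule mc) auto
  have "label_cost d0 \<le> total_capacity costs" by (rule cut_of_compatible(2)[OF assms])
  \<comment> \<open>A crossing forced arc would make the cut dearer than the one belonging to
    \<open>d0\<close>, contradicting minimality.\<close>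
  then have "snd a \<in> ?S" if a: "a \<in> set forced" "fst a \<in> ?S" for a
    using forced_cut[of a ?S] a le[OF assms] by force
  with compatible_of_cut[OF S] obtain d where d: "compatible d" "list_cut costs ?S = label_cost d"
    "\<And>u i. u < n \<Longrightarrow> i \<le> p \<Longrightarrow> (Suc u, i) \<in> ?S \<longleftrightarrow> i \<le> d u"
    by blast
  have "label_cost d \<le> list_cut ?N ?S" unfolding combine_def d(2)[symmetric] by simp
  moreover have "decode (cut_labelling p Fw Bw A Z Ls) u (L u) = L u ! d u" if u: "u < n" for u
    using u d(1,3) by (intro decode_eq) (auto simp: compatible_def)
  then have "decode_all (cut_labelling p Fw Bw A Z Ls) Ls = map (\<lambda>u. (u, L u ! d u)) [0..<n]"
    unfolding decode_all_def by (subst (2) Ls_def) simp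
  ultimately show ?thesis using that[OF d(1)] le by (meson order.trans)
qed

end


section \<open>Integral nonnegative costs\<close>

definition numer :: "rat \<Rightarrow> nat" where "numer r = nat \<bar>fst (quotient_of r)\<bar>"
definition denom :: "rat \<Rightarrow> nat" where "denom r = nat \<bar>snd (quotient_of r)\<bar>"
definition negative :: "rat \<Rightarrow> bool" where "negative r \<longleftrightarrow> fst (quotient_of r) < 0"

text \<open>Multiplying by all denominators makes the costs integral. Since every vertex gets exactly one
  label, a negative cost of a label is replaced by a positive cost of the other labels, see
  \<^const>\<open>weight\<close>.\<close>

definition scale :: "(node \<times> rat) list \<Rightarrow> (node \<times> bool \<times> nat) list" where
  "scale C = map (\<lambda>e. (fst e, negative (snd e),
     prod_list (map (\<lambda>e'. if fst e' = fst e then numer (snd e') else denom (snd e')) C))) C"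

definition cells :: "rat list list \<Rightarrow> (node \<times> rat) list" where
  "cells M = concat (map (\<lambda>(u, row). map (\<lambda>(i, r). ((u, i), r)) (List.enumerate 0 row)) (List.enumerate 0 M))"

definition arcs_of :: "bool list list \<Rightarrow> (nat \<times> nat) list" where
  "arcs_of M = concat (map (\<lambda>(u, row). map (\<lambda>e. (u, fst e)) (filter snd (List.enumerate 0 row))) (List.enumerate 0 M))"

lemma denom_pos: "denom r > 0"
  using quotient_of_denom_pos'[of r] by (simp add: denom_def)

lemma rat_conv: "rat_of_nat (numer r) = of_nat (denom r) * \<bar>r\<bar>" "negative r \<longleftrightarrow> r < 0"
proof -
  obtain a b where ab: "quotient_of r = (a, b)" by (cases "quotient_of r")
  then have b: "b > 0" and r: "r = of_int a / of_int b" by (rule quotient_of_denom_pos, rule quotient_of_div)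
  have n: "numer r = nat \<bar>a\<bar>" "denom r = nat \<bar>b\<bar>" "negative r \<longleftrightarrow> a < 0"
    by (simp_all add: numer_def denom_def negative_def ab)
  show "rat_of_nat (numer r) = of_nat (denom r) * \<bar>r\<bar>" "negative r \<longleftrightarrow> r < 0"
    unfolding n using b by (simp_all add: r divide_less_0_iff)
qed

text \<open>The scaling factor \<open>D > 0\<close> is common to all vertices and the shift
  \<open>\<kappa> u\<close> does not depend on the label, so the order of total costs is
  unchanged.\<close>

lemma weight_scale:
  assumes "distinct K" and C: "C = map (\<lambda>k. (k, r k)) K"
  obtains D :: rat and \<kappa> :: "nat \<Rightarrow> rat" where "D > 0"
    "\<And>u i. (u, i) \<in> set K \<Longrightarrow> of_nat (weight (scale C) u i) = D * r (u, i) + \<kappa> u"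
proof -
  define D :: rat where "D = of_nat (\<Prod>k \<in> set K. denom (r k))"
  define z where "z k = (\<Prod>k' \<leftarrow> K. if k' = k then numer (r k') else denom (r k'))" for k
  \<comment> \<open>All scaled negative costs at \<open>u\<close> in absolute value. A label with
    negative cost is charged this total without its own share, any other label the total plus its
    own cost.\<close>
  define \<kappa> :: "nat \<Rightarrow> rat" where "\<kappa> u = (\<Sum>k \<in> set K. if fst k = u \<and> negative (r k) then of_nat (z k) else 0)" for u
  have z: "of_nat (z k) = D * \<bar>r k\<bar>" if "k \<in> set K" for k
  proof -
    have "z k = (\<Prod>k' \<in> set K. if k' = k then numer (r k') else denom (r k'))"
      unfolding z_def using assms(1) by (rule prod.distinct_set_conv_list[symmetric])
    also have "\<dots> = numer (r k) * (\<Prod>k' \<in> set K - {k}. denom (r k'))"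
      using that by (subst prod.remove[of _ k]) (auto intro!: prod.cong)
    finally have "z k = numer (r k) * (\<Prod>k' \<in> set K - {k}. denom (r k'))" .
    moreover have "D = of_nat (denom (r k) * (\<Prod>k' \<in> set K - {k}. denom (r k')))"
      unfolding D_def using that by (subst prod.remove[of _ k]) auto
    ultimately show ?thesis by (simp add: rat_conv(1))
  qed
  show ?thesis
  proof (rule that)
    show "D > 0" unfolding D_def using denom_pos by (simp add: prod_pos)
    fix u i assume ui: "(u, i) \<in> set K"
    have Z: "scale C = map (\<lambda>k. (k, negative (r k), z k)) K"
      by (simp add: scale_def C z_def o_def cong: if_cong)
    have "weight (scale C) u i = (\<Sum>k \<in> set K. if fst k = u \<and> (snd k = i) \<noteq> negative (r k) then z k else 0)"
      unfolding weight_def Z using assms(1)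
      by (simp add: o_def sum.distinct_set_conv_list cong: if_cong)
    then have "rat_of_nat (weight (scale C) u i) =
        (\<Sum>k \<in> set K. if fst k = u \<and> (snd k = i) \<noteq> negative (r k) then of_nat (z k) else 0)"
      by (simp add: if_distrib cong: if_cong)
    also have "\<dots> = (\<Sum>k \<in> set K. (if fst k = u \<and> negative (r k) then of_nat (z k) else 0) +
        (if k = (u, i) then (if negative (r k) then - of_nat (z k) else of_nat (z k)) else 0))"
      by (intro sum.cong) auto
    also have "\<dots> = \<kappa> u + (if negative (r (u, i)) then - of_nat (z (u, i)) else of_nat (z (u, i)))"
      unfolding sum.distrib \<kappa>_def using ui by (subst sum.delta) auto
    also have "\<dots> = \<kappa> u + D * r (u, i)"
      using z[OF ui] by (simp add: rat_conv(2))
    finally show "of_nat (weight (scale C) u i) = D * r (u, i) + \<kappa> u" by simp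
  qed
qed

lemma product_upt: "concat (map (\<lambda>u. map (\<lambda>i. (u, i)) [0..<p]) [0..<n]) = List.product [0..<n] [0..<p]"
  by (simp add: product_concat_map)

lemma cells_eq:
  "cells (map (\<lambda>u. map (\<lambda>i. r (u, i)) [0..<p]) [0..<n]) = map (\<lambda>k. (k, r k)) (List.product [0..<n] [0..<p])"
  unfolding product_upt[symmetric] map_concat cells_def enumerate_conv_map map_map
  by (intro arg_cong[where f = concat]) simp

lemma set_arcs_of:
  "set (arcs_of (map (\<lambda>u. map (P u) [0..<n]) [0..<n])) = {(u, v). u < n \<and> v < n \<and> P u v}"
  unfolding arcs_of_def enumerate_conv_map by (auto simp: image_iff)


section \<open>Polynomial time of the reduction\<close>

text \<open>Abstracting the arguments to projections keeps them simple beneath the binders of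
  \<open>map\<close> and \<open>filter\<close>, where they would otherwise appear as unknown
  functions of an outer input.\<close>

lemma pt_compose2:
  "pt (\<lambda>y. f (fst y) (snd y)) \<Longrightarrow> pt a \<Longrightarrow> pt b \<Longrightarrow> pt (\<lambda>x. f (a x) (b x))"
  by (drule pt_comp[where g = "\<lambda>x. (a x, b x)"]) (auto intro: pt_Pair)

lemma pt_compose3:
  "pt (\<lambda>y. f (fst y) (fst (snd y)) (snd (snd y))) \<Longrightarrow> pt a \<Longrightarrow> pt b \<Longrightarrow> pt c \<Longrightarrow> pt (\<lambda>x. f (a x) (b x) (c x))"
  by (drule pt_comp[where g = "\<lambda>x. (a x, b x, c x)"]) (auto intro: pt_Pair)

lemma pt_quotient_of [pt_intros]: "pt f \<Longrightarrow> pt (\<lambda>x. quotient_of (f x))"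
  by (erule pt_retype) (simp add: enc_rat_conv)

lemma pt_neg_int [pt_intros]: "pt f \<Longrightarrow> pt (\<lambda>x. f x < (0 :: int))"
  by (erule pt_hd_enc) (simp add: enc_int_conv)

lemma pt_nat_abs [pt_intros]: "pt f \<Longrightarrow> pt (\<lambda>x. nat \<bar>f x\<bar>)"
  by (erule pt_tl_enc) (simp add: enc_int_conv)

lemma pt_product [pt_intros]:
  assumes "pt a" "pt b" shows "pt (\<lambda>x. List.product (a x) (b x))"
  unfolding product_concat_map
  by (rule pt_compose2[where f = "\<lambda>a b. concat (map (\<lambda>x. map (Pair x) b) a)", OF _ assms]) (intro pt_intros)

lemma pt_scale [pt_intros]: "pt f \<Longrightarrow> pt (\<lambda>x. scale (f x))"
  by (rule pt_comp[of scale]) (unfold scale_def numer_def denom_def negative_def, intro pt_intros)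

lemma pt_cells [pt_intros]: "pt f \<Longrightarrow> pt (\<lambda>x. cells (f x))"
  by (rule pt_comp[of cells]) (unfold cells_def, intro pt_intros)

lemma pt_arcs_of [pt_intros]: "pt f \<Longrightarrow> pt (\<lambda>x. arcs_of (f x))"
  by (rule pt_comp[of arcs_of]) (unfold arcs_of_def, intro pt_intros)

lemma pt_nodes [pt_intros]: "pt f \<Longrightarrow> pt (\<lambda>x. nodes p (f x))"
  by (rule pt_comp[of "nodes p"]) (unfold nodes_def, intro pt_intros)

lemma pt_weight [pt_intros]: "pt Z \<Longrightarrow> pt u \<Longrightarrow> pt i \<Longrightarrow> pt (\<lambda>x. weight (Z x) (u x) (i x))"
  by (rule pt_compose3) (unfold weight_def, intro pt_intros)

lemma pt_cost_arcs [pt_intros]: "pt Z \<Longrightarrow> pt Ls \<Longrightarrow> pt (\<lambda>x. cost_arcs (Z x) (Ls x))"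
  by (rule pt_compose2) (unfold cost_arcs_def, intro pt_intros)

lemma pt_chain_arcs [pt_intros]: "pt f \<Longrightarrow> pt (\<lambda>x. chain_arcs p (f x))"
  by (rule pt_comp[of "chain_arcs p"]) (unfold chain_arcs_def, intro pt_intros)

lemma pt_constraint_arcs [pt_intros]: "pt f \<Longrightarrow> pt (\<lambda>x. constraint_arcs Fw Bw (f x))"
  by (rule pt_comp[of "constraint_arcs Fw Bw"]) (unfold constraint_arcs_def, intro pt_intros)

lemma pt_combine [pt_intros]: "pt F \<Longrightarrow> pt C \<Longrightarrow> pt (\<lambda>x. combine (F x) (C x))"
  by (rule pt_compose2) (unfold combine_def total_capacity_def, intro pt_intros)

lemma pt_capacities [pt_intros]:
  fixes V :: "'b :: encodable \<Rightarrow> 'a :: encodable list"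
  shows "pt V \<Longrightarrow> pt N \<Longrightarrow> pt (\<lambda>x. capacities (V x) (N x))"
  by (rule pt_compose2) (unfold capacities_def tab_def capacity_def, intro pt_intros)

lemma pt_decode [pt_intros]: 
  assumes "pt S" "pt u" "pt l" shows "pt (\<lambda>x. decode (S x) (u x) (l x))"
proof (rule pt_compose3[OF _ assms])
  have *: "foldl (\<lambda>y (i, x). if Q i then x else y) d xs = (case rev (filter (\<lambda>e. Q (fst e)) xs) of [] \<Rightarrow> d | e # _ \<Rightarrow> snd e)"
    for Q d and xs :: "(nat \<times> nat) list"
    by (induction xs rule: rev_induct) auto
  show "pt (\<lambda>y. decode (fst y) (fst (snd y)) (snd (snd y)))"
    unfolding decode_def * by (intro pt_intros)
qed

lemma pt_decode_all [pt_intros]: "pt S \<Longrightarrow> pt Ls \<Longrightarrow> pt (\<lambda>x. decode_all (S x) (Ls x))"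
  by (rule pt_compose2) (unfold decode_all_def, intro pt_intros)

lemma pt_verify [pt_intros]: "pt A \<Longrightarrow> pt Fs \<Longrightarrow> pt (\<lambda>x. verify E (A x) (Fs x))"
  by (rule pt_compose2) (unfold verify_def, intro pt_intros)

lemma pt_solve [pt_intros]:
  assumes "pt A" "pt Z" "pt Ls" shows "pt (\<lambda>x. solve p Fw Bw E (A x) (Z x) (Ls x))"
  unfolding solve_def cut_labelling_def by (intro pt_intros assms)

section \<open>Correctness of the reduction\<close>

lemma verify_eq:
  assumes "\<And>u v. (u, v) \<in> set A \<Longrightarrow> u < n \<and> v < n"
  shows "verify E A (map (\<lambda>u. (u, f u)) [0..<n]) =
    (if \<forall>(u, v) \<in> set A. (f u, f v) \<in> set E then Some (map f [0..<n]) else None)"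
proof -
  have "lookup 0 (map (\<lambda>u. (u, f u)) [0..<n]) u = f u" if "u < n" for u
    using that by (simp add: lookup_def map_of_map_restrict)
  then have "(\<forall>a \<in> set A. (lookup 0 (map (\<lambda>u. (u, f u)) [0..<n]) (fst a), lookup 0 (map (\<lambda>u. (u, f u)) [0..<n]) (snd a)) \<in> set E)
      \<longleftrightarrow> (\<forall>(u, v) \<in> set A. (f u, f v) \<in> set E)"
    using assms by (intro ball_cong) auto
  then show ?thesis by (simp add: verify_def o_def)
qed

text \<open>Needed when there is no homomorphism: whatever the cut, the decoded labels are positions
  in \<open>H\<close>, so passing the check would make them a homomorphism.\<close>

lemma decode_in: "decode S u l \<in> insert 0 (set l)"
proof -
  have "foldl (\<lambda>y (i, x). if Q i then x else y) d xs \<in> insert d (snd ` set xs)"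
    for Q d and xs :: "(nat \<times> nat) list"
  proof (induction xs rule: rev_induct)
    case (snoc x xs)
    then show ?case by (cases "Q (fst x)") (auto simp: case_prod_beta)
  qed simp
  from this[of "\<lambda>i. (Suc u, i) \<in> set S" 0 "List.enumerate 0 l"] show ?thesis
    unfolding decode_def enumerate_conv_map by auto
qed

lemma poly_time_solvableI:
  assumes "pt f" "\<And>x. x \<in> I \<Longrightarrow> e x = enc (g x)" "\<And>x. x \<in> I \<Longrightarrow> ans x (enc (f (g x)))"
  shows "poly_time_solvable I e ans"
proof -
  obtain p T where "pb T" and T: "computes p T f" using assms(1) unfolding pt_def by blast
  obtain q where q: "\<And>z. T z \<le> poly q (size (enc z))" using \<open>pb T\<close> unfolding pb_def by blast
  show ?thesis
    unfolding poly_time_solvable_def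
  proof (intro exI[of _ p] exI[of _ q] ballI)
    fix x assume x: "x \<in> I"
    have "runs p ((\<lambda>_. Leaf)(0 := e x)) (T (g x)) (\<lambda>s'. s' 0 = enc (f (g x)))"
      by (rule runs_computes[OF T]) (simp add: assms(2)[OF x])
    then obtain t s where "exec p ((\<lambda>_. Leaf)(0 := e x)) t s" "t \<le> T (g x)" "s 0 = enc (f (g x))"
      unfolding runs_def by blast
    then show "\<exists>t s. exec p ((\<lambda>_. Leaf)(0 := e x)) t s \<and> t \<le> poly q (size (e x)) \<and> ans x (s 0)"
      using q[of "g x"] assms(2,3)[OF x] by (metis order.trans)
  qed
qed

definition minhom where
  "minhom p Fw Bw E lab x =
     solve p Fw Bw E (arcs_of (fst x)) (scale (cells (snd x))) (lab (fst x))"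

lemma pt_minhom:
  assumes "pt lab" shows "pt (minhom p Fw Bw E lab)"
  unfolding minhom_def by (intro pt_intros pt_comp[OF assms])

text \<open>Homomorphisms with the vertices of \<open>H\<close> replaced by their positions;
  \<open>P\<close> is adjacency in the input digraph.\<close>

definition position_hom :: "(nat \<times> nat) list \<Rightarrow> nat \<Rightarrow> nat \<Rightarrow> (nat \<Rightarrow> nat \<Rightarrow> bool) \<Rightarrow> (nat \<Rightarrow> nat) \<Rightarrow> bool" where
  "position_hom E p n P g \<longleftrightarrow> (\<forall>u<n. g u < p) \<and> (\<forall>u<n. \<forall>v<n. P u v \<longrightarrow> (g u, g v) \<in> set E)"

definition implies :: "(nat \<times> nat) list \<Rightarrow> (nat \<times> nat) list \<Rightarrow> nat \<Rightarrow> nat \<Rightarrow> bool" where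
  "implies Fw Bw a b \<longleftrightarrow> (\<forall>(i, j) \<in> set Fw. i \<le> a \<longrightarrow> j \<le> b) \<and> (\<forall>(i, j) \<in> set Bw. j \<le> b \<longrightarrow> i \<le> a)"

text \<open>The assumption \<open>hom\<close> about the label lists is conditional on some
  homomorphism, because for directed cycles the lists are correct only then. Their lengths and
  ranges are assumed in any case.\<close>

lemma minhom_correct:
  fixes r :: "node \<Rightarrow> rat"
  assumes "p > 0" "\<And>i j. (i, j) \<in> set Fw \<union> set Bw \<Longrightarrow> i \<le> p \<and> j \<le> p"
    and L: "\<And>u. u < n \<Longrightarrow> length (L u) = p" "\<And>u. u < n \<Longrightarrow> set (L u) \<subseteq> {..<p}"
    and hom: "\<And>g. position_hom E p n P g \<Longrightarrow> (\<forall>u<n. set (L u) = {..<p}) \<and>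
       (\<forall>u<n. \<forall>v<n. P u v \<longrightarrow> (\<forall>a<p. \<forall>b<p. (L u ! a, L v ! b) \<in> set E \<longleftrightarrow> implies Fw Bw a b))"
    and lab: "lab (map (\<lambda>u. map (P u) [0..<n]) [0..<n]) = map (\<lambda>u. (u, L u)) [0..<n]"
  defines "res \<equiv> minhom p Fw Bw E lab (map (\<lambda>u. map (P u) [0..<n]) [0..<n], map (\<lambda>u. map (\<lambda>i. r (u, i)) [0..<p]) [0..<n])"
  shows "(\<exists>g. position_hom E p n P g) \<Longrightarrow> \<exists>f. res = Some (map f [0..<n]) \<and> position_hom E p n P f \<and>
      (\<forall>g. position_hom E p n P g \<longrightarrow> (\<Sum>u<n. r (u, f u)) \<le> (\<Sum>u<n. r (u, g u)))"
    and "\<not> (\<exists>g. position_hom E p n P g) \<Longrightarrow> res = None"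
proof -
  define A where "A = arcs_of (map (\<lambda>u. map (P u) [0..<n]) [0..<n])"
  have A: "set A = {(u, v). u < n \<and> v < n \<and> P u v}" unfolding A_def by (rule set_arcs_of)
  define K where "K = List.product [0..<n] [0..<p]"
  define Z where "Z = scale (map (\<lambda>k. (k, r k)) K)"
  interpret labelling_problem n p A Fw Bw L Z
    using assms(2) L(1) A by unfold_locales auto
  have res: "res = verify E A (decode_all (cut_labelling p Fw Bw A Z Ls) Ls)"
    unfolding res_def minhom_def solve_def fst_conv snd_conv lab A_def[symmetric] cells_eq K_def[symmetric] Z_def[symmetric] Ls_def ..
  have verify: "verify E A (map (\<lambda>u. (u, f u)) [0..<n]) =
      (if \<forall>(u, v) \<in> set A. (f u, f v) \<in> set E then Some (map f [0..<n]) else None)" for f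
    by (rule verify_eq) (use A in auto)
  {
    assume "\<exists>g. position_hom E p n P g"
    then obtain g0 where g0: "position_hom E p n P g0" by blast
    have set_L: "set (L u) = {..<p}" if "u < n" for u using hom[OF g0] that by blast
    have E: "(L u ! a, L v ! b) \<in> set E \<longleftrightarrow> implies Fw Bw a b" if "u < n" "v < n" "P u v" "a < p" "b < p" for u v a b
      using hom[OF g0] that by blast
    have to_compatible: "\<exists>d. compatible d \<and> (\<forall>u<n. L u ! d u = g u)" if g: "position_hom E p n P g" for g
    proof -
      have "\<exists>i<p. L u ! i = g u" if u: "u < n" for u
      proof -
        have "g u \<in> set (L u)" using set_L[OF u] g u by (auto simp: position_hom_def)
        then show ?thesis using L(1)[OF u] by (auto simp: in_set_conv_nth)
      qed
      then obtain d where d: "\<And>u. u < n \<Longrightarrow> d u < p \<and> L u ! d u = g u" by metis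
      have "implies Fw Bw (d u) (d v)" if uv: "(u, v) \<in> set A" for u v
        using E[of u v "d u" "d v"] d[of u] d[of v] g uv by (auto simp: A position_hom_def)
      then have "compatible d" using d unfolding compatible_def implies_def by blast
      with d show ?thesis by blast
    qed
    obtain D :: rat and \<kappa> :: "nat \<Rightarrow> rat" where D: "D > 0"
      and w: "\<And>u i. (u, i) \<in> set K \<Longrightarrow> of_nat (weight Z u i) = D * r (u, i) + \<kappa> u"
      unfolding Z_def using weight_scale[OF _ refl, of K r] unfolding K_def by (auto simp: distinct_product)
    \<comment> \<open>An increasing affine function of the true cost whose constant is the same for
      all labellings, so a minimum for \<open>label_cost\<close> is one for the given costs.\<close>
    have cost: "rat_of_nat (label_cost d) = D * (\<Sum>u<n. r (u, L u ! d u)) + (\<Sum>u<n. \<kappa> u)" if d: "compatible d" for d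
    proof -
      have "(u, L u ! d u) \<in> set K" if u: "u < n" for u
      proof -
        have "L u ! d u \<in> set (L u)" using d L(1) u by (auto simp: compatible_def)
        then show ?thesis using L(2)[OF u] u unfolding K_def by auto
      qed
      then have "rat_of_nat (label_cost d) = (\<Sum>u<n. D * r (u, L u ! d u) + \<kappa> u)"
        unfolding label_cost_def of_nat_sum by (intro sum.cong refl w) auto
      then show ?thesis by (simp add: sum.distrib sum_distrib_left)
    qed
    obtain d0 where "compatible d0" using to_compatible[OF g0] by blast
    then obtain d where d: "compatible d" "\<And>d'. compatible d' \<Longrightarrow> label_cost d \<le> label_cost d'"
      "decode_all (cut_labelling p Fw Bw A Z Ls) Ls = map (\<lambda>u. (u, L u ! d u)) [0..<n]"
      using cut_labelling_optimal by blast
    define f where "f u = L u ! d u" for u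
    have dp: "d u < p" if "u < n" for u using d(1) that by (auto simp: compatible_def)
    have fE: "(f u, f v) \<in> set E" if "u < n" "v < n" "P u v" for u v
    proof -
      have "implies Fw Bw (d u) (d v)" using d(1) that unfolding compatible_def implies_def A by blast
      then show ?thesis unfolding f_def using E that dp by blast
    qed
    have "f u < p" if "u < n" for u
    proof -
      have "f u \<in> set (L u)" unfolding f_def using dp[OF that] L(1)[OF that] by simp
      then show ?thesis using L(2)[OF that] by auto
    qed
    with fE have "position_hom E p n P f" unfolding position_hom_def by blast
    moreover have "res = Some (map f [0..<n])"
      unfolding res d(3) f_def[symmetric] verify using fE A by auto
    moreover have "(\<Sum>u<n. r (u, f u)) \<le> (\<Sum>u<n. r (u, g u))" if g: "position_hom E p n P g" for g
    proof -
      obtain d' where d': "compatible d'" "\<And>u. u < n \<Longrightarrow> L u ! d' u = g u" using to_compatible[OF g] by blast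
      have "rat_of_nat (label_cost d) \<le> rat_of_nat (label_cost d')" using d(2)[OF d'(1)] by simp
      then have "D * (\<Sum>u<n. r (u, f u)) \<le> D * (\<Sum>u<n. r (u, L u ! d' u))"
        unfolding cost[OF d(1)] cost[OF d'(1)] f_def by simp
      also have "(\<Sum>u<n. r (u, L u ! d' u)) = (\<Sum>u<n. r (u, g u))"
        using d'(2) by (intro sum.cong) auto
      finally show ?thesis using D by simp
    qed
    ultimately show "\<exists>f. res = Some (map f [0..<n]) \<and> position_hom E p n P f \<and>
      (\<forall>g. position_hom E p n P g \<longrightarrow> (\<Sum>u<n. r (u, f u)) \<le> (\<Sum>u<n. r (u, g u)))" by blast
  }
  {
    assume none: "\<not> (\<exists>g. position_hom E p n P g)"
    define f where "f u = decode (cut_labelling p Fw Bw A Z Ls) u (L u)" for u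
    \<comment> \<open>The decoded labels are in range, so only a violated arc can keep
      \<open>f\<close> from being a homomorphism, and the check finds it.\<close>
    have "f u < p" if "u < n" for u
      using decode_in[of "cut_labelling p Fw Bw A Z Ls" u "L u"] L(2)[OF that] \<open>p > 0\<close> unfolding f_def by auto
    with none have "\<not> (\<forall>(u, v) \<in> set A. (f u, f v) \<in> set E)" unfolding position_hom_def A by blast
    moreover have "decode_all (cut_labelling p Fw Bw A Z Ls) Ls = map (\<lambda>u. (u, f u)) [0..<n]"
      unfolding decode_all_def f_def by (subst (2) Ls_def) simp
    ultimately show "res = None" unfolding res by (simp only: verify if_False)
  }
qed

text \<open>The interface to both cases: it remains to order the labels at each vertex so that
  adjacency in \<open>H\<close> becomes a fixed set of threshold implications between
  indices.\<close>

theorem poly_time_of_label_lists: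
  fixes H :: "('a, 'b) pre_digraph" and lab :: "bool list list \<Rightarrow> (nat \<times> nat list) list"
  assumes "distinct hs" "set hs = verts H" "hs \<noteq> []" "pt lab"
    and E: "set E = {(i, j). i < length hs \<and> j < length hs \<and> hs ! i \<rightarrow>\<^bsub>H\<^esub> hs ! j}"
    and FB: "\<And>i j. (i, j) \<in> set Fw \<union> set Bw \<Longrightarrow> i \<le> length hs \<and> j \<le> length hs"
    and lab: "\<And>n P. \<exists>L. lab (map (\<lambda>u. map (P u) [0..<n]) [0..<n]) = map (\<lambda>u. (u, L u)) [0..<n] \<and>
       (\<forall>u<n. length (L u) = length hs \<and> set (L u) \<subseteq> {..<length hs}) \<and>
       (\<forall>g. position_hom E (length hs) n P g \<longrightarrow> (\<forall>u<n. set (L u) = {..<length hs}) \<and>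
         (\<forall>u<n. \<forall>v<n. P u v \<longrightarrow> (\<forall>a<length hs. \<forall>b<length hs. (L u ! a, L v ! b) \<in> set E \<longleftrightarrow> implies Fw Bw a b)))"
  shows "poly_time_solvable minhom_instances (enc_minhom hs) (minhom_answer H hs)"
proof (rule poly_time_solvableI[OF pt_minhom[OF \<open>pt lab\<close>, of "length hs" Fw Bw E],
      where g = "\<lambda>(G, c). let vs = [0..<card (pverts G)] in
        (map (\<lambda>u. map (\<lambda>v. (u, v) \<in> parcs G) vs) vs, map (\<lambda>u. map (\<lambda>i. c u (hs ! i)) [0..<length hs]) vs)"])
  let ?p = "length hs"
  fix x :: "'a minhom_instance" assume x: "x \<in> minhom_instances"
  obtain G c where Gc: "x = (G, c)" by (cases x)
  from x Gc obtain n where n: "pverts G = {0..<n}" and "pair_digraph G"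
    unfolding minhom_instances_def by auto
  interpret G: pair_digraph G by fact
  let ?P = "\<lambda>u v. (u, v) \<in> parcs G"
  let ?r = "\<lambda>(u, i). c u (hs ! i)"
  have enc_map: "enc_list e (map h l) = enc_list (\<lambda>x. e (h x)) l" for e :: "'c \<Rightarrow> btree" and h :: "'d \<Rightarrow> 'c" and l
    by (induction l) auto
  have hs_map: "enc_list e hs = enc_list (\<lambda>i. e (hs ! i)) [0..<?p]" for e :: "'a \<Rightarrow> btree"
    using enc_map[of e "(!) hs" "[0..<?p]"] by (simp add: map_nth)
  show "enc_minhom hs x = enc (case x of (G, c) \<Rightarrow> let vs = [0..<card (pverts G)] in
        (map (\<lambda>u. map (\<lambda>v. (u, v) \<in> parcs G) vs) vs, map (\<lambda>u. map (\<lambda>i. c u (hs ! i)) [0..<?p]) vs))"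
    unfolding Gc enc_minhom_def split_conv Let_def hs_map enc_Pair
    by (simp add: encode_list encode_bool encode_rat enc_map)
  obtain L where L: "lab (map (\<lambda>u. map (?P u) [0..<n]) [0..<n]) = map (\<lambda>u. (u, L u)) [0..<n]"
    "\<And>u. u < n \<Longrightarrow> length (L u) = ?p" "\<And>u. u < n \<Longrightarrow> set (L u) \<subseteq> {..<?p}"
    "\<And>g. position_hom E ?p n ?P g \<Longrightarrow> (\<forall>u<n. set (L u) = {..<?p}) \<and>
         (\<forall>u<n. \<forall>v<n. ?P u v \<longrightarrow> (\<forall>a<?p. \<forall>b<?p. (L u ! a, L v ! b) \<in> set E \<longleftrightarrow> implies Fw Bw a b))"
    using lab[where n = n and P = ?P] by blast
  define res where "res = minhom ?p Fw Bw E lab (map (\<lambda>u. map (?P u) [0..<n]) [0..<n],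
    map (\<lambda>u. map (\<lambda>i. ?r (u, i)) [0..<?p]) [0..<n])"
  have p: "?p > 0" using \<open>hs \<noteq> []\<close> by simp
  note mc = minhom_correct[where p = "?p" and Fw = Fw and Bw = Bw and E = E and n = n and P = ?P and L = L
    and lab = lab and r = ?r, folded res_def]
  have correct: "\<exists>f. res = Some (map f [0..<n]) \<and> position_hom E ?p n ?P f \<and>
      (\<forall>g. position_hom E ?p n ?P g \<longrightarrow> (\<Sum>u<n. ?r (u, f u)) \<le> (\<Sum>u<n. ?r (u, g u)))"
    if ex: "\<exists>g. position_hom E ?p n ?P g"
    by (rule mc(1)) (fact p, erule FB, erule L(2), erule L(3), erule L(4), fact L(1), fact ex)
  have correct': "res = None" if no: "\<not> (\<exists>g. position_hom E ?p n ?P g)"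
    by (rule mc(2)) (fact p, erule FB, erule L(2), erule L(3), erule L(4), fact L(1), fact no)
  have verts: "u \<in> pverts G \<longleftrightarrow> u < n" for u using n by auto
  have arcs: "u < n \<and> v < n" if "(u, v) \<in> parcs G" for u v
    using G.in_arcsD1[OF that] G.in_arcsD2[OF that] verts by auto
  have to_hom: "digraph_hom (with_proj G) H (\<lambda>u. hs ! g u)" if g: "position_hom E ?p n ?P g" for g
    unfolding digraph_hom_def
  proof (intro conjI ballI allI impI)
    fix u assume "u \<in> verts (with_proj G)"
    then have "g u < ?p" using g verts unfolding position_hom_def by simp
    then show "hs ! g u \<in> verts H" using assms(2) nth_mem by blast
  next
    fix u v assume "u \<rightarrow>\<^bsub>with_proj G\<^esub> v"
    then have "(u, v) \<in> parcs G" by simp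
    then have "(g u, g v) \<in> set E" using g arcs[of u v] unfolding position_hom_def by blast
    then show "hs ! g u \<rightarrow>\<^bsub>H\<^esub> hs ! g v" unfolding E by simp
  qed
  have of_hom: "\<exists>g. position_hom E ?p n ?P g \<and> (\<forall>u<n. hs ! g u = f u)" if f: "digraph_hom (with_proj G) H f" for f
  proof -
    have "\<exists>i < ?p. hs ! i = f u" if u: "u < n" for u
    proof -
      have "f u \<in> set hs" using f u verts assms(2) unfolding digraph_hom_def by simp
      then show ?thesis by (auto simp: in_set_conv_nth)
    qed
    then obtain g where g: "\<And>u. u < n \<Longrightarrow> g u < ?p \<and> hs ! g u = f u" by metis
    moreover have "(g u, g v) \<in> set E" if uv: "u < n" "v < n" "(u, v) \<in> parcs G" for u v
      using f g[OF uv(1)] g[OF uv(2)] uv(3) unfolding E digraph_hom_def by auto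
    ultimately show ?thesis unfolding position_hom_def by blast
  qed
  have cost: "hom_cost (with_proj G) c f = (\<Sum>u<n. ?r (u, g u))" if g: "\<And>u. u < n \<Longrightarrow> hs ! g u = f u" for f g
    unfolding hom_cost_def using g n by (auto intro!: sum.cong)
  have "minhom_answer H hs (G, c) (enc res)"
  proof (cases "\<exists>g. position_hom E ?p n ?P g")
    case True
    then obtain f where f: "res = Some (map f [0..<n])" "position_hom E ?p n ?P f"
      "\<And>g. position_hom E ?p n ?P g \<Longrightarrow> (\<Sum>u<n. ?r (u, f u)) \<le> (\<Sum>u<n. ?r (u, g u))"
      using correct by blast
    have hom: "digraph_hom (with_proj G) H (\<lambda>u. hs ! f u)" by (rule to_hom[OF f(2)])
    have "min_cost_hom (with_proj G) H c (\<lambda>u. hs ! f u)"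
      unfolding min_cost_hom_def
    proof (intro conjI hom allI impI)
      fix h assume "digraph_hom (with_proj G) H h"
      then obtain g where g: "position_hom E ?p n ?P g" "\<And>u. u < n \<Longrightarrow> hs ! g u = h u" using of_hom by blast
      show "hom_cost (with_proj G) c (\<lambda>u. hs ! f u) \<le> hom_cost (with_proj G) c h"
        using f(3)[OF g(1)] cost[of g h, OF g(2)] cost[of f "\<lambda>u. hs ! f u"] by simp
    qed
    moreover have "set (map f [0..<n]) \<subseteq> {0..<?p}" using f(2) unfolding position_hom_def by auto
    moreover have "enc res = Fork Leaf (enc_list enc_nat (map f [0..<n]))"
      unfolding f(1) by (simp add: encode_list encode_nat)
    ultimately show ?thesis unfolding minhom_answer_def split_conv using hom
      by (subst if_P, blast)
        (intro exI[of _ "\<lambda>u. hs ! f u"] exI[of _ "map f [0..<n]"] conjI; simp add: n)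
  next
    case False
    then have "\<not> (\<exists>f. digraph_hom (with_proj G) H f)" using of_hom by blast
    moreover have "enc res = Leaf" using correct'[OF False] by simp
    ultimately show ?thesis unfolding minhom_answer_def by simp
  qed
  then show "minhom_answer H hs x (enc (minhom ?p Fw Bw E lab (case x of (G, c) \<Rightarrow> let vs = [0..<card (pverts G)] in
        (map (\<lambda>u. map (\<lambda>v. (u, v) \<in> parcs G) vs) vs, map (\<lambda>u. map (\<lambda>i. c u (hs ! i)) [0..<?p]) vs))))"
    unfolding Gc res_def Let_def by (simp add: n)
qed


section \<open>Acyclic locally semicomplete digraphs\<close>

locale acyclic_local_tournament =
  fixes r :: "('a \<times> 'a) set"
  assumes acyclic: "acyclic r"
    and in_neighbours: "(a, x) \<in> r \<Longrightarrow> (b, x) \<in> r \<Longrightarrow> a \<noteq> b \<Longrightarrow> (a, b) \<in> r \<or> (b, a) \<in> r"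
    and out_neighbours: "(x, a) \<in> r \<Longrightarrow> (x, b) \<in> r \<Longrightarrow> a \<noteq> b \<Longrightarrow> (a, b) \<in> r \<or> (b, a) \<in> r"
begin

text \<open>Walk back along the path from \<open>z\<close>: its last inner vertex and
  \<open>y\<close> are both in-neighbours of \<open>z\<close>, hence equal or adjacent. Either
  comparability follows at once or \<open>y\<close> has an arc to a vertex one step earlier.\<close>

lemma comparable_in: "(x, z) \<in> r\<^sup>* \<Longrightarrow> (y, z) \<in> r \<Longrightarrow> (x, y) \<in> r\<^sup>* \<or> (y, x) \<in> r\<^sup>*"
proof (induction arbitrary: y rule: rtrancl_induct)
  case (step x' z)
  then show ?case using in_neighbours[of x' z y] by (metis rtrancl.rtrancl_into_rtrancl)
qed blast

lemma dual: "acyclic_local_tournament (r\<inverse>)"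
  using acyclic in_neighbours out_neighbours by unfold_locales auto

lemma comparable_out:
  assumes "(z, x) \<in> r\<^sup>*" "(z, y) \<in> r" shows "(x, y) \<in> r\<^sup>* \<or> (y, x) \<in> r\<^sup>*"
  using acyclic_local_tournament.comparable_in[OF dual, of x z y] assms by (auto simp: rtrancl_converse)

text \<open>Extends comparability edge by edge along a walk in the underlying graph. Only edges
  pointing against the current direction need the neighbourhood conditions.\<close>

lemma comparable: "(x, y) \<in> (r \<union> r\<inverse>)\<^sup>* \<Longrightarrow> (x, y) \<in> r\<^sup>* \<or> (y, x) \<in> r\<^sup>*"
proof (induction rule: rtrancl_induct)
  case (step y z)
  consider "(x, y) \<in> r\<^sup>*" "(y, z) \<in> r" | "(x, y) \<in> r\<^sup>*" "(z, y) \<in> r"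
    | "(y, x) \<in> r\<^sup>*" "(y, z) \<in> r" | "(y, x) \<in> r\<^sup>*" "(z, y) \<in> r"
    using step by blast
  then show ?case
  proof cases
    case 1 then show ?thesis by (meson rtrancl.rtrancl_into_rtrancl)
  next
    case 2 then show ?thesis by (rule comparable_in)
  next
    case 3 then show ?thesis by (rule comparable_out)
  next
    case 4 then show ?thesis by (meson converse_rtrancl_into_rtrancl)
  qed
qed blast

lemma no_back: "(x, y) \<in> r\<^sup>* \<Longrightarrow> (y, x) \<in> r \<Longrightarrow> False"
  using acyclic by (meson acyclic_def rtrancl_into_trancl2 rtrancl_into_trancl1)

lemma antisym: "(x, y) \<in> r\<^sup>* \<Longrightarrow> (y, x) \<in> r\<^sup>* \<Longrightarrow> x = y"
  using acyclic by (metis acyclic_impl_antisym_rtrancl antisymD)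

text \<open>Move the head of the arc back along the path from \<open>k\<close>: \<open>x\<close> and
  the predecessor of the head are both in-neighbours of it, hence adjacent, and acyclicity fixes the
  direction.\<close>

lemma convex_out: "(k, y) \<in> r\<^sup>* \<Longrightarrow> (x, y) \<in> r \<Longrightarrow> (x, k) \<in> r\<^sup>* \<Longrightarrow> k \<noteq> x \<Longrightarrow> (x, k) \<in> r"
proof (induction rule: rtrancl_induct)
  case (step y' y)
  have "x \<noteq> y'" using step antisym by blast
  moreover have "(y', x) \<notin> r" using step no_back[of x y'] by (meson rtrancl_trans)
  ultimately show ?case using step in_neighbours by blast
qed

lemma convex_in: "(x, k) \<in> r\<^sup>* \<Longrightarrow> (x, y) \<in> r \<Longrightarrow> (k, y) \<in> r\<^sup>* \<Longrightarrow> k \<noteq> y \<Longrightarrow> (k, y) \<in> r"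
  using acyclic_local_tournament.convex_out[OF dual, of k x y] by (auto simp: rtrancl_converse)

end

lemma sorted_enumeration:
  assumes "finite V" "\<And>x y. x \<in> V \<Longrightarrow> y \<in> V \<Longrightarrow> R x y \<or> R y x" "\<And>x y z. R x y \<Longrightarrow> R y z \<Longrightarrow> R x z"
  shows "\<exists>xs. distinct xs \<and> set xs = V \<and> sorted_wrt R xs"
  using assms(1,2)
proof (induction V rule: finite_induct)
  case (insert a V)
  then obtain xs where xs: "distinct xs" "set xs = V" "sorted_wrt R xs" by blast
  let ?ys = "filter (\<lambda>x. R x a) xs @ a # filter (\<lambda>x. \<not> R x a) xs"
  have tot: "R a y" if "y \<in> V" "\<not> R y a" for y using insert.prems[of a y] that by blast
  have "sorted_wrt R ?ys"
    using xs tot assms(3) by (auto simp: sorted_wrt_append sorted_wrt_filter)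
  moreover have "distinct ?ys" "set ?ys = insert a V" using xs insert.hyps by auto
  ultimately show ?case by blast
qed simp

text \<open>A relation on indices that only goes forward and is convex is determined by the threshold
  implications that it satisfies.\<close>

definition forward_implications :: "nat \<Rightarrow> (nat \<Rightarrow> nat \<Rightarrow> bool) \<Rightarrow> (nat \<times> nat) list" where
  "forward_implications p e =
     filter (\<lambda>(i, j). \<forall>a<p. \<forall>b<p. e a b \<longrightarrow> i \<le> a \<longrightarrow> j \<le> b) (List.product [0..<Suc p] [0..<Suc p])"

definition backward_implications :: "nat \<Rightarrow> (nat \<Rightarrow> nat \<Rightarrow> bool) \<Rightarrow> (nat \<times> nat) list" where
  "backward_implications p e =
     filter (\<lambda>(i, j). \<forall>a<p. \<forall>b<p. e a b \<longrightarrow> j \<le> b \<longrightarrow> i \<le> a) (List.product [0..<Suc p] [0..<Suc p])"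

lemma implies_iff:
  assumes "\<And>a b. a < p \<Longrightarrow> b < p \<Longrightarrow> e a b \<Longrightarrow> a < b"
    "\<And>a b a' b'. b < p \<Longrightarrow> e a b \<Longrightarrow> a \<le> a' \<Longrightarrow> a' < b' \<Longrightarrow> b' \<le> b \<Longrightarrow> e a' b'"
    "a < p" "b < p"
  shows "e a b \<longleftrightarrow> implies (forward_implications p e) (backward_implications p e) a b"
proof
  assume "e a b"
  then show "implies (forward_implications p e) (backward_implications p e) a b"
    using assms(3,4) unfolding implies_def forward_implications_def backward_implications_def by auto
next
  assume I: "implies (forward_implications p e) (backward_implications p e) a b"
  \<comment> \<open>Valid because arcs go forward. For \<open>a = p - 1\<close> its conclusion is
    the unattainable threshold \<open>p\<close>, which is why thresholds run up to \<open>p\<close>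
    inclusive.\<close>
  have "(a, Suc a) \<in> set (forward_implications p e)"
    using assms(1,3) unfolding forward_implications_def by (fastforce simp del: upt_Suc)
  with I have "a < b" unfolding implies_def by force
  show "e a b"
  proof (rule ccontr)
    assume "\<not> e a b"
    \<comment> \<open>An arc from at most \<open>a\<close> to at least \<open>b\<close> would force
      the arc from \<open>a\<close> to \<open>b\<close> by convexity. The implication from
      \<open>b\<close> back to \<open>Suc a\<close> is therefore valid, yet the pair itself violates
      it.\<close>
    then have "Suc a \<le> a'" if "a' < p" "b' < p" "e a' b'" "b \<le> b'" for a' b'
      using assms(2)[of b' a' a b] that \<open>a < b\<close> by force
    then have "(Suc a, b) \<in> set (backward_implications p e)"
      using assms(3,4) unfolding backward_implications_def by (auto simp del: upt_Suc)
    with I show False unfolding implies_def by force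
  qed
qed

definition adjacency_list :: "('a, 'b) pre_digraph \<Rightarrow> 'a list \<Rightarrow> (nat \<times> nat) list" where
  "adjacency_list H hs =
     filter (\<lambda>(i, j). hs ! i \<rightarrow>\<^bsub>H\<^esub> hs ! j) (List.product [0..<length hs] [0..<length hs])"

lemma set_adjacency_list:
  "set (adjacency_list H hs) = {(i, j). i < length hs \<and> j < length hs \<and> hs ! i \<rightarrow>\<^bsub>H\<^esub> hs ! j}"
  by (auto simp: adjacency_list_def)

section \<open>From digraphs to relations on the vertices\<close>

lemma acyclic_arcs_ends:
  assumes "digraph H" "acyclic_digraph H" shows "acyclic (arcs_ends H)"
proof (rule acyclicI, rule allI, rule notI)
  interpret digraph H by fact
  fix x assume "(x, x) \<in> (arcs_ends H)\<^sup>+"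
  then obtain p where "awalk x p x" "p \<noteq> []" unfolding reachable1_awalk by blast
  then have "closed_w p" by (auto simp: closed_w_def)
  from closed_w_imp_cycle[OF this] show False using assms(2) by (simp add: acyclic_digraph_def)
qed

lemma connected_rtrancl:
  assumes "connected H" "u \<in> verts H" "v \<in> verts H"
  shows "(u, v) \<in> (arcs_ends H \<union> (arcs_ends H)\<inverse>)\<^sup>*"
proof -
  have "u \<rightarrow>\<^sup>*\<^bsub>with_proj (mk_symmetric H)\<^esub> v"
    using assms by (simp add: connected_def strongly_connected_def)
  then have "(u, v) \<in> (arcs_ends (with_proj (mk_symmetric H)))\<^sup>*" by (rule reachable_rtranclI)
  moreover have "arcs_ends (with_proj (mk_symmetric H)) = arcs_ends H \<union> (arcs_ends H)\<inverse>"
    by (auto simp: parcs_mk_symmetric arcs_ends_conv)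
  ultimately show ?thesis by simp
qed

lemma semicomplete_induce:
  assumes "semicomplete (H \<restriction> S)" "a \<in> S" "b \<in> S" "a \<noteq> b"
  shows "a \<rightarrow>\<^bsub>H\<^esub> b \<or> b \<rightarrow>\<^bsub>H\<^esub> a"
  using assms unfolding semicomplete_def by (auto simp: arcs_ends_conv; blast)

lemma acyclic_case:
  fixes H :: "('a, 'b) pre_digraph"
  assumes "digraph H" "connected H" "locally_semicomplete H" "acyclic_digraph H"
  shows "MinHOM_poly_time H"
  unfolding MinHOM_poly_time_def
proof (intro allI impI, elim conjE)
  fix hs assume hs: "distinct hs" "set hs = verts H"
  interpret H: digraph H by fact
  let ?r = "arcs_ends H" and ?p = "length hs"
  interpret T: acyclic_local_tournament ?r
  proof
    show "acyclic ?r" by (rule acyclic_arcs_ends[OF assms(1,4)])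
    show "(a, b) \<in> ?r \<or> (b, a) \<in> ?r" if "(a, x) \<in> ?r" "(b, x) \<in> ?r" "a \<noteq> b" for a b x
    proof (rule semicomplete_induce)
      show "semicomplete (H \<restriction> {y. y \<rightarrow>\<^bsub>H\<^esub> x})"
        using assms(3) H.adj_in_verts[OF that(1)] by (simp add: locally_semicomplete_def)
    qed (use that in auto)
    show "(a, b) \<in> ?r \<or> (b, a) \<in> ?r" if "(x, a) \<in> ?r" "(x, b) \<in> ?r" "a \<noteq> b" for a b x
    proof (rule semicomplete_induce)
      show "semicomplete (H \<restriction> {y. x \<rightarrow>\<^bsub>H\<^esub> y})"
        using assms(3) H.adj_in_verts[OF that(1)] by (simp add: locally_semicomplete_def)
    qed (use that in auto)
  qed
  have "\<exists>xs. distinct xs \<and> set xs = {..<?p} \<and> sorted_wrt (\<lambda>i j. (hs ! i, hs ! j) \<in> ?r\<^sup>*) xs"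
  proof (rule sorted_enumeration)
    fix i j assume "i \<in> {..<?p}" "j \<in> {..<?p}"
    then have "hs ! i \<in> verts H" "hs ! j \<in> verts H" using hs(2) nth_mem by auto
    then show "(hs ! i, hs ! j) \<in> ?r\<^sup>* \<or> (hs ! j, hs ! i) \<in> ?r\<^sup>*"
      using T.comparable[OF connected_rtrancl[OF assms(2)]] by blast
  qed auto
  then obtain \<sigma> where \<sigma>: "distinct \<sigma>" "set \<sigma> = {..<?p}" "sorted_wrt (\<lambda>i j. (hs ! i, hs ! j) \<in> ?r\<^sup>*) \<sigma>"
    by blast
  have len: "length \<sigma> = ?p" using distinct_card[OF \<sigma>(1)] \<sigma>(2) by simp
  define v where "v a = hs ! (\<sigma> ! a)" for a
  define e where "e a b \<longleftrightarrow> (v a, v b) \<in> ?r" for a b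
  have \<sigma>_less: "\<sigma> ! a < ?p" if "a < ?p" for a using that \<sigma>(2) len nth_mem[of a \<sigma>] by auto
  have v_le: "(v a, v b) \<in> ?r\<^sup>*" if "a \<le> b" "b < ?p" for a b
    using that sorted_wrt_nth_less[OF \<sigma>(3), of a b] len by (cases "a = b") (auto simp: v_def)
  have v_neq: "v a \<noteq> v b" if "a < b" "b < ?p" for a b
    using that \<sigma>_less[of a] \<sigma>_less[of b] \<sigma>(1) hs(1) len by (simp add: v_def nth_eq_iff_index_eq)
  have e1: "a < b" if "a < ?p" "b < ?p" "e a b" for a b
    using v_le[of b a] T.no_back[of "v b" "v a"] that by (force simp: e_def)
  have e2: "e a' b'" if "b < ?p" "e a b" "a \<le> a'" "a' < b'" "b' \<le> b" for a b a' b'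
  proof -
    \<comment> \<open>The arc is shrunk at its head first and then, by \<open>convex_in\<close>, at
      its tail.\<close>
    have "(v a, v b') \<in> ?r"
      using that v_neq[of a b'] by (intro T.convex_out[of "v b'" "v b" "v a"] v_le) (auto simp: e_def)
    then show ?thesis
      unfolding e_def using that v_neq[of a' b'] by (intro T.convex_in[of "v a" "v a'" "v b'"] v_le) auto
  qed
  let ?F = "forward_implications ?p e" and ?B = "backward_implications ?p e"
  have E: "(\<sigma> ! a, \<sigma> ! b) \<in> set (adjacency_list H hs) \<longleftrightarrow> implies ?F ?B a b" if "a < ?p" "b < ?p" for a b
  proof -
    have "(\<sigma> ! a, \<sigma> ! b) \<in> set (adjacency_list H hs) \<longleftrightarrow> e a b"
      using \<sigma>_less that by (simp add: set_adjacency_list e_def v_def)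
    also have "\<dots> \<longleftrightarrow> implies ?F ?B a b" by (rule implies_iff[OF e1 e2 that])
    finally show ?thesis .
  qed
  show "poly_time_solvable minhom_instances (enc_minhom hs) (minhom_answer H hs)"
  \<comment> \<open>The input digraph does not influence the ordering here: every vertex gets the
    list \<open>\<sigma>\<close>.\<close>
  proof (rule poly_time_of_label_lists[where Fw = ?F and Bw = ?B and E = "adjacency_list H hs"
        and lab = "\<lambda>M. map (\<lambda>x. (fst x, \<sigma>)) (List.enumerate 0 M)"])
    show "hs \<noteq> []" using assms(2) hs(2) by (auto simp: connected_def strongly_connected_def)
    show "pt (\<lambda>M :: bool list list. map (\<lambda>x. (fst x, \<sigma>)) (List.enumerate 0 M))" by (intro pt_intros)
    show "i \<le> ?p \<and> j \<le> ?p" if "(i, j) \<in> set ?F \<union> set ?B" for i j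
      using that by (auto simp: forward_implications_def backward_implications_def simp del: upt_Suc)
    show "\<exists>L. map (\<lambda>x. (fst x, \<sigma>)) (List.enumerate 0 (map (\<lambda>u. map (P u) [0..<n]) [0..<n])) = map (\<lambda>u. (u, L u)) [0..<n] \<and>
       (\<forall>u<n. length (L u) = ?p \<and> set (L u) \<subseteq> {..<?p}) \<and>
       (\<forall>g. position_hom (adjacency_list H hs) ?p n P g \<longrightarrow> (\<forall>u<n. set (L u) = {..<?p}) \<and>
         (\<forall>u<n. \<forall>v<n. P u v \<longrightarrow> (\<forall>a<?p. \<forall>b<?p. (L u ! a, L v ! b) \<in> set (adjacency_list H hs) \<longleftrightarrow> implies ?F ?B a b)))"
      for n P
      using len \<sigma>(2) E by (intro exI[of _ "\<lambda>_. \<sigma>"]) (simp add: enumerate_conv_map)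
  qed (use hs set_adjacency_list in auto)
qed


section \<open>Directed cycles\<close>

text \<open>One step along an arc (\<open>True\<close>) or against it (\<open>False\<close>);
  rotating a list of length \<open>k\<close> by \<open>k - 1\<close> undoes one rotation.\<close>

definition turn :: "nat \<Rightarrow> bool \<Rightarrow> 'a list \<Rightarrow> 'a list" where
  "turn k x l = (if x then rotate1 l else rotate (k - 1) l)"

text \<open>Forests list new arcs first, so \<open>foldr\<close> handles a parent before its
  children. Roots get \<open>\<sigma>\<close>, every other vertex the list of its parent turned by
  one step.\<close>

definition labels :: "nat list \<Rightarrow> (nat, bool) arc_list \<Rightarrow> (nat \<times> nat list) list" where
  "labels \<sigma> T = foldr (\<lambda>e M. (snd (fst e), if fst (fst e) = snd (fst e) then \<sigma>
     else turn (length \<sigma>) (snd e) (lookup \<sigma> M (fst (fst e)))) # M) T []"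

definition both_directions :: "(nat \<times> nat) list \<Rightarrow> (nat, bool) arc_list" where
  "both_directions A = concat (map (\<lambda>a. [(a, True), ((snd a, fst a), False)]) A)"

text \<open>Closing after each root makes the reached set closed before the next root is added, as
  \<open>arbor\<close> demands.\<close>

definition spanning_forest :: "(nat, bool) arc_list \<Rightarrow> nat list \<Rightarrow> (nat, bool) arc_list" where
  "spanning_forest A vs = foldl (\<lambda>T u. if u \<in> set (reach T) then T else close A (((u, u), True) # T)) [] vs"

definition cycle_labels :: "nat list \<Rightarrow> bool list list \<Rightarrow> (nat \<times> nat list) list" where
  "cycle_labels \<sigma> M = (let T = labels \<sigma> (spanning_forest (both_directions (arcs_of M)) [0..<length M])
     in map (\<lambda>u. (u, lookup \<sigma> T u)) [0..<length M])"

lemma labels_simps [simp]: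
  "labels \<sigma> [] = []"
  "labels \<sigma> (e # T) = (snd (fst e), if fst (fst e) = snd (fst e) then \<sigma>
     else turn (length \<sigma>) (snd e) (lookup \<sigma> (labels \<sigma> T) (fst (fst e)))) # labels \<sigma> T"
  by (simp_all add: labels_def)

lemma lookup_simps [simp]: "lookup d [] k = d" "lookup d (kv # M) k = (if fst kv = k then snd kv else lookup d M k)"
  by (simp_all add: lookup_def)

lemma lookup_cases: "lookup d M k = d \<or> (\<exists>kv \<in> set M. lookup d M k = snd kv)"
  by (induction M) auto

lemma turn_rotate: "\<exists>m'. turn k x (rotate m \<sigma>) = rotate m' \<sigma>"
  unfolding turn_def by (metis rotate_Suc rotate_rotate)

lemma labels_rotate: "\<exists>m. lookup \<sigma> (labels \<sigma> T) u = rotate m \<sigma>"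
proof (induction T arbitrary: u)
  case Nil
  then show ?case by (auto intro: exI[of _ 0])
next
  case (Cons e T)
  obtain m where "lookup \<sigma> (labels \<sigma> T) (fst (fst e)) = rotate m \<sigma>" using Cons by blast
  then show ?case using Cons[of u] turn_rotate[of "length \<sigma>" "snd e" m \<sigma>] by (auto intro: exI[of _ 0])
qed

lemma rotate_cong: "m mod length l = m' mod length l \<Longrightarrow> rotate m l = rotate m' l"
  by (metis rotate_conv_mod)

lemma set_both_directions: "((u, v), x) \<in> set (both_directions A) \<longleftrightarrow> (if x then (u, v) \<in> set A else (v, u) \<in> set A)"
  by (cases x) (force simp: both_directions_def)+

text \<open>The lists are computed without knowing a homomorphism. If one exists, it can be shifted
  component by component until the computed rotations are its values.\<close>

lemma labels_correct:
  assumes "arbor (both_directions A) X T" and k: "length \<sigma> = k" "k > 0"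
    and "\<And>u v. (u, v) \<in> set A \<Longrightarrow> h v mod k = Suc (h u) mod k"
  shows "\<exists>h. (\<forall>(u, v) \<in> set A. h v mod k = Suc (h u) mod k) \<and>
    (\<forall>u \<in> set (reach T). lookup \<sigma> (labels \<sigma> T) u = rotate (h u) \<sigma>)"
  using assms(1)
proof (induction T)
  case Nil
  then show ?case using assms(4) by auto
next
  case (Cons e T)
  obtain a b x where e: "e = ((a, b), x)" by (metis prod.collapse)
  from Cons obtain h where h: "\<And>u v. (u, v) \<in> set A \<Longrightarrow> h v mod k = Suc (h u) mod k"
    and lab: "\<And>u. u \<in> set (reach T) \<Longrightarrow> lookup \<sigma> (labels \<sigma> T) u = rotate (h u) \<sigma>" by auto
  have b: "b \<notin> set (reach T)" using Cons.prems by (simp add: e)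
  show ?case
  proof (cases "a = b")
    case True
    then have closed: "closed_under (both_directions A) (set (reach T))" using Cons.prems b by (auto simp: e)
    \<comment> \<open>Chosen so that \<open>h b + c\<close> is divisible by \<open>k\<close>, since
      the new root gets \<open>\<sigma>\<close> unrotated. Shifting only outside the reached set is
      safe: that set is closed in both directions, so no arc leaves or enters it.\<close>
    define c where "c = k - h b mod k"
    define h' where "h' u = (if u \<in> set (reach T) then h u else h u + c)" for u
    have step: "h' v mod k = Suc (h' u) mod k" if uv: "(u, v) \<in> set A" for u v
    proof -
      have "u \<in> set (reach T) \<longleftrightarrow> v \<in> set (reach T)"
        using closed uv set_both_directions[of u v True A] set_both_directions[of v u False A]
        unfolding closed_under_def by (metis fst_conv snd_conv)
      moreover have "(h v + c) mod k = (Suc (h u) + c) mod k"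
        by (rule mod_add_cong[OF h[OF uv] refl])
      ultimately show ?thesis using h[OF uv] by (auto simp: h'_def)
    qed
    have "(h b + c) mod k = 0"
    proof -
      have "(h b + c) mod k = (h b mod k + c) mod k" by (simp add: mod_add_left_eq)
      also have "h b mod k + c = k" unfolding c_def using \<open>k > 0\<close> by (simp add: less_imp_le)
      finally show ?thesis by simp
    qed
    then have rot: "rotate (h b + c) \<sigma> = \<sigma>"
      using rotate_cong[of "h b + c" \<sigma> 0] k by simp
    have "\<forall>u \<in> set (reach (e # T)). lookup \<sigma> (labels \<sigma> (e # T)) u = rotate (h' u) \<sigma>"
      using lab b True rot by (auto simp: e h'_def)
    with step show ?thesis by blast
  next
    case False
    then have a: "a \<in> set (reach T)" "((a, b), x) \<in> set (both_directions A)" using Cons.prems by (auto simp: e)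
    have "turn k x (rotate (h a) \<sigma>) = rotate (h b) \<sigma>"
    proof (cases x)
      case True
      then have "h b mod k = Suc (h a) mod k" using a(2) h by (simp add: set_both_directions)
      then have "rotate (Suc (h a)) \<sigma> = rotate (h b) \<sigma>" by (intro rotate_cong) (simp add: k)
      then show ?thesis using True by (simp add: turn_def)
    next
      case x: False
      then have "h a mod k = Suc (h b) mod k" using a(2) h by (simp add: set_both_directions)
      \<comment> \<open>Adding \<open>k - 1\<close> inverts \<open>Suc\<close> modulo
        \<open>k\<close>, which recovers the value at the head \<open>b\<close> of a tree arc that
        is traversed backwards.\<close>
      then have "(k - 1 + h a) mod k = (k - 1 + Suc (h b)) mod k" by (rule mod_add_cong[OF refl])
      also have "k - 1 + Suc (h b) = h b + k" using k by simp
      finally have "rotate (k - 1 + h a) \<sigma> = rotate (h b) \<sigma>" by (intro rotate_cong) (simp add: k)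
      then show ?thesis using x by (simp add: turn_def rotate_rotate)
    qed
    then show ?thesis using h lab a(1) b False by (intro exI[of _ h]) (auto simp: e k)
  qed
qed

lemma spanning_forest_properties:
  "arbor A UNIV (spanning_forest A vs)" "set vs \<subseteq> set (reach (spanning_forest A vs))"
proof -
  have "arbor A UNIV (spanning_forest A vs) \<and> closed_under A (set (reach (spanning_forest A vs)))
     \<and> set vs \<subseteq> set (reach (spanning_forest A vs))"
  proof (induction vs rule: rev_induct)
    case (snoc u vs)
    let ?T = "spanning_forest A vs"
    have F: "spanning_forest A (vs @ [u]) = (if u \<in> set (reach ?T) then ?T else close A (((u, u), True) # ?T))"
      by (simp add: spanning_forest_def)
    show ?case
    proof (cases "u \<in> set (reach ?T)")
      case False
      then have "arbor A UNIV (((u, u), True) # ?T)" using snoc by simp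
      from close_properties[OF this] show ?thesis using snoc False by (auto simp: F)
    qed (use snoc F in auto)
  qed (simp add: spanning_forest_def closed_under_def)
  then show "arbor A UNIV (spanning_forest A vs)" "set vs \<subseteq> set (reach (spanning_forest A vs))" by auto
qed

section \<open>The label lists of a directed cycle in polynomial time\<close>

lemma pt_rotate1 [pt_intros]:
  fixes f :: "'a :: encodable \<Rightarrow> 'b :: encodable list"
  assumes "pt f" shows "pt (\<lambda>x. rotate1 (f x))"
proof -
  have "rotate1 l = (case l of [] \<Rightarrow> [] | y # ys \<Rightarrow> ys @ [y])" for l :: "'b list" by (cases l) auto
  then show ?thesis by (simp only:) (intro pt_intros assms)
qed

lemma pt_rotate [pt_intros]:
  fixes f :: "'a :: encodable \<Rightarrow> 'b :: encodable list"
  assumes "pt f" shows "pt (\<lambda>x. rotate m (f x))"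
proof (induction m)
  case (Suc m)
  then show ?case by (simp add: pt_rotate1)
qed (simp add: assms)

lemma size_rotate: "size (enc (rotate m l)) = size (enc l)"
proof (induction m)
  case (Suc m)
  have "size (enc (rotate1 l)) = size (enc l)" for l :: "'a list" by (cases l) auto
  then show ?case using Suc by simp
qed simp

text \<open>Each stored list is a rotation of the constant \<open>\<sigma>\<close>, so an entry has
  bounded size although it is computed from earlier entries.\<close>

lemma pt_labels [pt_intros]:
  fixes T :: "'a :: encodable \<Rightarrow> (nat, bool) arc_list"
  assumes "pt T" shows "pt (\<lambda>x. labels \<sigma> (T x))"
  unfolding labels_def foldr_conv_foldl
proof (rule pt_foldl_inv[where C = "\<lambda>x. 2 + size (enc (T x)) + size (enc \<sigma>)"
      and I = "\<lambda>_ M. \<forall>kv \<in> set M. \<exists>m. snd kv = rotate m \<sigma>"])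
  show "pb (\<lambda>x. 2 + size (enc (T x)) + size (enc \<sigma>))" by (intro pb_add pb_const pb_pt assms)
  fix x and M :: "(nat \<times> nat list) list" and e
  assume M: "\<forall>kv \<in> set M. \<exists>m. snd kv = rotate m \<sigma>" and e: "e \<in> set (rev (T x))"
  let ?l = "if fst (fst e) = snd (fst e) then \<sigma> else turn (length \<sigma>) (snd e) (lookup \<sigma> M (fst (fst e)))"
  have "\<exists>m. lookup \<sigma> M (fst (fst e)) = rotate m \<sigma>"
    using lookup_cases[of \<sigma> M "fst (fst e)"] M by (metis rotate0 id_apply)
  then obtain m where m: "?l = rotate m \<sigma>"
    using turn_rotate[of "length \<sigma>" "snd e" _ \<sigma>] by (metis rotate0 id_apply)
  have "size (enc (snd (fst e))) \<le> size (enc (T x))"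
    using size_enc_elem[of e "T x"] e by (simp add: enc_prod_def case_prod_beta)
  then show "(\<forall>kv \<in> set ((snd (fst e), ?l) # M). \<exists>m. snd kv = rotate m \<sigma>) \<and>
      size (enc ((snd (fst e), ?l) # M)) \<le> size (enc M) + (2 + size (enc (T x)) + size (enc \<sigma>))"
    using M unfolding m by (auto simp: size_rotate)
qed (unfold turn_def, (intro pt_intros assms | simp)+)

lemma size_close:
  fixes A T :: "('a :: encodable, 'x :: encodable) arc_list"
  shows "size (enc (close A T)) \<le> size (enc T) + length A * (length A * Suc (size (enc A)))"
  unfolding close_def
  by (intro foldl_measure[where I = "\<lambda>_. True" and m = "\<lambda>T. size (enc T)", THEN conjunct2])
    (simp_all only: size_grow simp_thms)

lemma pt_spanning_forest [pt_intros]: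
  fixes A :: "'a :: encodable \<Rightarrow> (nat, bool) arc_list"
  assumes "pt A" "pt vs" shows "pt (\<lambda>x. spanning_forest (A x) (vs x))"
  unfolding spanning_forest_def
proof (rule pt_foldl_add[where C = "\<lambda>x. 4 + 2 * size (enc (vs x)) + length (A x) * (length (A x) * Suc (size (enc (A x))))"])
  have "pt (\<lambda>z :: 'a \<times> (nat, bool) arc_list \<times> nat. A (fst z))" by (rule pt_comp[OF assms(1)]) (intro pt_intros)
  then show "pt (\<lambda>z :: 'a \<times> (nat, bool) arc_list \<times> nat. if snd (snd z) \<in> set (reach (fst (snd z))) then fst (snd z)
      else close (A (fst z)) (((snd (snd z), snd (snd z)), True) # fst (snd z)))"
    by (intro pt_intros)
  fix x and T :: "(nat, bool) arc_list" and u assume "u \<in> set (vs x)"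
  from size_enc_elem[OF this]
  show "size (enc (if u \<in> set (reach T) then T else close (A x) (((u, u), True) # T)))
      \<le> size (enc T) + (4 + 2 * size (enc (vs x)) + length (A x) * (length (A x) * Suc (size (enc (A x)))))"
    using size_close[of "A x" "((u, u), True) # T"] by auto
qed (intro pt_intros pb_intros pb_pt assms)+

lemma pt_cycle_labels: "pt (cycle_labels \<sigma>)"
proof -
  have *: "cycle_labels \<sigma> M = (\<lambda>y. map (\<lambda>u. (u, lookup \<sigma> (fst y) u)) (snd y))
      (labels \<sigma> (spanning_forest (both_directions (arcs_of M)) [0..<length M]), [0..<length M])" for M
    by (simp add: cycle_labels_def)
  have "pt both_directions" unfolding both_directions_def by (intro pt_intros)
  then have "pt (\<lambda>M. both_directions (arcs_of M))" by (rule pt_comp) (intro pt_intros)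
  then have "pt (\<lambda>M. (labels \<sigma> (spanning_forest (both_directions (arcs_of M)) [0..<length M]), [0..<length M]))"
    by (intro pt_intros)
  then have "pt (\<lambda>M. (\<lambda>y. map (\<lambda>u. (u, lookup \<sigma> (fst y) u)) (snd y))
      (labels \<sigma> (spanning_forest (both_directions (arcs_of M)) [0..<length M]), [0..<length M]))"
    by (rule pt_comp[rotated]) (intro pt_intros)
  then show ?thesis unfolding *[symmetric] .
qed

lemma directed_cycle_isoE:
  assumes "digraph H" "digraph_iso H (with_proj (directed_cycle k))"
  obtains \<phi> where "bij_betw \<phi> (verts H) {0..<k}"
    "\<And>u v. u \<in> verts H \<Longrightarrow> v \<in> verts H \<Longrightarrow> u \<rightarrow>\<^bsub>H\<^esub> v \<longleftrightarrow> \<phi> v = Suc (\<phi> u) mod k"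
proof -
  interpret H: digraph H by fact
  let ?C = "with_proj (directed_cycle k)"
  from assms(2) obtain f where f: "H.digraph_isomorphism f" and C: "?C = app_iso f H"
    unfolding digraph_iso_def by blast
  let ?\<phi> = "iso_verts f"
  have inj: "inj_on ?\<phi> (verts H)" using f by (simp add: H.digraph_isomorphism_def)
  have img: "?\<phi> ` verts H = {0..<k}" using arg_cong[OF C, of verts] by (simp add: directed_cycle_def)
  have ends: "arcs_ends (app_iso f H) = {(i, Suc i mod k) | i. i < k}"
    unfolding C[symmetric] by (simp add: directed_cycle_def)
  have "arcs_ends (app_iso f H) = map_prod ?\<phi> ?\<phi> ` arcs_ends H"
    unfolding arcs_ends_conv using f by (force simp: H.digraph_isomorphism_def image_image)
  then have m: "map_prod ?\<phi> ?\<phi> ` arcs_ends H = {(i, Suc i mod k) | i. i < k}" using ends by simp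
  have "u \<rightarrow>\<^bsub>H\<^esub> v \<longleftrightarrow> ?\<phi> v = Suc (?\<phi> u) mod k" if uv: "u \<in> verts H" "v \<in> verts H" for u v
  proof
    assume "u \<rightarrow>\<^bsub>H\<^esub> v"
    then have "(?\<phi> u, ?\<phi> v) \<in> map_prod ?\<phi> ?\<phi> ` arcs_ends H" by force
    then show "?\<phi> v = Suc (?\<phi> u) mod k" unfolding m by auto
  next
    assume "?\<phi> v = Suc (?\<phi> u) mod k"
    then have "(?\<phi> u, ?\<phi> v) \<in> map_prod ?\<phi> ?\<phi> ` arcs_ends H" unfolding m using img uv by auto
    then obtain a b where ab: "a \<rightarrow>\<^bsub>H\<^esub> b" "?\<phi> a = ?\<phi> u" "?\<phi> b = ?\<phi> v" by auto
    then have "a = u" "b = v" using inj uv H.adj_in_verts[OF ab(1)] by (auto dest: inj_onD)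
    with ab show "u \<rightarrow>\<^bsub>H\<^esub> v" by simp
  qed
  then show ?thesis using that[of ?\<phi>] inj img by (auto simp: bij_betw_def)
qed

lemma mod_add_left_cancel_nat: "(c + a) mod k = (c + b) mod k \<Longrightarrow> a < k \<Longrightarrow> b < k \<Longrightarrow> a = (b :: nat)"
proof -
  have "x = y" if "(c + x) mod k = (c + y) mod k" "x \<le> y" "y < k" for x y
  proof -
    have "k dvd y - x" using mod_eq_dvd_iff_nat[of "c + x" "c + y" k] that by simp
    then show ?thesis using that by (cases "y - x = 0") (auto dest!: dvd_imp_le)
  qed
  then show "(c + a) mod k = (c + b) mod k \<Longrightarrow> a < k \<Longrightarrow> b < k \<Longrightarrow> a = b"
    by (metis nat_le_linear)
qed

lemma cycle_case:
  fixes H :: "('a, 'b) pre_digraph"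
  assumes "digraph H" "k \<ge> 2" "digraph_iso H (with_proj (directed_cycle k))"
  shows "MinHOM_poly_time H"
  unfolding MinHOM_poly_time_def
proof (intro allI impI, elim conjE)
  fix hs assume hs: "distinct hs" "set hs = verts H"
  obtain \<phi> where \<phi>: "bij_betw \<phi> (verts H) {0..<k}"
    "\<And>u v. u \<in> verts H \<Longrightarrow> v \<in> verts H \<Longrightarrow> u \<rightarrow>\<^bsub>H\<^esub> v \<longleftrightarrow> \<phi> v = Suc (\<phi> u) mod k"
    using directed_cycle_isoE[OF assms(1,3)] by blast
  have len: "length hs = k" using distinct_card[OF hs(1)] hs(2) bij_betw_same_card[OF \<phi>(1)] by simp
  have hs_in: "hs ! i \<in> verts H" if "i < k" for i using that len hs(2) nth_mem[of i hs] by simp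
  have "\<exists>i<k. \<phi> (hs ! i) = a" if a: "a < k" for a
  proof -
    obtain x where "x \<in> verts H" "\<phi> x = a" using \<phi>(1) a unfolding bij_betw_def by (metis atLeast0LessThan imageE lessThan_iff)
    then show ?thesis using hs(2) len by (metis in_set_conv_nth)
  qed
  then obtain pos where pos: "\<And>a. a < k \<Longrightarrow> pos a < k \<and> \<phi> (hs ! pos a) = a" by metis
  \<comment> \<open>The positions in \<open>hs\<close> in their order along the cycle, so that
    rotating this list corresponds to walking around the cycle.\<close>
  define \<sigma> where "\<sigma> = map pos [0..<k]"
  have l\<sigma>: "length \<sigma> = k" by (simp add: \<sigma>_def)
  have "inj_on pos {..<k}" by (rule inj_onI) (metis pos lessThan_iff)
  then have "pos ` {..<k} = {..<k}" using pos by (intro endo_inj_surj) auto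
  then have set_\<sigma>: "set \<sigma> = {..<k}" by (simp add: \<sigma>_def atLeast0LessThan)
  have \<sigma>: "\<sigma> ! a < k" "\<phi> (hs ! (\<sigma> ! a)) = a" if "a < k" for a using pos that by (auto simp: \<sigma>_def)
  \<comment> \<open>Used in both directions, the implications between equal thresholds say that the
    two indices are equal.\<close>
  let ?E = "adjacency_list H hs" and ?I = "map (\<lambda>i. (i, i)) [0..<k]"
  have E: "(i, j) \<in> set ?E \<longleftrightarrow> i < k \<and> j < k \<and> \<phi> (hs ! j) = Suc (\<phi> (hs ! i)) mod k" for i j
    unfolding set_adjacency_list len using \<phi>(2) hs_in by auto
  have imp: "implies ?I ?I a b \<longleftrightarrow> a = b" if "a < k" "b < k" for a b
    using that unfolding implies_def by (auto simp: image_iff intro: antisym)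
  show "poly_time_solvable minhom_instances (enc_minhom hs) (minhom_answer H hs)"
  proof (rule poly_time_of_label_lists[where Fw = ?I and Bw = ?I and E = ?E and lab = "cycle_labels \<sigma>"])
    show "hs \<noteq> []" using len assms(2) by auto
    show "pt (cycle_labels \<sigma>)" by (rule pt_cycle_labels)
    show "i \<le> length hs \<and> j \<le> length hs" if "(i, j) \<in> set ?I \<union> set ?I" for i j
      using that len by auto
    fix n :: nat and P :: "nat \<Rightarrow> nat \<Rightarrow> bool"
    define M where "M = map (\<lambda>u. map (P u) [0..<n]) [0..<n]"
    define A where "A = arcs_of M"
    have A: "set A = {(u, v). u < n \<and> v < n \<and> P u v}" unfolding A_def M_def by (rule set_arcs_of)
    define T where "T = spanning_forest (both_directions A) [0..<n]"
    define L where "L u = lookup \<sigma> (labels \<sigma> T) u" for u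
    have len_M: "length M = n" by (simp add: M_def)
    have M: "cycle_labels \<sigma> M = map (\<lambda>u. (u, L u)) [0..<n]"
      unfolding cycle_labels_def Let_def A_def[symmetric] len_M T_def[symmetric] L_def ..
    have L: "length (L u) = k" "set (L u) = {..<k}" for u
    proof -
      obtain m where "L u = rotate m \<sigma>" using labels_rotate[of \<sigma> T u] unfolding L_def by blast
      then show "length (L u) = k" "set (L u) = {..<k}" using l\<sigma> set_\<sigma> by simp_all
    qed
    have "(L u ! a, L v ! b) \<in> set ?E \<longleftrightarrow> implies ?I ?I a b"
      if g: "position_hom ?E k n P g" and uv: "u < n" "v < n" "P u v" and ab: "a < k" "b < k" for g u v a b
    proof -
      have hom: "\<phi> (hs ! g v) mod k = Suc (\<phi> (hs ! g u)) mod k" if "(u, v) \<in> set A" for u v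
        using g that unfolding position_hom_def A E by auto
      have k: "k > 0" using assms(2) by simp
      have "arbor (both_directions A) UNIV T"
        unfolding T_def by (rule spanning_forest_properties(1))
      from labels_correct[OF this l\<sigma> k, of "\<lambda>u. \<phi> (hs ! g u)", OF hom]
      obtain h where h: "\<And>u v. (u, v) \<in> set A \<Longrightarrow> h v mod k = Suc (h u) mod k"
        and "\<And>u. u \<in> set (reach T) \<Longrightarrow> L u = rotate (h u) \<sigma>"
        unfolding L_def by blast
      then have rot: "L u = rotate (h u) \<sigma>" if u: "u < n" for u
        using spanning_forest_properties(2)[of "[0..<n]" "both_directions A"] u unfolding T_def by auto
      have nth: "L u ! a = \<sigma> ! ((h u + a) mod k)" if "u < n" "a < k" for u a
        using rot[OF that(1)] that(2) l\<sigma> by (simp add: nth_rotate)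
      \<comment> \<open>Index \<open>a\<close> at \<open>u\<close> stands for cycle position
        \<open>h u + a\<close>. Since \<open>h v\<close> is one more than \<open>h u\<close> modulo
        \<open>k\<close>, consecutive positions mean equal indices.\<close>
      have "(L u ! a, L v ! b) \<in> set ?E \<longleftrightarrow> (h v + b) mod k = Suc ((h u + a) mod k) mod k"
        unfolding nth[OF uv(1) ab(1)] nth[OF uv(2) ab(2)] E using \<sigma> k by simp
      also have "Suc ((h u + a) mod k) mod k = (Suc (h u) + a) mod k" by (simp add: mod_Suc_eq)
      also have "\<dots> = (h v + a) mod k" using h[of u v] uv A by (intro mod_add_cong) auto
      also have "(h v + b) mod k = (h v + a) mod k \<longleftrightarrow> a = b"
        using mod_add_left_cancel_nat[of "h v" b k a] ab by auto
      finally show ?thesis using imp[OF ab] by simp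
    qed
    then show "\<exists>L. cycle_labels \<sigma> (map (\<lambda>u. map (P u) [0..<n]) [0..<n]) = map (\<lambda>u. (u, L u)) [0..<n] \<and>
       (\<forall>u<n. length (L u) = length hs \<and> set (L u) \<subseteq> {..<length hs}) \<and>
       (\<forall>g. position_hom ?E (length hs) n P g \<longrightarrow> (\<forall>u<n. set (L u) = {..<length hs}) \<and>
         (\<forall>u<n. \<forall>v<n. P u v \<longrightarrow> (\<forall>a<length hs. \<forall>b<length hs. (L u ! a, L v ! b) \<in> set ?E \<longleftrightarrow> implies ?I ?I a b)))"
      unfolding M_def[symmetric] len using M L by (intro exI[of _ L]) simp
  qed (use hs set_adjacency_list in auto)
qed

theorem theorem3p2:
  fixes H :: "('a, 'b) pre_digraph"
  assumes "digraph H"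
    and "connected H"
    and "locally_semicomplete H"
    and "acyclic_digraph H
      \<or> (\<exists>k::nat. k \<ge> 2 \<and> digraph_iso H (with_proj (directed_cycle k)))"
  shows "MinHOM_poly_time H"
  using assms acyclic_case cycle_case by blast

end
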